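(* Let $N\ge 1$ be an integer, let $\sigma_1,\dots,\sigma_N>0$, and let $+\infty=q_0>q_1>\dots>q_{N-1}>q_N=-\infty$. Let $l$ be the index of the phase containing $0$, i.e. $q_l<0<q_{l-1}$. Consider the system for functions $u_k=u_k(x,t)$, $k=1,\dots,N$, $t>0$: $$\frac{\partial u_k}{\partial t}=\frac12\sigma_k^2\frac{\partial^2 u_k}{\partial x^2},\qquad q_k<x<q_{k-1},\quad k=1,\dots,N,$$ $$u_l(x,0)=\delta(x),\qquad u_k(x,0)=0\ \text{ for } k\neq l,$$ $$u_k=u_{k+1}\quad\text{and}\quad \frac12\sigma_k^2\frac{\partial u_k}{\partial x}=\frac12\sigma_{k+1}^2\frac{\partial u_{k+1}}{\partial x}\qquad\text{at } x=q_k,\quad k=1,\dots,N-1,$$ where $\delta$ is the Dirac delta and solutions are required to vanish, together with their $x$-derivative, as $x\to\pm\infty$. Let $u(x,t)=u(x,t;\{q_i\})$ denote the function on $\mathbb{R}\times(0,\infty)$ equal to $u_k(x,t)$ for $q_k<x<q_{k-1}$. Then the solution $u$ of this system (i) is unique; (ii) represents a probability distribution: for every $t>0$, $u(x,t)\ge 0$ for all $x$ and $\int_{-\infty}^{\infty}u(x,t)\,dx=1$; (iii) is a semigroup: for all $0<s<t$ and $x\in\mathbb{R}$, $$u(x,t;\{q_i\})=\int_{-\infty}^{\infty}u(y,s;\{q_i\})\,u(x-y,t-s;\{q_i-y\})\,dy .$$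
   Context: The intervals $(q_k,q_{k-1})$ are called phases and the finite points $q_1,\dots,q_{N-1}$ are the interphase boundaries. The initial condition with the Dirac delta is understood in the usual sense, that $u(\cdot,t)\to\delta$ as $t\to 0^+$ in the sense of distributions. For a real number $y$, $u(x,t;\{q_i-y\})$ denotes the solution of the same system, with the same diffusivities $\sigma_1,\dots,\sigma_N$, but with each interphase boundary $q_i$ replaced by $q_i-y$ (so the phase carrying the initial datum $\delta(x)$ is the one containing $0$ among the shifted intervals $(q_k-y,q_{k-1}-y)$; the finitely many $y$ for which $0$ is itself a shifted boundary are irrelevant in the integral).
   Formalization: Vanishing of u and its x-derivative as x→±∞ is required uniformly for t in (0,T], every T (with decay only at each fixed t, uniqueness fails already for N=1); u_k(x,0)=0 for k≠l is read as continuous attainment at t=0 up to the finite phase end points. *)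

theory Defs
  imports "HOL-Analysis.Analysis"
begin

definition phase :: "(nat \<Rightarrow> ereal) \<Rightarrow> nat \<Rightarrow> real set" where
  "phase q k = {x. q k < ereal x \<and> ereal x < q (k - 1)}"

text \<open>The closed phase adds to the phase its finite end points only.\<close>

definition closed_phase :: "(nat \<Rightarrow> ereal) \<Rightarrow> nat \<Rightarrow> real set" where
  "closed_phase q k = {x. q k \<le> ereal x \<and> ereal x \<le> q (k - 1)}"

definition shifted :: "(nat \<Rightarrow> ereal) \<Rightarrow> real \<Rightarrow> (nat \<Rightarrow> ereal)" where
  "shifted q y = (\<lambda>i. q i - ereal y)"

text \<open>Classical solutions \<open>v\<close> of \<open>v\<^sub>t = (s\<^sup>2/2) v\<^sub>x\<^sub>x\<close> on one phase for \<open>t > 0\<close>.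
  The interface conditions involve \<open>v\<close> and \<open>v\<^sub>x\<close> at the ends of the phase, so both are
  continuous up to the closed phase; \<open>v'\<close> is \<open>v\<^sub>x\<close>, one-sided at the end points.\<close>

definition heat_solution_on_phase ::
    "(nat \<Rightarrow> ereal) \<Rightarrow> nat \<Rightarrow> real \<Rightarrow> (real \<Rightarrow> real \<Rightarrow> real) \<Rightarrow> (real \<Rightarrow> real \<Rightarrow> real) \<Rightarrow> bool" where
  "heat_solution_on_phase q k s v v' \<longleftrightarrow>
     continuous_on (closed_phase q k \<times> {0<..}) (\<lambda>(x, t). v x t) \<and>
     continuous_on (closed_phase q k \<times> {0<..}) (\<lambda>(x, t). v' x t) \<and>
     (\<forall>x\<in>closed_phase q k. \<forall>t>0.
        ((\<lambda>z. v z t) has_real_derivative v' x t) (at x within closed_phase q k)) \<and>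
     (\<exists>v''. continuous_on (phase q k \<times> {0<..}) (\<lambda>(x, t). v'' x t) \<and>
        (\<forall>x\<in>phase q k. \<forall>t>0.
           ((\<lambda>z. v' z t) has_real_derivative v'' x t) (at x) \<and>
           ((\<lambda>r. v x r) has_real_derivative 1 / 2 * s\<^sup>2 * v'' x t) (at t)))"

definition test_function :: "(real \<Rightarrow> real) \<Rightarrow> bool" where
  "test_function \<phi> \<longleftrightarrow>
     (\<forall>n x. ((deriv ^^ n) \<phi>) differentiable (at x)) \<and> compact (closure {x. \<phi> x \<noteq> 0})"

definition tends_to_dirac :: "(real \<Rightarrow> real \<Rightarrow> real) \<Rightarrow> bool" where
  "tends_to_dirac u \<longleftrightarrow>
     (\<forall>\<phi>. test_function \<phi> \<longrightarrow> ((\<lambda>t. LINT x|lborel. u x t * \<phi> x) \<longlongrightarrow> \<phi> 0) (at_right 0))"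

text \<open>\<open>u\<close> is the function on \<open>\<real> \<times> (0,\<infinity>)\<close> glued from the components \<open>v k\<close> (for \<open>u\<^sub>k\<close>) of a
  solution of the system; \<open>v' k\<close> is the \<open>x\<close>-derivative of \<open>v k\<close>. At an interphase boundary, \<open>u\<close>
  takes the common value of the two adjacent components.

  The zero initial data of the components with \<open>k \<noteq> l\<close> are attained continuously on the closed
  phase. Decay at infinity is uniform for \<open>t\<close> in bounded intervals \<open>(0, T]\<close>: without uniformity in
  \<open>t\<close> down to \<open>0\<close>, solutions are not unique even for \<open>N = 1\<close>, since integrating
  \<open>exp (exp z)\<close> against the heat kernel in \<open>x - z\<close> along the boundary of a half-strip
  \<open>Re z > 0, -\<pi> < Im z < \<pi>\<close> gives a nonzero solution that vanishes, with all its
  derivatives, at infinity for each \<open>t > 0\<close> and tends to \<open>0\<close> locally uniformly as \<open>t\<close> tends to \<open>0\<close>.\<close>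

definition multiphase_solution ::
    "nat \<Rightarrow> (nat \<Rightarrow> real) \<Rightarrow> (nat \<Rightarrow> ereal) \<Rightarrow> nat \<Rightarrow> (real \<Rightarrow> real \<Rightarrow> real) \<Rightarrow> bool" where
  "multiphase_solution N \<sigma> q l u \<longleftrightarrow> (\<exists>v v'.
     (\<forall>k\<in>{1..N}. heat_solution_on_phase q k (\<sigma> k) (v k) (v' k)) \<and>
     (\<forall>k\<in>{1..<N}. \<forall>x. ereal x = q k \<longrightarrow> (\<forall>t>0.
        v k x t = v (Suc k) x t \<and>
        1 / 2 * (\<sigma> k)\<^sup>2 * v' k x t = 1 / 2 * (\<sigma> (Suc k))\<^sup>2 * v' (Suc k) x t)) \<and>
     (\<forall>T>0. uniform_limit {0<..T} (v 1) (\<lambda>_. 0) at_top \<and>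
            uniform_limit {0<..T} (v' 1) (\<lambda>_. 0) at_top \<and>
            uniform_limit {0<..T} (v N) (\<lambda>_. 0) at_bot \<and>
            uniform_limit {0<..T} (v' N) (\<lambda>_. 0) at_bot) \<and>
     (\<forall>k\<in>{1..N}. k \<noteq> l \<longrightarrow> (\<forall>x\<in>closed_phase q k.
        ((\<lambda>(z, t). v k z t) \<longlongrightarrow> 0) (at (x, 0) within closed_phase q k \<times> {0<..}))) \<and>
     (\<forall>k\<in>{1..N}. \<forall>x\<in>closed_phase q k. \<forall>t>0. u x t = v k x t) \<and>
     tends_to_dirac u)"

end

theory Submission
  imports Defs
begin

text \<open>
  On each phase the system is a heat equation, and the interface conditions say that \<open>u\<close> and the
  flux \<open>J = a u\<^sub>x\<close>, with \<open>a = \<sigma>\<^sub>k\<^sup>2 / 2\<close> on phase \<open>k\<close>, are continuous across the interfaces. The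
  system is therefore the single divergence-form equation \<open>u\<^sub>t = (a u\<^sub>x)\<^sub>x\<close> in a medium whose
  coefficient \<open>a\<close> is continuous off a finite set. Its operator \<open>A \<psi> = (a \<psi>')'\<close> is symmetric, and all
  statements follow from Green's identity (\<open>green\<close>), applied to \<open>u\<close> and a well-chosen second function.

  The difficulty in uniqueness and positivity is that the initial value \<open>\<delta>\<close> is attained only in the
  sense of distributions, so that no maximum principle and no integral bound on \<open>u\<close> near \<open>t = 0\<close> is
  available at the start. The Laplace transform in time avoids such bounds. Write \<open>\<langle>u, \<psi>\<rangle>\<close> for
  the integral of \<open>u(x,t) \<psi>(x)\<close> over \<open>x\<close>. For \<open>\<lambda> > 0\<close> and \<open>f \<ge> 0\<close> let \<open>\<psi> = R\<^sub>\<lambda> f\<close> be the bounded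
  solution of \<open>\<lambda> \<psi> - A \<psi> = f\<close>. Green's identity gives
  \<open>d/dt \<langle>u, R\<^sub>\<lambda> f\<rangle> = \<lambda> \<langle>u, R\<^sub>\<lambda> f\<rangle> - \<langle>u, f\<rangle>\<close> (\<open>pairing_resolvent_deriv\<close>), and \<open>\<langle>u, R\<^sub>\<lambda> f\<rangle>\<close>
  tends to \<open>R\<^sub>\<lambda> f\<close> at the source as \<open>t\<close> tends to \<open>0\<close> (\<open>initial_pairing\<close>), because \<open>R\<^sub>\<lambda> f\<close> agrees with
  a smooth function on the phase of the source and \<open>u\<close> tends uniformly to \<open>0\<close> elsewhere. Iterating the
  resolvent expresses the integrals of \<open>s\<^sup>n exp(-\<lambda>s) \<langle>u(s), f\<rangle>\<close> through the numbers
  \<open>R\<^sub>\<lambda>\<^sup>n f\<close> at the source, which are nonnegative and do not depend on the solution, up to an error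
  caused by the final time. With \<open>\<lambda>\<close> proportional to \<open>n\<close> the weights concentrate at one point and the
  error is negligible; this is the Post-Widder inversion formula (\<open>post_widder_nonneg\<close>). It yields
  \<open>u \<ge> 0\<close>, and, applied to differences of two solutions, uniqueness. The resolvent exists and is
  positive because it is the limit of a monotone iteration with an explicit positive kernel
  (\<open>resolvent_exists\<close>). Total mass \<open>1\<close> follows from the decay of the flux (\<open>solution_mass\<close>).

  For the semigroup property let \<open>G\<^sub>y\<close> be the solution with source \<open>y\<close>. Symmetry of \<open>A\<close> makes the
  integral of \<open>G\<^sub>x(z,r) G\<^sub>y(z,t-r)\<close> over \<open>z\<close> independent of \<open>r\<close>; its limit at \<open>r = 0\<close> is \<open>G\<^sub>y(x,t)\<close>
  since \<open>G\<^sub>x\<close> is a probability density contracting to \<open>x\<close> (\<open>duality\<close>). Exchanging the roles of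
  \<open>x\<close> and \<open>y\<close> gives \<open>G\<^sub>y(x,t) = G\<^sub>x(y,t)\<close> (\<open>symmetry\<close>), and together these are the semigroup identity
  at every \<open>x\<close> that is not an interface. An interface point is not the source of any given solution;
  there the identity follows by letting \<open>x\<close> vary, with dominated convergence justified by a bound on
  \<open>G\<^sub>y(x,t)\<close> that is uniform in \<open>x\<close> and \<open>y\<close> (\<open>off_diagonal_bound\<close>).
\<close>

section \<open>Smooth functions and plateaus\<close>

definition smooth :: "(real \<Rightarrow> real) \<Rightarrow> bool" where
  "smooth f \<longleftrightarrow> (\<forall>n x. ((deriv ^^ n) f) differentiable (at x))"

text \<open>The closure properties of smooth functions below are instances of this principle: it suffices to
  exhibit a class of functions that is closed under differentiation, so that iterated derivatives
  never have to be computed.\<close>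

lemma smooth_coinduct:
  assumes "f \<in> S"
    and step: "\<And>g. g \<in> S \<Longrightarrow> \<exists>g'\<in>S. \<forall>x. (g has_real_derivative g' x) (at x)"
  shows "smooth f"
proof -
  have S_deriv: "deriv g \<in> S \<and> (\<forall>x. g differentiable (at x))" if "g \<in> S" for g
  proof -
    obtain g' where g': "g' \<in> S" "\<And>x. (g has_real_derivative g' x) (at x)"
      using step[OF \<open>g \<in> S\<close>] by blast
    moreover have "deriv g = g'"
      using g'(2) DERIV_imp_deriv by blast
    ultimately show ?thesis
      using real_differentiable_def by auto
  qed
  have "(deriv ^^ n) f \<in> S" for n
    by (induction n) (use assms(1) S_deriv in auto)
  then show ?thesis
    unfolding smooth_def using S_deriv by blast
qed

lemma smooth_deriv:
  assumes "smooth f"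
  shows "smooth (deriv f)" "(f has_real_derivative deriv f x) (at x)"
proof -
  have "((deriv ^^ n) (deriv f)) differentiable (at x)" for n x
    using assms unfolding smooth_def
    by (metis funpow_Suc_right o_apply)
  then show "smooth (deriv f)"
    unfolding smooth_def by blast
  have "((deriv ^^ 0) f) differentiable (at x)"
    using assms unfolding smooth_def by blast
  then show "(f has_real_derivative deriv f x) (at x)"
    by (simp add: DERIV_deriv_iff_real_differentiable)
qed

lemma smooth_continuous: "smooth f \<Longrightarrow> continuous_on UNIV f"
  by (meson DERIV_continuous_on UNIV_I smooth_deriv(2))

lemma smooth_antideriv:
  assumes "\<And>x. (f has_real_derivative g x) (at x)" "smooth g"
  shows "smooth f"
proof (rule smooth_coinduct[where S = "insert f {g. smooth g}"])
  fix h assume "h \<in> insert f {g. smooth g}"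
  then show "\<exists>h'\<in>insert f {g. smooth g}. \<forall>x. (h has_real_derivative h' x) (at x)"
    using assms smooth_deriv by (cases "h = f") blast+
qed auto

lemma smooth_const: "smooth (\<lambda>x. c)"
proof (rule smooth_coinduct[where S = "range (\<lambda>c x. c)"])
  fix g :: "real \<Rightarrow> real"
  assume "g \<in> range (\<lambda>c x. c)"
  then show "\<exists>g'\<in>range (\<lambda>c x. c). \<forall>x. (g has_real_derivative g' x) (at x)"
    by (intro bexI[of _ "\<lambda>x. 0"]) auto
qed auto

text \<open>By the product rule the derivative of a product is a sum of two products; the closure of products
  under sums is therefore closed under differentiation.\<close>

inductive_set products :: "(real \<Rightarrow> real) set" where
  products_mult: "smooth f \<Longrightarrow> smooth g \<Longrightarrow> (\<lambda>x. f x * g x) \<in> products"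
| products_add: "f \<in> products \<Longrightarrow> g \<in> products \<Longrightarrow> (\<lambda>x. f x + g x) \<in> products"

lemma products_smooth:
  assumes "f \<in> products" shows "smooth f"
proof (rule smooth_coinduct[OF assms])
  fix g assume "g \<in> products"
  then show "\<exists>g'\<in>products. \<forall>x. (g has_real_derivative g' x) (at x)"
  proof (induction rule: products.induct)
    case (products_mult f g)
    have d: "(\<lambda>x. deriv f x * g x + f x * deriv g x) \<in> products"
      using products_mult smooth_deriv(1) by (intro products.intros) auto
    have "((\<lambda>x. f x * g x) has_real_derivative (deriv f x * g x + f x * deriv g x)) (at x)" for x
      using DERIV_mult[OF smooth_deriv(2)[of f x] smooth_deriv(2)[of g x]] products_mult
      by (simp add: algebra_simps)
    then show ?case
      by (intro bexI[OF _ d]) blast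
  next
    case (products_add f g)
    then obtain f' g' where "f' \<in> products" "\<forall>x. (f has_real_derivative f' x) (at x)"
      "g' \<in> products" "\<forall>x. (g has_real_derivative g' x) (at x)" by blast
    then show ?case
      by (intro bexI[of _ "\<lambda>x. f' x + g' x"]) (auto intro!: derivative_eq_intros products.intros)
  qed
qed

lemma smooth_mult: "smooth f \<Longrightarrow> smooth g \<Longrightarrow> smooth (\<lambda>x. f x * g x)"
  by (rule products_smooth) (rule products_mult)

lemma smooth_add:
  assumes "smooth f" "smooth g"
  shows "smooth (\<lambda>x. f x + g x)"
proof -
  have "(\<lambda>x. f x * 1 + g x * 1) \<in> products"
    using assms by (intro products.intros smooth_const)
  then show ?thesis using products_smooth by simp
qed

lemma smooth_affine_comp:
  assumes "smooth f" shows "smooth (\<lambda>x. f (c * x + d))"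
proof (rule smooth_coinduct[where S = "{\<lambda>x. k * g (c * x + d) | k g. smooth g}"])
  show "(\<lambda>x. f (c * x + d)) \<in> {\<lambda>x. k * g (c * x + d) | k g. smooth g}"
    using assms by (auto intro!: exI[of _ 1])
next
  fix h assume "h \<in> {\<lambda>x. k * g (c * x + d) | k g. smooth g}"
  then obtain k g where g: "smooth g" and h: "h = (\<lambda>x. k * g (c * x + d))" by blast
  have *: "(h has_real_derivative k * c * deriv g (c * x + d)) (at x)" for x
    unfolding h
    by (auto intro!: derivative_eq_intros DERIV_chain2[OF smooth_deriv(2)[OF g]])
  show "\<exists>h'\<in>{\<lambda>x. k * g (c * x + d) | k g. smooth g}. \<forall>x. (h has_real_derivative h' x) (at x)"
    by (rule bexI[of _ "\<lambda>x. (k * c) * deriv g (c * x + d)"]) (use * g smooth_deriv(1) in auto)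
qed

lemma smooth_exp: "smooth (\<lambda>x. exp (c * x))"
proof -
  have "smooth exp"
    by (rule smooth_coinduct[where S = "{exp}"]) (auto intro: DERIV_exp)
  from smooth_affine_comp[OF this, of c 0] show ?thesis by simp
qed

text \<open>Functions of the form \<open>h / g\<^sup>n\<close> with \<open>h\<close> smooth are closed under differentiation; the exponent
  has to be allowed to grow.\<close>

lemma smooth_divide:
  assumes "smooth f" "smooth g" and pos: "\<And>x. g x \<noteq> 0"
  shows "smooth (\<lambda>x. f x / g x)"
proof (rule smooth_coinduct[where S = "{\<lambda>x. h x / g x ^ n | h n. smooth h}"])
  show "(\<lambda>x. f x / g x) \<in> {\<lambda>x. h x / g x ^ n | h n. smooth h}"
    using assms by (auto intro!: exI[of _ f] exI[of _ 1])
next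
  fix p assume "p \<in> {\<lambda>x. h x / g x ^ n | h n. smooth h}"
  then obtain h n where h: "smooth h" and p: "p = (\<lambda>x. h x / g x ^ n)" by blast
  define h' where "h' = (\<lambda>x. deriv h x * g x + - (real n) * (h x * deriv g x))"
  have "smooth h'"
    unfolding h'_def using h assms smooth_deriv(1)
    by (intro smooth_add smooth_mult smooth_const) auto
  moreover have "(p has_real_derivative h' x / g x ^ Suc n) (at x)" for x
  proof -
    have "(p has_real_derivative
        (deriv h x * g x ^ n - h x * (real n * g x ^ (n - 1) * deriv g x)) / (g x ^ n * g x ^ n)) (at x)"
      unfolding p using pos
      by (auto intro!: derivative_eq_intros smooth_deriv(2)[OF h] smooth_deriv(2)[OF assms(2)])
    also have "(deriv h x * g x ^ n - h x * (real n * g x ^ (n - 1) * deriv g x)) / (g x ^ n * g x ^ n)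
        = h' x / g x ^ Suc n"
      using pos[of x] by (cases n) (auto simp: h'_def field_simps)
    finally show ?thesis .
  qed
  moreover have "(\<lambda>x. h' x / g x ^ Suc n) \<in> {\<lambda>x. h x / g x ^ n | h n. smooth h}"
    using \<open>smooth h'\<close> by blast
  ultimately show "\<exists>p'\<in>{\<lambda>x. h x / g x ^ n | h n. smooth h}. \<forall>x. (p has_real_derivative p' x) (at x)"
    by (intro bexI[of _ "\<lambda>x. h' x / g x ^ Suc n"]) simp_all
qed

lemma poly_exp_decay:
  fixes p :: "real poly"
  shows "((\<lambda>y. y ^ n * poly p y * exp (- y)) \<longlongrightarrow> 0) at_top"
proof (induction p arbitrary: n)
  case 0
  show ?case by simp
next
  case (pCons c p)
  have 1: "((\<lambda>y::real. c * (y ^ n / exp y)) \<longlongrightarrow> c * 0) at_top"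
    by (intro tendsto_intros tendsto_power_div_exp_0)
  have "((\<lambda>y. c * (y ^ n / exp y) + y ^ Suc n * poly p y * exp (- y)) \<longlongrightarrow> c * 0 + 0) at_top"
    by (intro tendsto_add 1 pCons.IH)
  then show ?case
    by (simp add: exp_minus field_simps)
qed

definition flat_exp :: "real \<Rightarrow> real" where
  "flat_exp x = (if x \<le> 0 then 0 else exp (- inverse x))"

text \<open>All derivatives have the form \<open>p(1/x) exp(-1/x)\<close> on the right half-line, where \<open>p\<close> is a
  polynomial. They fit together with the zero function at \<open>0\<close> because \<open>y p(y) exp(-y)\<close> tends to
  \<open>0\<close> as \<open>y = 1/x\<close> tends to infinity.\<close>

lemma smooth_flat_exp: "smooth flat_exp"
proof (rule smooth_coinduct[where S = "range (\<lambda>p x. if x \<le> 0 then 0 else poly p (inverse x) * exp (- inverse x))"])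
  show "flat_exp \<in> range (\<lambda>p x. if x \<le> 0 then 0 else poly p (inverse x) * exp (- inverse x))"
    by (auto simp: flat_exp_def image_iff fun_eq_iff intro!: exI[of _ "[:1:]"])
next
  fix g :: "real \<Rightarrow> real"
  assume "g \<in> range (\<lambda>p x. if x \<le> 0 then 0 else poly p (inverse x) * exp (- inverse x))"
  then obtain p where g: "g = (\<lambda>x. if x \<le> 0 then 0 else poly p (inverse x) * exp (- inverse x))" by blast
  \<comment> \<open>Differentiating \<open>p(1/x) exp(-1/x)\<close> gives the polynomial \<open>y\<^sup>2 (p(y) - p'(y))\<close> in \<open>y = 1/x\<close>.\<close>
  define r where "r = [:0, 0, 1:] * (p - pderiv p)"
  have "(g has_real_derivative (if x \<le> 0 then 0 else poly r (inverse x) * exp (- inverse x))) (at x)" for x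
  proof -
    consider "x < 0" | "x > 0" | "x = 0" by linarith
    then show ?thesis
    proof cases
      case 1
      have "((\<lambda>x. 0) has_real_derivative 0) (at x)" by simp
      then have "(g has_real_derivative 0) (at x)"
        by (rule DERIV_cong_ev[THEN iffD2, OF refl _ refl, rotated])
          (use 1 in \<open>auto simp: g intro!: eventually_mono[OF eventually_nhds_in_open[of "{..<0}" x]]\<close>)
      then show ?thesis using 1 by simp
    next
      case 2
      have "((\<lambda>x. poly p (inverse x) * exp (- inverse x)) has_real_derivative
          (poly r (inverse x) * exp (- inverse x))) (at x)"
        using 2 unfolding r_def
        by (auto intro!: derivative_eq_intros DERIV_chain2[OF poly_DERIV] simp: field_simps power2_eq_square)
      then have "(g has_real_derivative poly r (inverse x) * exp (- inverse x)) (at x)"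
        by (rule DERIV_cong_ev[THEN iffD2, OF refl _ refl, rotated])
          (use 2 in \<open>auto simp: g intro!: eventually_mono[OF eventually_nhds_in_open[of "{0<..}" x]]\<close>)
      then show ?thesis using 2 by simp
    next
      case 3
      have "((\<lambda>y. y ^ 1 * poly p y * exp (- y)) \<longlongrightarrow> 0) at_top"
        by (rule poly_exp_decay)
      then have "((\<lambda>x. inverse x ^ 1 * poly p (inverse x) * exp (- inverse x)) \<longlongrightarrow> 0) (at_right 0)"
        by (rule filterlim_compose[OF _ filterlim_inverse_at_top_right])
      then have r: "((\<lambda>h. (g (0 + h) - g 0) / h) \<longlongrightarrow> 0) (at_right 0)"
        by (rule Lim_transform_eventually)
          (auto simp: g field_simps eventually_at_right_field intro!: exI[of _ 1])
      have l: "((\<lambda>h. (g (0 + h) - g 0) / h) \<longlongrightarrow> 0) (at_left 0)"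
        by (rule tendsto_eventually)
          (auto simp: g field_simps eventually_at_left_field intro!: exI[of _ "-1"])
      have "(g has_real_derivative 0) (at 0)"
        unfolding DERIV_def using filterlim_split_at[OF l r] by simp
      then show ?thesis using 3 by simp
    qed
  qed
  then show "\<exists>g'\<in>range (\<lambda>p x. if x \<le> 0 then 0 else poly p (inverse x) * exp (- inverse x)).
      \<forall>x. (g has_real_derivative g' x) (at x)"
    by (intro bexI[of _ "\<lambda>x. if x \<le> 0 then 0 else poly r (inverse x) * exp (- inverse x)"]) auto
qed

text \<open>The quotient \<open>flat_exp x / (flat_exp x + flat_exp (1 - x))\<close> is a smooth step from \<open>0\<close> on the
  left of \<open>0\<close> to \<open>1\<close> on the right of \<open>1\<close>. An increasing and a decreasing step of width \<open>\<delta>\<close>,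
  multiplied, form the plateau.\<close>

lemma plateau:
  assumes "\<alpha> \<le> \<beta>" "0 < (\<delta>::real)"
  obtains \<phi> where "test_function \<phi>" "\<And>x. 0 \<le> \<phi> x" "\<And>x. \<phi> x \<le> 1"
    "\<And>x. x \<in> {\<alpha>..\<beta>} \<Longrightarrow> \<phi> x = 1" "\<And>x. x \<notin> {\<alpha>-\<delta><..<\<beta>+\<delta>} \<Longrightarrow> \<phi> x = 0"
proof -
  define s where "s = (\<lambda>x. flat_exp x / (flat_exp x + flat_exp (-1 * x + 1)))"
  have pos: "flat_exp x \<ge> 0" for x by (simp add: flat_exp_def)
  have nz: "flat_exp x + flat_exp (-1 * x + 1) \<noteq> 0" for x
    by (auto simp: flat_exp_def add_nonneg_eq_0_iff)
  have "smooth s"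
    unfolding s_def
    by (intro smooth_divide smooth_add smooth_affine_comp smooth_flat_exp nz)
  have s01: "0 \<le> s x" "s x \<le> 1" for x
    using pos[of x] pos[of "-1*x+1"] nz[of x] by (auto simp: s_def divide_le_eq_1)
  have s0: "s x = 0" if "x \<le> 0" for x using that by (simp add: s_def flat_exp_def)
  have s1: "s x = 1" if "x \<ge> 1" for x using that by (simp add: s_def flat_exp_def)
  define \<phi> where "\<phi> = (\<lambda>x. s (1/\<delta> * x + (\<delta> - \<alpha>)/\<delta>) * s (-1/\<delta> * x + (\<beta> + \<delta>)/\<delta>))"
  have "smooth \<phi>"
    unfolding \<phi>_def by (intro smooth_mult smooth_affine_comp \<open>smooth s\<close>)
  have out: "\<phi> x = 0" if "x \<notin> {\<alpha>-\<delta><..<\<beta>+\<delta>}" for x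
  proof -
    have "1/\<delta> * x + (\<delta> - \<alpha>)/\<delta> \<le> 0 \<or> -1/\<delta> * x + (\<beta> + \<delta>)/\<delta> \<le> 0"
    proof (cases "x \<le> \<alpha> - \<delta>")
      case True
      then have "(x + (\<delta> - \<alpha>)) / \<delta> \<le> 0" using assms by (simp add: divide_nonpos_pos)
      then show ?thesis by (simp add: add_divide_distrib)
    next
      case False
      then have "(- x + (\<beta> + \<delta>)) / \<delta> \<le> 0" using assms that by (simp add: divide_nonpos_pos)
      then show ?thesis by (simp add: add_divide_distrib diff_divide_distrib)
    qed
    then show ?thesis unfolding \<phi>_def using s0 by auto
  qed
  have "{x. \<phi> x \<noteq> 0} \<subseteq> {\<alpha>-\<delta>..\<beta>+\<delta>}"
  proof
    fix x assume "x \<in> {x. \<phi> x \<noteq> 0}"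
    then have "x \<in> {\<alpha>-\<delta><..<\<beta>+\<delta>}" using out by blast
    then show "x \<in> {\<alpha>-\<delta>..\<beta>+\<delta>}" by auto
  qed
  then have "bounded (closure {x. \<phi> x \<noteq> 0})"
    by (meson bounded_closure bounded_closed_interval bounded_subset)
  then have "test_function \<phi>"
    using \<open>smooth \<phi>\<close> by (simp add: test_function_def smooth_def compact_eq_bounded_closed)
  moreover have "\<phi> x = 1" if "x \<in> {\<alpha>..\<beta>}" for x
  proof -
    have "1/\<delta> * x + (\<delta> - \<alpha>)/\<delta> \<ge> 1" "-1/\<delta> * x + (\<beta> + \<delta>)/\<delta> \<ge> 1"
      using that assms by (auto simp: field_simps)
    then show ?thesis unfolding \<phi>_def using s1 by auto
  qed
  moreover have "0 \<le> \<phi> x" "\<phi> x \<le> 1" for x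
    unfolding \<phi>_def using s01 by (auto simp: mult_le_one)
  ultimately show ?thesis using that out by blast
qed

lemma test_function_smooth: "test_function \<phi> \<Longrightarrow> smooth \<phi>"
  by (simp add: test_function_def smooth_def)

lemma test_function_mult_smooth:
  assumes "test_function \<phi>" "smooth f"
  shows "test_function (\<lambda>x. f x * \<phi> x)"
proof -
  have sm: "smooth (\<lambda>x. f x * \<phi> x)"
    by (rule smooth_mult[OF assms(2) test_function_smooth[OF assms(1)]])
  have "closure {x. f x * \<phi> x \<noteq> 0} \<subseteq> closure {x. \<phi> x \<noteq> 0}"
    by (intro closure_mono) auto
  then have c: "compact (closure {x. f x * \<phi> x \<noteq> 0})"
    using assms(1) unfolding test_function_def
    by (auto simp: compact_eq_bounded_closed intro: bounded_subset)
  from sm c show ?thesis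
    by (simp add: test_function_def smooth_def)
qed

lemma test_function_bounded_support:
  assumes "test_function \<phi>"
  obtains R where "R > 0" "\<And>x. \<bar>x\<bar> > R \<Longrightarrow> \<phi> x = 0"
proof -
  have "bounded {x. \<phi> x \<noteq> 0}"
    using assms unfolding test_function_def
    by (meson bounded_subset closure_subset compact_imp_bounded)
  then obtain R where "\<forall>x\<in>{x. \<phi> x \<noteq> 0}. \<bar>x\<bar> \<le> R"
    by (auto simp: bounded_iff)
  then show ?thesis
    by (intro that[of "max R 1"]) force+
qed

lemma integrable_compact_support:
  fixes f :: "real \<Rightarrow> real"
  assumes "continuous_on UNIV f" "\<And>x. \<bar>x\<bar> > R \<Longrightarrow> f x = 0"
  shows "integrable lborel f"
proof -
  have "set_integrable lborel {-R..R} f"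
    by (rule borel_integrable_atLeastAtMost') (use assms continuous_on_subset in blast)
  moreover have "(\<lambda>x. indicator {-R..R} x *\<^sub>R f x) = f"
  proof
    fix x show "indicator {-R..R} x *\<^sub>R f x = f x"
      using assms(2)[of x] by (cases "\<bar>x\<bar> > R") (auto simp: indicator_def abs_le_iff)
  qed
  ultimately show ?thesis by (simp add: set_integrable_def)
qed

lemma test_function_integrable: "test_function \<phi> \<Longrightarrow> integrable lborel \<phi>"
  by (rule test_function_bounded_support) (auto intro: integrable_compact_support smooth_continuous test_function_smooth)

lemma bump:
  fixes x \<delta> :: real
  assumes "0 < \<delta>"
  obtains f where "test_function f" "\<And>z. 0 \<le> f z" "\<And>z. z \<notin> {x - \<delta><..<x + \<delta>} \<Longrightarrow> f z = 0"
    "0 < (LINT z|lborel. f z)"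
proof -
  let ?I = "{x - \<delta>/2..x + \<delta>/2}"
  obtain f where f: "test_function f" "\<And>z. 0 \<le> f z" "\<And>z. f z \<le> 1" "\<And>z. z \<in> ?I \<Longrightarrow> f z = 1"
    "\<And>z. z \<notin> {x - \<delta>/2 - \<delta>/2<..<x + \<delta>/2 + \<delta>/2} \<Longrightarrow> f z = 0"
    by (rule plateau[of "x - \<delta>/2" "x + \<delta>/2" "\<delta>/2"]) (use assms in auto)
  have "\<delta> = (LINT z|lborel. indicator ?I z)" using assms by simp
  also have "\<dots> \<le> (LINT z|lborel. f z)"
  proof (rule integral_mono[OF _ test_function_integrable[OF f(1)]])
    show "integrable lborel (indicator ?I :: real \<Rightarrow> real)"
      by (intro integrable_real_indicator) (auto simp: emeasure_lborel_cbox_finite[of "x - \<delta>/2" "x + \<delta>/2", simplified])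
    show "indicator ?I z \<le> f z" for z
      using f(2,4)[of z] by (auto simp: indicator_def)
  qed
  finally have "0 < (LINT z|lborel. f z)" using assms by linarith
  moreover have "f z = 0" if "z \<notin> {x - \<delta><..<x + \<delta>}" for z
    using that by (intro f(5)) auto
  ultimately show ?thesis using that f(1,2) by blast
qed

section \<open>The divergence form of the system\<close>

lemma continuous_on_slices:
  assumes "continuous_on (A \<times> T) (\<lambda>(x, t). f x t)"
  shows "t \<in> T \<Longrightarrow> continuous_on A (\<lambda>x. f x t)" "x \<in> A \<Longrightarrow> continuous_on T (f x)"
proof -
  show "continuous_on A (\<lambda>x. f x t)" if "t \<in> T"
    using continuous_on_compose2[OF assms continuous_on_Pair[OF continuous_on_id continuous_on_const[of A t]]] that
    by (auto simp: image_subset_iff)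
  show "continuous_on T (f x)" if "x \<in> A"
    using continuous_on_compose2[OF assms continuous_on_Pair[OF continuous_on_const[of T x] continuous_on_id]] that
    by (auto simp: image_subset_iff)
qed

text \<open>Near a point of \<open>B\<close> the derivative \<open>Q'\<close> need not be integrable over the space-time rectangle, so
  the order of integration cannot be exchanged. Integrating over time first avoids this: the time
  integral of \<open>Q\<close> is continuous in \<open>x\<close> across \<open>B\<close>, off \<open>B\<close> it may be differentiated under the
  integral sign, and the fundamental theorem of calculus tolerates finitely many exceptional points.\<close>

lemma divergence_has_integral:
  fixes Q Q' :: "real \<Rightarrow> real \<Rightarrow> real"
  assumes "finite B" "\<alpha> \<le> \<beta>"
    and contQ: "continuous_on (UNIV \<times> {s..t}) (\<lambda>(x, r). Q x r)"
    and derQ: "\<And>x r. x \<notin> B \<Longrightarrow> r \<in> {s..t} \<Longrightarrow> ((\<lambda>x. Q x r) has_real_derivative Q' x r) (at x)"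
    and contQ': "continuous_on ((- B) \<times> {s..t}) (\<lambda>(x, r). Q' x r)"
  shows "((\<lambda>x. integral {s..t} (Q' x)) has_integral
      (integral {s..t} (Q \<beta>) - integral {s..t} (Q \<alpha>))) {\<alpha>..\<beta>}"
proof (rule fundamental_theorem_of_calculus_interior_strong[OF assms(1,2)])
  show "continuous_on {\<alpha>..\<beta>} (\<lambda>x. integral {s..t} (Q x))"
    using integral_continuous_on_param[of UNIV s t Q] contQ
    by (auto intro: continuous_on_subset)
next
  fix x assume "x \<in> {\<alpha><..<\<beta>} - B"
  then have "x \<notin> B" by blast
  moreover have "open (- B)" using \<open>finite B\<close> by (simp add: finite_imp_closed open_Compl)
  ultimately obtain e where e: "e > 0" "ball x e \<subseteq> - B"
    by (meson Compl_iff openE)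
  have "((\<lambda>x. integral (cbox s t) (Q x)) has_field_derivative integral (cbox s t) (Q' x)) (at x within ball x e)"
  proof (rule leibniz_rule_field_derivative)
    fix y r assume "y \<in> ball x e" "r \<in> cbox s t"
    then show "((\<lambda>x. Q x r) has_real_derivative Q' y r) (at y within ball x e)"
      using derQ[of y r] subsetD[OF e(2), of y] by (auto intro: has_field_derivative_at_within)
  next
    fix y
    show "Q y integrable_on cbox s t"
      using continuous_on_slices(2)[OF contQ, of y] by (simp add: integrable_continuous_real)
  next
    show "continuous_on (ball x e \<times> cbox s t) (\<lambda>(x, t). Q' x t)"
      by (rule continuous_on_subset[OF contQ']) (use e in auto)
  qed (use e in auto)
  then show "((\<lambda>x. integral {s..t} (Q x)) has_vector_derivative integral {s..t} (Q' x)) (at x)"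
    using e(1) by (simp add: has_real_derivative_iff_has_vector_derivative at_within_open[of x "ball x e"])
qed

lemma integral_symmetric_tendsto:
  fixes f :: "real \<Rightarrow> real"
  assumes "integrable lborel f"
  shows "(\<lambda>n. integral {- real n..real n} f) \<longlonglongrightarrow> (LINT x|lborel. f x)"
proof -
  have "(\<lambda>n. LINT x|lborel. indicator {- real n..real n} x *\<^sub>R f x) \<longlonglongrightarrow> (LINT x|lborel. f x)"
  proof (rule integral_dominated_convergence[where w = "\<lambda>x. \<bar>f x\<bar>"])
    show "AE x in lborel. (\<lambda>n. indicator {- real n..real n} x *\<^sub>R f x) \<longlonglongrightarrow> f x"
    proof (rule AE_I2, rule tendsto_eventually)
      fix x :: real
      obtain N where "\<bar>x\<bar> \<le> real N" using real_arch_simple by blast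
      then show "\<forall>\<^sub>F n in sequentially. indicator {- real n..real n} x *\<^sub>R f x = f x"
        by (intro eventually_sequentiallyI[of N]) (auto simp: indicator_def abs_le_iff)
    qed
  qed (use assms in \<open>auto simp: indicator_def\<close>)
  moreover have "(LINT x|lborel. indicator {- real n..real n} x *\<^sub>R f x) = integral {- real n..real n} f" for n
    using set_borel_integral_eq_integral(2)[of "{- real n..real n}" f]
      integrable_mult_indicator[OF _ assms, of "{- real n..real n}"]
    by (simp add: set_lebesgue_integral_def set_integrable_def)
  ultimately show ?thesis by simp
qed

lemma nonneg_integrable_windows:
  fixes f :: "real \<Rightarrow> real"
  assumes [measurable]: "f \<in> borel_measurable lborel" and nn: "\<And>x. 0 \<le> f x"
    and window: "\<And>n. \<exists>I. (f has_integral I) {- real n..real n} \<and> I \<le> C"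
  shows "integrable lborel f" "(LINT x|lborel. f x) \<le> C"
proof -
  define F where "F = (\<lambda>n::nat. \<lambda>x. ennreal (f x) * indicator {- real n..real n} x)"
  have "integral\<^sup>N lborel (F n) \<le> ennreal C" for n
  proof -
    obtain I where I: "(f has_integral I) {- real n..real n}" "I \<le> C" using window by blast
    have "integral\<^sup>N lborel (F n) = ennreal I"
      unfolding F_def by (rule nn_integral_has_integral_lebesgue'[OF nn I(1)])
    then show ?thesis using I(2) by (simp add: ennreal_leI)
  qed
  moreover have "(\<integral>\<^sup>+x. ennreal (f x) \<partial>lborel) = (SUP n. integral\<^sup>N lborel (F n))"
  proof -
    have "(SUP n. F n x) = ennreal (f x)" for x
    proof (rule antisym)
      show "(SUP n. F n x) \<le> ennreal (f x)"
        by (intro SUP_least) (auto simp: F_def indicator_def)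
      obtain n where "\<bar>x\<bar> \<le> real n" using real_arch_simple by blast
      then have "F n x = ennreal (f x)" by (auto simp: F_def indicator_def)
      then show "ennreal (f x) \<le> (SUP n. F n x)" by (metis SUP_upper UNIV_I)
    qed
    moreover have "incseq F" by (auto simp: F_def incseq_def le_fun_def indicator_def)
    moreover have "F n \<in> borel_measurable lborel" for n unfolding F_def by measurable
    ultimately show ?thesis using nn_integral_monotone_convergence_SUP[of F lborel] by simp
  qed
  ultimately have le: "(\<integral>\<^sup>+x. ennreal (f x) \<partial>lborel) \<le> ennreal C" by (simp add: SUP_least)
  show int: "integrable lborel f"
    by (rule integrableI_nonneg) (use nn le in \<open>auto simp: le_less_trans[OF _ ennreal_less_top]\<close>)
  have "0 \<le> C" using window[of 0] has_integral_nonneg nn by (metis order_trans)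
  then show "(LINT x|lborel. f x) \<le> C"
    using le nn_integral_eq_integral[OF int] nn by (simp add: ennreal_le_iff)
qed

text \<open>In all applications \<open>b\<close> is the flux through the point \<open>x\<close> that Green's identity on a bounded
  interval leaves at the end points.\<close>

lemma boundary_integrals_vanish:
  fixes b :: "real \<Rightarrow> real \<Rightarrow> real"
  assumes cont: "\<And>x. continuous_on {s..t} (b x)"
    and small: "\<And>\<epsilon>. \<epsilon> > 0 \<Longrightarrow> \<exists>R. \<forall>x r. \<bar>x\<bar> \<ge> R \<and> r \<in> {s..t} \<longrightarrow> \<bar>b x r\<bar> \<le> \<epsilon>"
    and "s \<le> t"
  shows "(\<lambda>n. integral {s..t} (b (real n)) - integral {s..t} (b (- real n))) \<longlonglongrightarrow> 0"
proof (rule tendstoI)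
  fix e :: real assume "e > 0"
  define \<epsilon> where "\<epsilon> = e / 4 / (t - s + 1)"
  have "\<epsilon> > 0" using \<open>e > 0\<close> assms(3) by (simp add: \<epsilon>_def)
  then have "\<epsilon> * (t - s) \<le> \<epsilon> * (t - s + 1)" by (intro mult_left_mono) auto
  also have "\<dots> = e / 4" using assms(3) by (simp add: \<epsilon>_def del: divide_divide_eq_left)
  finally have \<epsilon>: "2 * (\<epsilon> * (t - s)) < e" using \<open>e > 0\<close> by linarith
  obtain R where R: "\<And>x r. \<bar>x\<bar> \<ge> R \<Longrightarrow> r \<in> {s..t} \<Longrightarrow> \<bar>b x r\<bar> \<le> \<epsilon>" using small[OF \<open>\<epsilon> > 0\<close>] by blast
  obtain N where N: "R \<le> real N" using real_arch_simple by blast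
  have bound: "\<bar>integral {s..t} (b x)\<bar> \<le> \<epsilon> * (t - s)" if "\<bar>x\<bar> \<ge> R" for x
    using integral_bound[OF assms(3) cont[of x]] R[OF that] by simp
  show "\<forall>\<^sub>F n in sequentially. dist (integral {s..t} (b (real n)) - integral {s..t} (b (- real n))) 0 < e"
  proof (rule eventually_sequentiallyI[of N])
    fix n assume "N \<le> n"
    then show "dist (integral {s..t} (b (real n)) - integral {s..t} (b (- real n))) 0 < e"
      using bound[of "real n"] bound[of "- real n"] N \<epsilon> by (simp add: dist_real_def)
  qed
qed

definition pairing :: "(real \<Rightarrow> real \<Rightarrow> real) \<Rightarrow> (real \<Rightarrow> real) \<Rightarrow> real \<Rightarrow> real" where
  "pairing u \<psi> t = (LINT x|lborel. u x t * \<psi> x)"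

text \<open>The equation is \<open>u\<^sub>t = (a u\<^sub>x)\<^sub>x\<close>. The coefficient may jump at the finitely many points of \<open>B\<close>;
  it is bounded away from \<open>0\<close> and from infinity. For the multiphase system \<open>B\<close> consists of the
  interphase boundaries, and \<open>a\<close> is \<open>\<sigma>\<^sub>k\<^sup>2 / 2\<close> on phase \<open>k\<close>.\<close>

locale layered_medium =
  fixes a :: "real \<Rightarrow> real" and B :: "real set" and lo hi :: real
  assumes finite_B: "finite B"
    and lo_pos: "0 < lo" and a_ge: "\<And>x. lo \<le> a x" and a_le: "\<And>x. a x \<le> hi"
    and a_cont: "\<And>x. x \<notin> B \<Longrightarrow> isCont a x"
begin

lemma a_pos: "0 < a x"
  using lo_pos a_ge[of x] by linarith

lemma hi_pos: "0 < hi"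
  using a_pos[of 0] a_le[of 0] by linarith

text \<open>The second argument is the flux \<open>J = a u\<^sub>x\<close>. The two interface conditions are encoded as
  the continuity of \<open>u\<close> and of \<open>J\<close> on the whole line.\<close>

definition solution :: "(real \<Rightarrow> real \<Rightarrow> real) \<Rightarrow> (real \<Rightarrow> real \<Rightarrow> real) \<Rightarrow> bool" where
  "solution u J \<longleftrightarrow>
     continuous_on (UNIV \<times> {0<..}) (\<lambda>(x, t). u x t) \<and>
     continuous_on (UNIV \<times> {0<..}) (\<lambda>(x, t). J x t) \<and>
     (\<exists>D. continuous_on ((- B) \<times> {0<..}) (\<lambda>(x, t). D x t) \<and>
        (\<forall>x t. x \<notin> B \<and> t > 0 \<longrightarrow>
           ((\<lambda>z. u z t) has_real_derivative J x t / a x) (at x) \<and>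
           ((\<lambda>z. J z t) has_real_derivative D x t) (at x) \<and>
           (u x has_real_derivative D x t) (at t))) \<and>
     (\<forall>T>0. \<forall>\<epsilon>>0. \<exists>R. \<forall>x t. \<bar>x\<bar> \<ge> R \<and> 0 < t \<and> t \<le> T \<longrightarrow> \<bar>u x t\<bar> < \<epsilon> \<and> \<bar>J x t\<bar> < \<epsilon>)"

lemma solution_cont:
  assumes "solution u J" "T \<subseteq> {0<..}"
  shows "continuous_on (A \<times> T) (\<lambda>(x, t). u x t)" "continuous_on (A \<times> T) (\<lambda>(x, t). J x t)"
proof -
  have "continuous_on (UNIV \<times> {0<..}) (\<lambda>(x, t). u x t)" "continuous_on (UNIV \<times> {0<..}) (\<lambda>(x, t). J x t)"
    using assms(1) by (auto simp: solution_def)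
  moreover have "A \<times> T \<subseteq> UNIV \<times> {0<..}" using assms(2) by auto
  ultimately show "continuous_on (A \<times> T) (\<lambda>(x, t). u x t)" "continuous_on (A \<times> T) (\<lambda>(x, t). J x t)"
    using continuous_on_subset by blast+
qed

lemma solution_cont_x:
  assumes "solution u J" "0 < t"
  shows "continuous_on UNIV (\<lambda>x. u x t)" "continuous_on UNIV (\<lambda>x. J x t)"
  using continuous_on_slices(1)[OF solution_cont(1)[OF assms(1), of "{t}" UNIV], of t]
    continuous_on_slices(1)[OF solution_cont(2)[OF assms(1), of "{t}" UNIV], of t] assms(2)
  by auto

lemma solution_cont_t:
  assumes "solution u J" "0 < s"
  shows "continuous_on {s..t} (u x)" "continuous_on {s..t} (J x)"
  using continuous_on_slices(2)[OF solution_cont(1)[OF assms(1), of "{s..t}" UNIV], of x]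
    continuous_on_slices(2)[OF solution_cont(2)[OF assms(1), of "{s..t}" UNIV], of x] assms(2)
  by (auto simp: subset_eq)

lemma solution_decay:
  assumes "solution u J" "0 < T" "0 < \<epsilon>"
  obtains R where "R > 0" "\<And>x t. \<bar>x\<bar> \<ge> R \<Longrightarrow> 0 < t \<Longrightarrow> t \<le> T \<Longrightarrow> \<bar>u x t\<bar> < \<epsilon>"
    "\<And>x t. \<bar>x\<bar> \<ge> R \<Longrightarrow> 0 < t \<Longrightarrow> t \<le> T \<Longrightarrow> \<bar>J x t\<bar> < \<epsilon>"
proof -
  have "\<forall>T>0. \<forall>\<epsilon>>0. \<exists>R. \<forall>x t. \<bar>x\<bar> \<ge> R \<and> 0 < t \<and> t \<le> T \<longrightarrow> \<bar>u x t\<bar> < \<epsilon> \<and> \<bar>J x t\<bar> < \<epsilon>"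
    using assms(1) unfolding solution_def by blast
  then obtain R where "\<forall>x t. \<bar>x\<bar> \<ge> R \<and> 0 < t \<and> t \<le> T \<longrightarrow> \<bar>u x t\<bar> < \<epsilon> \<and> \<bar>J x t\<bar> < \<epsilon>"
    using assms(2,3) by blast
  then show ?thesis by (intro that[of "max R 1"]) auto
qed

lemma solution_bounded:
  assumes "solution u J" "0 < s"
  obtains M where "M > 0" "\<And>x r. r \<in> {s..t} \<Longrightarrow> \<bar>u x r\<bar> \<le> M" "\<And>x r. r \<in> {s..t} \<Longrightarrow> \<bar>J x r\<bar> \<le> M"
proof -
  obtain R where R: "R > 0" "\<And>x r. \<bar>x\<bar> \<ge> R \<Longrightarrow> 0 < r \<Longrightarrow> r \<le> max s t \<Longrightarrow> \<bar>u x r\<bar> < 1"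
    "\<And>x r. \<bar>x\<bar> \<ge> R \<Longrightarrow> 0 < r \<Longrightarrow> r \<le> max s t \<Longrightarrow> \<bar>J x r\<bar> < 1"
    by (rule solution_decay[OF assms(1), of "max s t" 1]) (use assms(2) in auto)
  have "compact ((\<lambda>(x, t). u x t) ` ({-R..R} \<times> {s..t}))" "compact ((\<lambda>(x, t). J x t) ` ({-R..R} \<times> {s..t}))"
    using assms(2) by (intro compact_continuous_image solution_cont[OF assms(1)] compact_Times; force)+
  then obtain M1 M2 where
    M1: "\<forall>y\<in>(\<lambda>(x, t). u x t) ` ({-R..R} \<times> {s..t}). \<bar>y\<bar> \<le> M1" and
    M2: "\<forall>y\<in>(\<lambda>(x, t). J x t) ` ({-R..R} \<times> {s..t}). \<bar>y\<bar> \<le> M2"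
    by (metis bounded_iff compact_imp_bounded real_norm_def)
  have "\<bar>u x r\<bar> \<le> max 1 (max M1 M2) \<and> \<bar>J x r\<bar> \<le> max 1 (max M1 M2)" if "r \<in> {s..t}" for x r
  proof (cases "\<bar>x\<bar> \<ge> R")
    case True
    then have "\<bar>u x r\<bar> < 1" "\<bar>J x r\<bar> < 1"
      using R(2)[of x r] R(3)[of x r] that assms(2) by auto
    then show ?thesis by auto
  next
    case False
    then have "(x, r) \<in> {-R..R} \<times> {s..t}" using that by auto
    then have "\<bar>u x r\<bar> \<le> M1" "\<bar>J x r\<bar> \<le> M2"
      using M1 M2 by force+
    then show ?thesis by auto
  qed
  then show ?thesis by (intro that[of "max 1 (max M1 M2)"]) auto
qed

text \<open>The second function \<open>w\<close>, with flux \<open>m\<close> and \<open>m\<^sub>x = E\<close>, solves the backward equation up to the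
  source term \<open>F\<close>. Off \<open>B\<close> the time derivative of \<open>u w\<close> is then \<open>(J w - u m)\<^sub>x + u F\<close>, because the
  terms \<open>J m / a\<close> cancel. The flux \<open>J w - u m\<close> is continuous across \<open>B\<close>, so no interface terms occur.
  The lemma is used with \<open>w\<close> independent of time, where \<open>F = E\<close>, and with \<open>w\<close> a
  time-reversed solution, where \<open>F = 0\<close>.\<close>

lemma green:
  assumes sol: "solution u J" and st: "0 < s" "s \<le> t" and "\<alpha> \<le> \<beta>"
    and cont: "continuous_on (UNIV \<times> {s..t}) (\<lambda>(x, r). w x r)"
      "continuous_on (UNIV \<times> {s..t}) (\<lambda>(x, r). m x r)"
      "continuous_on ((- B) \<times> {s..t}) (\<lambda>(x, r). E x r)"
    and der: "\<And>x r. x \<notin> B \<Longrightarrow> r \<in> {s..t} \<Longrightarrow> ((\<lambda>x. w x r) has_real_derivative m x r / a x) (at x)"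
      "\<And>x r. x \<notin> B \<Longrightarrow> r \<in> {s..t} \<Longrightarrow> ((\<lambda>x. m x r) has_real_derivative E x r) (at x)"
      "\<And>x r. x \<notin> B \<Longrightarrow> r \<in> {s..t} \<Longrightarrow> (w x has_real_derivative F x r - E x r) (at r within {s..t})"
  shows "((\<lambda>x. u x t * w x t - u x s * w x s - integral {s..t} (\<lambda>r. u x r * F x r)) has_integral
      (integral {s..t} (\<lambda>r. J \<beta> r * w \<beta> r - u \<beta> r * m \<beta> r) -
       integral {s..t} (\<lambda>r. J \<alpha> r * w \<alpha> r - u \<alpha> r * m \<alpha> r))) {\<alpha>..\<beta>}"
proof -
  obtain D where D: "continuous_on ((- B) \<times> {0<..}) (\<lambda>(x, t). D x t)"
    "\<And>x t. x \<notin> B \<Longrightarrow> t > 0 \<Longrightarrow> ((\<lambda>z. u z t) has_real_derivative J x t / a x) (at x)"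
    "\<And>x t. x \<notin> B \<Longrightarrow> t > 0 \<Longrightarrow> ((\<lambda>z. J z t) has_real_derivative D x t) (at x)"
    "\<And>x t. x \<notin> B \<Longrightarrow> t > 0 \<Longrightarrow> (u x has_real_derivative D x t) (at t)"
    using sol unfolding solution_def by blast
  have sub: "{s..t} \<subseteq> {0<..}" using st by auto
  define Q' where "Q' = (\<lambda>x r. D x r * w x r - u x r * E x r)"
  have cQ': "continuous_on ((- B) \<times> {s..t}) (\<lambda>(x, r). Q' x r)"
  proof -
    have "continuous_on ((- B) \<times> {s..t}) (\<lambda>p. (\<lambda>(x, t). D x t) p * (\<lambda>(x, t). w x t) p - (\<lambda>(x, t). u x t) p * (\<lambda>(x, t). E x t) p)"
      by (intro continuous_intros cont solution_cont[OF sol] sub continuous_on_subset[OF D(1)]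
          continuous_on_subset[OF cont(1)]) (use sub in auto)
    then show ?thesis by (simp add: Q'_def split_beta)
  qed
  have main: "((\<lambda>x. integral {s..t} (Q' x)) has_integral
      (integral {s..t} (\<lambda>r. J \<beta> r * w \<beta> r - u \<beta> r * m \<beta> r) -
       integral {s..t} (\<lambda>r. J \<alpha> r * w \<alpha> r - u \<alpha> r * m \<alpha> r))) {\<alpha>..\<beta>}"
  proof (rule divergence_has_integral[OF finite_B \<open>\<alpha> \<le> \<beta>\<close> _ _ cQ'])
    have "continuous_on (UNIV \<times> {s..t}) (\<lambda>p. (\<lambda>(x, t). J x t) p * (\<lambda>(x, t). w x t) p - (\<lambda>(x, t). u x t) p * (\<lambda>(x, t). m x t) p)"
      by (intro continuous_intros cont solution_cont[OF sol] sub)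
    then show "continuous_on (UNIV \<times> {s..t}) (\<lambda>(x, r). J x r * w x r - u x r * m x r)"
      by (simp add: split_beta)
  next
    fix x r assume x: "x \<notin> B" and r: "r \<in> {s..t}"
    then have "r > 0" using st by auto
    show "((\<lambda>x. J x r * w x r - u x r * m x r) has_real_derivative Q' x r) (at x)"
      unfolding Q'_def
      by (rule derivative_eq_intros D(2,3)[OF x \<open>r > 0\<close>] der(1,2)[OF x r] refl)+
        (simp add: algebra_simps)
  qed
  have eq: "u x t * w x t - u x s * w x s - integral {s..t} (\<lambda>r. u x r * F x r) = integral {s..t} (Q' x)"
    if x: "x \<notin> B" for x
  proof -
    have "((\<lambda>r. D x r * w x r + u x r * (F x r - E x r)) has_integral (u x t * w x t - u x s * w x s)) {s..t}"
    proof (rule fundamental_theorem_of_calculus[OF st(2)])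
      fix r assume r: "r \<in> {s..t}"
      then have "r > 0" using st by auto
      have "((\<lambda>r. u x r * w x r) has_real_derivative D x r * w x r + u x r * (F x r - E x r)) (at r within {s..t})"
        by (rule derivative_eq_intros has_field_derivative_at_within[OF D(4)[OF x \<open>r > 0\<close>]] der(3)[OF x r] refl)+
          (simp add: algebra_simps)
      then show "((\<lambda>r. u x r * w x r) has_vector_derivative D x r * w x r + u x r * (F x r - E x r)) (at r within {s..t})"
        by (simp add: has_real_derivative_iff_has_vector_derivative)
    qed
    moreover have "(Q' x has_integral integral {s..t} (Q' x)) {s..t}"
      using continuous_on_slices(2)[OF cQ', of x] x
      by (intro integrable_integral integrable_continuous_real) auto
    ultimately have "((\<lambda>r. D x r * w x r + u x r * (F x r - E x r) - Q' x r) has_integral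
        (u x t * w x t - u x s * w x s - integral {s..t} (Q' x))) {s..t}"
      by (rule has_integral_diff)
    then have "((\<lambda>r. u x r * F x r) has_integral
        (u x t * w x t - u x s * w x s - integral {s..t} (Q' x))) {s..t}"
      by (simp add: Q'_def algebra_simps)
    then show ?thesis by (simp add: integral_unique)
  qed
  show ?thesis
    by (rule has_integral_spike_finite[OF finite_B _ main]) (use eq in auto)
qed

lemma pairing_integrable:
  assumes "solution u J" "0 < t" "integrable lborel \<psi>"
  shows "integrable lborel (\<lambda>x. u x t * \<psi> x)"
proof -
  obtain M where M: "M > 0" "\<And>x r. r \<in> {t..t} \<Longrightarrow> \<bar>u x r\<bar> \<le> M"
    by (rule solution_bounded[OF assms(1,2)]) blast
  show ?thesis
  proof (rule Bochner_Integration.integrable_bound[where f = "\<lambda>x. M * \<psi> x"])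
    show "(\<lambda>x. u x t * \<psi> x) \<in> borel_measurable lborel"
      using borel_measurable_continuous_onI[OF solution_cont_x(1)[OF assms(1,2)]] assms(3)
      by (intro borel_measurable_times) auto
    show "AE x in lborel. norm (u x t * \<psi> x) \<le> norm (M * \<psi> x)"
      using M by (auto simp: abs_mult intro!: mult_right_mono)
  qed (use assms in auto)
qed

lemma pairing_cont:
  assumes "solution u J" "integrable lborel \<psi>" "0 < s"
  shows "continuous_on {s..t} (pairing u \<psi>)"
proof -
  obtain M where M: "M > 0" "\<And>x r. r \<in> {s..t} \<Longrightarrow> \<bar>u x r\<bar> \<le> M"
    by (rule solution_bounded[OF assms(1,3)]) blast
  have "continuous_on {s..t} (\<lambda>r. LINT x|lborel. u x r * \<psi> x)"
    unfolding continuous_on_sequentially comp_def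
  proof safe
    fix y :: "nat \<Rightarrow> real" and r assume r: "r \<in> {s..t}" "\<forall>n. y n \<in> {s..t}" "y \<longlonglongrightarrow> r"
    show "(\<lambda>n. LINT x|lborel. u x (y n) * \<psi> x) \<longlonglongrightarrow> (LINT x|lborel. u x r * \<psi> x)"
    proof (rule integral_dominated_convergence[where w = "\<lambda>x. M * \<bar>\<psi> x\<bar>"])
      show "(\<lambda>x. u x r * \<psi> x) \<in> borel_measurable lborel"
        "\<And>i. (\<lambda>x. u x (y i) * \<psi> x) \<in> borel_measurable lborel"
      proof -
        have "0 < r" "0 < y i" for i
          using r assms(3) by (auto intro: order_less_le_trans)
        then show "(\<lambda>x. u x r * \<psi> x) \<in> borel_measurable lborel"
          "\<And>i. (\<lambda>x. u x (y i) * \<psi> x) \<in> borel_measurable lborel"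
          using pairing_integrable[OF assms(1) _ assms(2)] by (blast intro: borel_measurable_integrable)+
      qed
      show "integrable lborel (\<lambda>x. M * \<bar>\<psi> x\<bar>)" using assms(2) by auto
      show "AE x in lborel. (\<lambda>i. u x (y i) * \<psi> x) \<longlonglongrightarrow> u x r * \<psi> x"
      proof (intro AE_I2 tendsto_intros)
        fix x
        have "continuous_on {s..t} (u x)" by (rule solution_cont_t(1)[OF assms(1,3)])
        then show "(\<lambda>i. u x (y i)) \<longlonglongrightarrow> u x r"
          using r unfolding continuous_on_sequentially comp_def by blast
      qed
      show "\<And>i. AE x in lborel. norm (u x (y i) * \<psi> x) \<le> M * \<bar>\<psi> x\<bar>"
        using M(2) r by (auto simp: abs_mult intro!: mult_right_mono)
    qed
  qed
  then show ?thesis by (simp add: pairing_def[abs_def])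
qed

text \<open>Green's identity on \<open>{- n..n}\<close>, in the limit of large \<open>n\<close>: the boundary terms disappear since
  \<open>u\<close> and its flux decay uniformly on the time interval and \<open>\<psi>\<close>, \<open>m\<close> are bounded. Differentiation
  under the integral sign is not available here, as nothing is known about the decay of \<open>u\<^sub>t\<close>.\<close>

lemma pairing_increment:
  assumes sol: "solution u J" and st: "0 < s" "s \<le> t"
    and cont: "continuous_on UNIV \<psi>" "continuous_on UNIV m" "continuous_on UNIV e"
    and der: "\<And>x. x \<notin> B \<Longrightarrow> (\<psi> has_real_derivative m x / a x) (at x)"
      "\<And>x. x \<notin> B \<Longrightarrow> (m has_real_derivative e x) (at x)"
    and bdd: "\<And>x. \<bar>\<psi> x\<bar> \<le> C" "\<And>x. \<bar>m x\<bar> \<le> C"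
    and int: "integrable lborel \<psi>" "integrable lborel e"
  shows "pairing u \<psi> t - pairing u \<psi> s = integral {s..t} (pairing u e)"
proof -
  have sub: "{s..t} \<subseteq> {0<..}" and t: "t > 0" using st by auto
  have C: "C \<ge> 0" using bdd(1)[of 0] by linarith
  have c2: "continuous_on (A \<times> {s..t}) (\<lambda>(x, r). f x)" if "continuous_on UNIV f" for f :: "real \<Rightarrow> real" and A
    using continuous_on_compose2[OF that continuous_on_fst[OF continuous_on_id], of "A \<times> {s..t}"]
    by (simp add: split_beta)
  have cue: "continuous_on (UNIV \<times> {s..t}) (\<lambda>(x, r). u x r * e x)"
  proof -
    have "continuous_on (UNIV \<times> {s..t}) (\<lambda>p. (\<lambda>(x, r). u x r) p * (\<lambda>(x, r). e x) p)"
      by (intro continuous_intros solution_cont[OF sol] sub c2 cont)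
    then show ?thesis by (simp add: split_beta)
  qed
  define bd where "bd = (\<lambda>x r. J x r * \<psi> x - u x r * m x)"
  have bd_small: "\<exists>R. \<forall>x r. \<bar>x\<bar> \<ge> R \<and> r \<in> {s..t} \<longrightarrow> \<bar>bd x r\<bar> \<le> \<epsilon>" if "\<epsilon> > 0" for \<epsilon>
  proof -
    define \<eta> where "\<eta> = \<epsilon> / 2 / (C + 1)"
    have \<eta>: "\<eta> > 0" "\<eta> * (C + 1) = \<epsilon> / 2" using that C by (auto simp: \<eta>_def simp del: divide_divide_eq_left)
    obtain R where R: "\<And>x r. \<bar>x\<bar> \<ge> R \<Longrightarrow> 0 < r \<Longrightarrow> r \<le> t \<Longrightarrow> \<bar>u x r\<bar> < \<eta>"
      "\<And>x r. \<bar>x\<bar> \<ge> R \<Longrightarrow> 0 < r \<Longrightarrow> r \<le> t \<Longrightarrow> \<bar>J x r\<bar> < \<eta>"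
      using solution_decay[OF sol t \<eta>(1)] by metis
    have "\<bar>bd x r\<bar> \<le> \<epsilon>" if "\<bar>x\<bar> \<ge> R" "r \<in> {s..t}" for x r
    proof -
      have "\<bar>J x r * \<psi> x\<bar> \<le> \<eta> * (C + 1)" "\<bar>u x r * m x\<bar> \<le> \<eta> * (C + 1)"
        unfolding abs_mult using R(1,2)[of x r] bdd[of x] that st C \<eta>(1)
        by (intro mult_mono; force)+
      then show ?thesis unfolding bd_def \<eta>(2) by linarith
    qed
    then show ?thesis by blast
  qed
  have "continuous_on {s..t} (bd x)" for x
    unfolding bd_def by (intro continuous_intros solution_cont_t[OF sol st(1)])
  note bd_lim = boundary_integrals_vanish[OF this bd_small st(2)]
  have step: "integral {-real n..real n} (\<lambda>x. u x t * \<psi> x) - integral {-real n..real n} (\<lambda>x. u x s * \<psi> x) =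
      integral {s..t} (\<lambda>r. integral {-real n..real n} (\<lambda>x. u x r * e x)) +
      (integral {s..t} (bd (real n)) - integral {s..t} (bd (- real n)))" for n
  proof -
    have i0: "((\<lambda>x. u x t * \<psi> x - u x s * \<psi> x - integral {s..t} (\<lambda>r. u x r * e x)) has_integral
      (integral {s..t} (bd (real n)) - integral {s..t} (bd (- real n)))) {- real n..real n}"
      unfolding bd_def
      by (rule green[OF sol st, where E = "\<lambda>x r. e x"])
        (use c2[OF cont(1)] c2[OF cont(2)] c2[OF cont(3)] der in auto)
    have i3: "(\<lambda>x. integral {s..t} (\<lambda>r. u x r * e x)) integrable_on {- real n..real n}"
      using integral_continuous_on_param[of "{- real n..real n}" s t "\<lambda>x r. u x r * e x"]
        continuous_on_subset[OF cue, of "{- real n..real n} \<times> {s..t}"]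
      by (auto intro: integrable_continuous_real)
    have i12: "(\<lambda>x. u x t * \<psi> x) integrable_on {- real n..real n}" "(\<lambda>x. u x s * \<psi> x) integrable_on {- real n..real n}"
      using solution_cont_x(1)[OF sol t] solution_cont_x(1)[OF sol st(1)] cont(1)
      by (auto intro!: integrable_continuous_real continuous_intros intro: continuous_on_subset)
    have "integral {-real n..real n} (\<lambda>x. u x t * \<psi> x) - integral {-real n..real n} (\<lambda>x. u x s * \<psi> x) -
      integral {-real n..real n} (\<lambda>x. integral {s..t} (\<lambda>r. u x r * e x)) = (integral {s..t} (bd (real n)) - integral {s..t} (bd (- real n)))"
      using integral_unique[OF i0] Henstock_Kurzweil_Integration.integral_diff[OF integrable_diff[OF i12] i3]
        Henstock_Kurzweil_Integration.integral_diff[OF i12] by simp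
    moreover have "integral {-real n..real n} (\<lambda>x. integral {s..t} (\<lambda>r. u x r * e x)) =
        integral {s..t} (\<lambda>r. integral {-real n..real n} (\<lambda>x. u x r * e x))"
      using integral_swap_continuous[of "- real n" s "real n" t "\<lambda>x r. u x r * e x"]
        continuous_on_subset[OF cue Sigma_mono[OF subset_UNIV order_refl], of "{- real n..real n}"]
      by (simp add: cbox_Pair_eq)
    ultimately show ?thesis by linarith
  qed
  have lhs: "(\<lambda>n. integral {-real n..real n} (\<lambda>x. u x t * \<psi> x) - integral {-real n..real n} (\<lambda>x. u x s * \<psi> x))
      \<longlonglongrightarrow> pairing u \<psi> t - pairing u \<psi> s"
    unfolding pairing_def
    by (intro tendsto_diff integral_symmetric_tendsto pairing_integrable[OF sol] int t st)
  obtain M where M: "M > 0" "\<And>x r. r \<in> {s..t} \<Longrightarrow> \<bar>u x r\<bar> \<le> M"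
    by (rule solution_bounded[OF sol st(1)]) blast
  have inner: "(\<lambda>n. integral {s..t} (\<lambda>r. integral {-real n..real n} (\<lambda>x. u x r * e x)))
      \<longlonglongrightarrow> integral {s..t} (pairing u e)"
  proof (rule dominated_convergence(2)[where h = "\<lambda>_. M * (LINT x|lborel. \<bar>e x\<bar>)"])
    fix n
    have "continuous_on ({s..t} \<times> {-real n..real n}) (\<lambda>(r, x). u x r * e x)"
      using continuous_on_compose2[OF cue continuous_on_swap, of "{s..t} \<times> {-real n..real n}"]
      by (force simp: split_beta prod.swap_def image_subset_iff)
    then show "(\<lambda>r. integral {-real n..real n} (\<lambda>x. u x r * e x)) integrable_on {s..t}"
      using integral_continuous_on_param[of "{s..t}" "-real n" "real n" "\<lambda>r x. u x r * e x"]
      by (auto intro: integrable_continuous_real)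
    fix r assume r: "r \<in> {s..t}"
    have i: "integrable lborel (\<lambda>x. u x r * e x)" using pairing_integrable[OF sol _ int(2)] r st by auto
    have "norm (integral {-real n..real n} (\<lambda>x. u x r * e x)) = norm (LINT x:{-real n..real n}|lborel. u x r * e x)"
      using set_borel_integral_eq_integral(2)[of "{- real n..real n}" "\<lambda>x. u x r * e x"]
        integrable_mult_indicator[OF _ i, of "{- real n..real n}"]
      by (simp add: set_integrable_def)
    also have "\<dots> \<le> (LINT x|lborel. norm (indicator {-real n..real n} x *\<^sub>R (u x r * e x)))"
      unfolding set_lebesgue_integral_def by (rule integral_norm_bound)
    also have "\<dots> \<le> (LINT x|lborel. M * \<bar>e x\<bar>)"
    proof (rule integral_mono)
      show "integrable lborel (\<lambda>x. norm (indicator {- real n..real n} x *\<^sub>R (u x r * e x)))"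
        using i by (intro integrable_norm integrable_mult_indicator) auto
      show "norm (indicator {- real n..real n} x *\<^sub>R (u x r * e x)) \<le> M * \<bar>e x\<bar>" for x
        using M(1) M(2)[OF r, of x] by (auto simp: indicator_def abs_mult intro!: mult_right_mono)
    qed (use int in auto)
    finally show "norm (integral {-real n..real n} (\<lambda>x. u x r * e x)) \<le> M * (LINT x|lborel. \<bar>e x\<bar>)"
      by simp
  next
    show "(\<lambda>n. integral {-real n..real n} (\<lambda>x. u x r * e x)) \<longlonglongrightarrow> pairing u e r" if "r \<in> {s..t}" for r
      unfolding pairing_def using st that
      by (intro integral_symmetric_tendsto pairing_integrable[OF sol] int) auto
  qed auto
  have "(\<lambda>n. integral {s..t} (\<lambda>r. integral {-real n..real n} (\<lambda>x. u x r * e x)) +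
      (integral {s..t} (bd (real n)) - integral {s..t} (bd (- real n)))) \<longlonglongrightarrow> integral {s..t} (pairing u e) + 0"
    by (intro tendsto_add inner bd_lim)
  then show ?thesis
    using LIMSEQ_unique[OF lhs[unfolded step]] by simp
qed

lemma pairing_deriv:
  assumes sol: "solution u J" and t: "0 < t"
    and cont: "continuous_on UNIV \<psi>" "continuous_on UNIV m" "continuous_on UNIV e"
    and der: "\<And>x. x \<notin> B \<Longrightarrow> (\<psi> has_real_derivative m x / a x) (at x)"
      "\<And>x. x \<notin> B \<Longrightarrow> (m has_real_derivative e x) (at x)"
    and bdd: "\<And>x. \<bar>\<psi> x\<bar> \<le> C" "\<And>x. \<bar>m x\<bar> \<le> C"
    and int: "integrable lborel \<psi>" "integrable lborel e"
  shows "(pairing u \<psi> has_real_derivative pairing u e t) (at t)"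
proof -
  have s: "0 < t / 2" "t / 2 < t" "t < 2 * t" using t by auto
  have "((\<lambda>r. integral {t/2..r} (pairing u e)) has_vector_derivative pairing u e t) (at t within {t/2..2*t})"
    by (rule integral_has_vector_derivative[OF pairing_cont[OF sol int(2) s(1)]]) (use s in auto)
  then have "((\<lambda>r. pairing u \<psi> (t/2) + integral {t/2..r} (pairing u e)) has_real_derivative pairing u e t) (at t within {t/2..2*t})"
    by (auto simp: has_real_derivative_iff_has_vector_derivative intro!: derivative_eq_intros)
  then have "(pairing u \<psi> has_real_derivative pairing u e t) (at t within {t/2..2*t})"
  proof (rule has_field_derivative_transform_within[OF _ zero_less_one])
    show "pairing u \<psi> (t/2) + integral {t/2..r} (pairing u e) = pairing u \<psi> r" if "r \<in> {t/2..2*t}" for r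
      using pairing_increment[OF sol s(1) _ cont der bdd int, of r] that by auto
  qed (use s in auto)
  then show ?thesis
    using s at_within_interior[of t "{t/2..2*t}"] by auto
qed

end

section \<open>The resolvent\<close>

lemma indefinite_integral_local:
  fixes g F :: "real \<Rightarrow> real"
  assumes "g integrable_on {p..q}" "p < x" "x < q"
    and F: "\<And>y. y \<in> {p..q} \<Longrightarrow> F y = F p + k * integral {p..y} g"
  shows "isCont F x" and "isCont g x \<Longrightarrow> (F has_real_derivative k * g x) (at x)"
proof -
  have int: "x \<in> interior {p..q}" using assms by simp
  have "continuous_on {p..q} (\<lambda>y. F p + k * integral {p..y} g)"
    by (intro continuous_intros indefinite_integral_continuous_1 assms)
  then have "continuous_on {p..q} F"
    by (rule continuous_on_eq) (simp add: F[symmetric])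
  then show "isCont F x"
    using int by (rule continuous_on_interior)
  assume "isCont g x"
  then have "continuous (at x within ({p..q} - {})) g"
    by (rule continuous_at_imp_continuous_at_within)
  then have "((\<lambda>y. integral {p..y} g) has_vector_derivative g x) (at x within {p..q})"
    using integral_has_vector_derivative_continuous_at[OF assms(1), of x "{}"] assms(2,3) by simp
  then have "((\<lambda>y. integral {p..y} g) has_real_derivative g x) (at x)"
    using at_within_interior[OF int] by (simp add: has_real_derivative_iff_has_vector_derivative)
  then have "((\<lambda>y. F p + k * integral {p..y} g) has_real_derivative k * g x) (at x)"
    by (auto intro!: derivative_eq_intros)
  then show "(F has_real_derivative k * g x) (at x)"
  proof (rule has_field_derivative_transform_within_open[of _ _ _ "{p<..<q}"])
    show "F p + k * integral {p..y} g = F y" if "y \<in> {p<..<q}" for y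
      using F[of y] that by simp
  qed (use assms in auto)
qed

lemma set_integral_split_left:
  fixes g :: "real \<Rightarrow> real"
  assumes "set_integrable lborel {..q} g" "p \<le> y" "y \<le> q"
  shows "(LINT z:{..y}|lborel. g z) = (LINT z:{..p}|lborel. g z) + integral {p..y} g" "g integrable_on {p..q}"
proof -
  have i: "set_integrable lborel {..p} g" "set_integrable lborel {p<..y} g" "set_integrable lborel {p..y} g"
    "set_integrable lborel {p..q} g"
    using assms by (auto intro: set_integrable_subset[OF assms(1)])
  have "{..y} = {..p} \<union> {p<..y}" "{..p} \<inter> {p<..y} = {}" using assms by auto
  then have "(LINT z:{..y}|lborel. g z) = (LINT z:{..p}|lborel. g z) + (LINT z:{p<..y}|lborel. g z)"
    using set_integral_Un[of "{..p}" "{p<..y}" lborel g] i by simp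
  also have "(LINT z:{p<..y}|lborel. g z) = (LINT z:{p..y}|lborel. g z)"
    unfolding set_lebesgue_integral_def
  proof (rule integral_discrete_difference[of "{p}"])
  qed (auto simp: indicator_def)
  also have "\<dots> = integral {p..y} g"
    by (rule set_borel_integral_eq_integral(2)[OF i(3)])
  finally show "(LINT z:{..y}|lborel. g z) = (LINT z:{..p}|lborel. g z) + integral {p..y} g" .
  show "g integrable_on {p..q}"
    by (rule set_borel_integral_eq_integral(1)[OF i(4)])
qed

lemma set_integral_split_right:
  fixes g :: "real \<Rightarrow> real"
  assumes "set_integrable lborel {p..} g" "p \<le> y" "y \<le> q"
  shows "(LINT z:{y<..}|lborel. g z) = (LINT z:{p<..}|lborel. g z) + (-1) * integral {p..y} g" "g integrable_on {p..q}"
proof -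
  have i: "set_integrable lborel {y<..} g" "set_integrable lborel {p<..y} g" "set_integrable lborel {p..y} g"
    "set_integrable lborel {p..q} g"
    using assms by (auto intro: set_integrable_subset[OF assms(1)])
  have "{p<..} = {p<..y} \<union> {y<..}" "{p<..y} \<inter> {y<..} = {}" using assms by auto
  then have "(LINT z:{p<..}|lborel. g z) = (LINT z:{p<..y}|lborel. g z) + (LINT z:{y<..}|lborel. g z)"
    using set_integral_Un[of "{p<..y}" "{y<..}" lborel g] i by simp
  also have "(LINT z:{p<..y}|lborel. g z) = (LINT z:{p..y}|lborel. g z)"
    unfolding set_lebesgue_integral_def
  proof (rule integral_discrete_difference[of "{p}"])
  qed (auto simp: indicator_def)
  also have "\<dots> = integral {p..y} g"
    by (rule set_borel_integral_eq_integral(2)[OF i(3)])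
  finally show "(LINT z:{y<..}|lborel. g z) = (LINT z:{p<..}|lborel. g z) + (-1) * integral {p..y} g" by simp
  show "g integrable_on {p..q}"
    by (rule set_borel_integral_eq_integral(1)[OF i(4)])
qed

context layered_medium
begin

lemma a_measurable [measurable]: "a \<in> borel_measurable borel"
proof (rule measurable_discrete_difference[of "\<lambda>x. indicator (- B) x *\<^sub>R a x" _ _ B])
  have "open (- B)" using finite_B by (simp add: finite_imp_closed open_Compl)
  then show "(\<lambda>x. indicator (- B) x *\<^sub>R a x) \<in> borel_measurable borel"
    using a_cont by (intro borel_measurable_continuous_on_indicator continuous_at_imp_continuous_on) auto
qed (use finite_B in \<open>simp_all add: countable_finite indicator_def\<close>)

lemma inverse_a_integrable: "(\<lambda>z. 1 / a z) integrable_on {p..q}"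
proof -
  have "set_integrable lborel {p..q} (\<lambda>z. 1 / a z)"
    unfolding set_integrable_def
  proof (rule Bochner_Integration.integrable_bound[where f = "\<lambda>z. indicator {p..q} z *\<^sub>R (1 / lo)"])
    show "integrable lborel (\<lambda>z. indicator {p..q} z *\<^sub>R (1 / lo))"
      by (intro integrable_scaleR_left integrable_real_indicator) (auto simp: emeasure_lborel_cbox_finite[of p q, simplified])
    show "AE z in lborel. norm (indicator {p..q} z *\<^sub>R (1 / a z)) \<le> norm (indicator {p..q} z *\<^sub>R (1 / lo))"
      using a_ge a_pos lo_pos by (auto simp: indicator_def abs_of_pos frac_le)
  qed auto
  then show ?thesis by (rule set_borel_integral_eq_integral(1))
qed

text \<open>In the coordinate \<open>Y\<close> the operator \<open>a d/dx\<close>, which produces the flux, is plain differentiation.\<close>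

definition Y :: "real \<Rightarrow> real" where
  "Y x = integral {0..x} (\<lambda>z. 1 / a z) - integral {x..0} (\<lambda>z. 1 / a z)"

lemma Y_diff:
  assumes "x \<le> y" shows "Y y = Y x + 1 * integral {x..y} (\<lambda>z. 1 / a z)"
proof -
  note c = Henstock_Kurzweil_Integration.integral_combine[OF _ _ inverse_a_integrable]
  have deg: "integral {u..v} (\<lambda>z. 1 / a z) = 0" if "v \<le> u" for u v
    using that by (cases "u = v") auto
  consider "0 \<le> x" | "x \<le> 0" "0 \<le> y" | "y \<le> 0" by linarith
  then show ?thesis
  proof cases
    case 1
    then show ?thesis using c[of 0 x y] assms deg[of 0 x] deg[of 0 y] by (simp add: Y_def)
  next
    case 2
    then show ?thesis using c[of x 0 y] assms deg[of x 0] deg[of 0 y] by (simp add: Y_def)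
  next
    case 3
    then show ?thesis using c[of x y 0] assms deg[of x 0] deg[of y 0] by (simp add: Y_def)
  qed
qed

lemma Y_mono: "x \<le> y \<Longrightarrow> Y x \<le> Y y"
  using Y_diff[of x y] Henstock_Kurzweil_Integration.integral_nonneg[OF inverse_a_integrable, of x y] a_pos by (auto simp: less_imp_le)

lemma Y_cont: "isCont Y x"
  by (rule indefinite_integral_local(1)[OF inverse_a_integrable[of "x-1" "x+1"]]) (auto intro!: Y_diff)

lemma Y_deriv: "x \<notin> B \<Longrightarrow> (Y has_real_derivative 1 / a x) (at x)"
  using indefinite_integral_local(2)[OF inverse_a_integrable[of "x-1" "x+1"], of x Y 1]
    Y_diff a_cont[of x] a_pos[of x] by (auto intro!: continuous_intros)

lemma Y_measurable [measurable]: "Y \<in> borel_measurable borel"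
  by (intro borel_measurable_continuous_onI continuous_at_imp_continuous_on) (auto intro: Y_cont)

text \<open>The operator \<open>\<psi> \<mapsto> (a \<psi>')' - c\<^sup>2 \<psi> / a\<close> becomes \<open>d\<^sup>2/dY\<^sup>2 - c\<^sup>2\<close>, up to the factor
  \<open>1/a\<close>, in the coordinate \<open>Y\<close>. It has the explicit positive Green function \<open>kern c\<close>, and
  \<open>smoothing c\<close> is its negative inverse. The operator \<open>\<psi> \<mapsto> (a \<psi>')' - \<lambda> \<psi>\<close> of the resolvent
  equation, which has no such formula, is treated as a perturbation.\<close>

definition kern :: "real \<Rightarrow> real \<Rightarrow> real \<Rightarrow> real" where
  "kern c x z = exp (- c * \<bar>Y x - Y z\<bar>) / (2 * c)"

definition smoothing :: "real \<Rightarrow> (real \<Rightarrow> real) \<Rightarrow> real \<Rightarrow> real" where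
  "smoothing c h x = (LINT z|lborel. kern c x z * h z)"

lemma kern_nonneg: "c > 0 \<Longrightarrow> 0 \<le> kern c x z"
  by (simp add: kern_def)

lemma kern_le: "c > 0 \<Longrightarrow> kern c x z \<le> 1 / (2 * c)"
  by (simp add: kern_def divide_right_mono)

lemma kern_measurable [measurable]: "kern c x \<in> borel_measurable borel"
  unfolding kern_def[abs_def] by measurable

lemma kern_integrable:
  assumes "c > 0" "integrable lborel h"
  shows "integrable lborel (\<lambda>z. kern c x z * h z)"
proof (rule Bochner_Integration.integrable_bound[where f = "\<lambda>z. 1 / (2 * c) * h z"])
  show "AE z in lborel. norm (kern c x z * h z) \<le> norm (1 / (2 * c) * h z)"
    using kern_nonneg[OF assms(1)] kern_le[OF assms(1)] assms(1)
    by (auto simp: abs_mult intro!: AE_I2 mult_right_mono simp del: times_divide_eq_left)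
qed (use assms in auto)

lemma smoothing_nonneg: "c > 0 \<Longrightarrow> (\<And>z. 0 \<le> h z) \<Longrightarrow> 0 \<le> smoothing c h x"
  unfolding smoothing_def by (auto intro!: integral_nonneg_AE mult_nonneg_nonneg kern_nonneg)

lemma smoothing_mono:
  assumes "c > 0" "integrable lborel h" "integrable lborel k" "\<And>z. h z \<le> k z"
  shows "smoothing c h x \<le> smoothing c k x"
  unfolding smoothing_def
  by (intro integral_mono kern_integrable assms mult_left_mono kern_nonneg)

lemma smoothing_le:
  assumes "c > 0" "integrable lborel h" "\<And>z. 0 \<le> h z"
  shows "smoothing c h x \<le> (LINT z|lborel. h z) / (2 * c)"
proof -
  have "smoothing c h x \<le> (LINT z|lborel. 1 / (2 * c) * h z)"
    unfolding smoothing_def using assms(2)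
    by (intro integral_mono kern_integrable assms mult_right_mono kern_le) auto
  then show ?thesis by simp
qed

text \<open>The parts of \<open>smoothing c h x\<close> that come from the left and from the right of \<open>x\<close>, without the
  exponential factors in \<open>Y x\<close>. Each is an indefinite integral and so can be differentiated at the
  points of continuity of \<open>h\<close>.\<close>

definition below :: "real \<Rightarrow> (real \<Rightarrow> real) \<Rightarrow> real \<Rightarrow> real" where
  "below c h x = (LINT z:{..x}|lborel. exp (c * Y z) * h z)"

definition above :: "real \<Rightarrow> (real \<Rightarrow> real) \<Rightarrow> real \<Rightarrow> real" where
  "above c h x = (LINT z:{x<..}|lborel. exp (- c * Y z) * h z)"

lemma exp_weight_integrable:
  assumes "c > 0" "integrable lborel h"
  shows "set_integrable lborel {..x} (\<lambda>z. exp (c * Y z) * h z)"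
    "set_integrable lborel {x..} (\<lambda>z. exp (- c * Y z) * h z)"
proof -
  show "set_integrable lborel {..x} (\<lambda>z. exp (c * Y z) * h z)"
    unfolding set_integrable_def
  proof (rule Bochner_Integration.integrable_bound[where f = "\<lambda>z. exp (c * Y x) * h z"])
    show "AE z in lborel. norm (indicator {..x} z *\<^sub>R (exp (c * Y z) * h z)) \<le> norm (exp (c * Y x) * h z)"
      using assms(1) by (auto simp: indicator_def abs_mult intro!: AE_I2 mult_right_mono Y_mono)
  qed (use assms in auto)
  show "set_integrable lborel {x..} (\<lambda>z. exp (- c * Y z) * h z)"
    unfolding set_integrable_def
  proof (rule Bochner_Integration.integrable_bound[where f = "\<lambda>z. exp (- c * Y x) * h z"])
    show "AE z in lborel. norm (indicator {x..} z *\<^sub>R (exp (- c * Y z) * h z)) \<le> norm (exp (- c * Y x) * h z)"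
      using assms(1) by (auto simp: indicator_def abs_mult intro!: AE_I2 mult_right_mono Y_mono)
  qed (use assms in auto)
qed

lemma smoothing_split:
  assumes "c > 0" "integrable lborel h"
  shows "smoothing c h x = (exp (- c * Y x) * below c h x + exp (c * Y x) * above c h x) / (2 * c)"
proof -
  have i: "set_integrable lborel {..x} (\<lambda>z. exp (c * Y z) * h z)"
    "set_integrable lborel {x<..} (\<lambda>z. exp (- c * Y z) * h z)"
    by (rule exp_weight_integrable[OF assms],
        rule set_integrable_subset[OF exp_weight_integrable(2)[OF assms, of x]]) auto
  have "kern c x z * h z = exp (- c * Y x) / (2 * c) * (indicator {..x} z *\<^sub>R (exp (c * Y z) * h z)) +
      exp (c * Y x) / (2 * c) * (indicator {x<..} z *\<^sub>R (exp (- c * Y z) * h z))" for z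
  proof (cases "z \<le> x")
    case True
    then have "Y z \<le> Y x" by (rule Y_mono)
    then have "exp (- c * \<bar>Y x - Y z\<bar>) = exp (- c * Y x) * exp (c * Y z)"
      by (simp add: exp_add[symmetric] algebra_simps)
    with True show ?thesis by (simp add: kern_def)
  next
    case False
    then have "Y x \<le> Y z" by (intro Y_mono) auto
    then have "exp (- c * \<bar>Y x - Y z\<bar>) = exp (c * Y x) * exp (- c * Y z)"
      by (simp add: exp_add[symmetric] algebra_simps)
    with False show ?thesis by (simp add: kern_def)
  qed
  then have "smoothing c h x = exp (- c * Y x) / (2 * c) * below c h x + exp (c * Y x) / (2 * c) * above c h x"
    unfolding smoothing_def below_def above_def set_lebesgue_integral_def
    using i unfolding set_integrable_def by simp
  then show ?thesis by (simp add: add_divide_distrib)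
qed

definition smoothing_flux :: "real \<Rightarrow> (real \<Rightarrow> real) \<Rightarrow> real \<Rightarrow> real" where
  "smoothing_flux c h x = (exp (c * Y x) * above c h x - exp (- c * Y x) * below c h x) / 2"

lemma below_above_cont:
  assumes "c > 0" "integrable lborel h"
  shows "isCont (below c h) x" "isCont (above c h) x"
    and "isCont h x \<Longrightarrow> (below c h has_real_derivative exp (c * Y x) * h x) (at x)"
    and "isCont h x \<Longrightarrow> (above c h has_real_derivative - (exp (- c * Y x) * h x)) (at x)"
proof -
  note b = set_integral_split_left[OF exp_weight_integrable(1)[OF assms, of "x+1"], of "x-1"]
  note a = set_integral_split_right[OF exp_weight_integrable(2)[OF assms, of "x-1"], of _ "x+1"]
  have b1: "below c h y = below c h (x-1) + 1 * integral {x-1..y} (\<lambda>z. exp (c * Y z) * h z)" if "y \<in> {x-1..x+1}" for y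
    using b(1)[of y] that by (simp add: below_def)
  have a1: "above c h y = above c h (x-1) + (-1) * integral {x-1..y} (\<lambda>z. exp (- c * Y z) * h z)" if "y \<in> {x-1..x+1}" for y
    using a(1)[of y] that by (simp add: above_def)
  have ib: "(\<lambda>z. exp (c * Y z) * h z) integrable_on {x-1..x+1}" by (rule b(2)[of "x"]) auto
  have ia: "(\<lambda>z. exp (- c * Y z) * h z) integrable_on {x-1..x+1}" by (rule a(2)[of "x"]) auto
  show "isCont (below c h) x"
    by (rule indefinite_integral_local(1)[OF ib _ _ b1]) auto
  show "isCont (above c h) x"
    by (rule indefinite_integral_local(1)[OF ia _ _ a1]) auto
  assume h: "isCont h x"
  have "(below c h has_real_derivative 1 * (exp (c * Y x) * h x)) (at x)"
    by (rule indefinite_integral_local(2)[OF ib _ _ b1]) (use h Y_cont in \<open>auto intro!: continuous_intros\<close>)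
  then show "(below c h has_real_derivative exp (c * Y x) * h x) (at x)" by simp
  have "(above c h has_real_derivative (-1) * (exp (- c * Y x) * h x)) (at x)"
    by (rule indefinite_integral_local(2)[OF ia _ _ a1]) (use h Y_cont in \<open>auto intro!: continuous_intros\<close>)
  then show "(above c h has_real_derivative - (exp (- c * Y x) * h x)) (at x)" by simp
qed

lemma smoothing_cont:
  assumes "c > 0" "integrable lborel h"
  shows "isCont (smoothing c h) x" "isCont (smoothing_flux c h) x"
proof -
  have "smoothing c h = (\<lambda>x. (exp (- c * Y x) * below c h x + exp (c * Y x) * above c h x) / (2 * c))"
    using smoothing_split[OF assms] by auto
  then show "isCont (smoothing c h) x"
    using assms(1) by (auto intro!: continuous_intros Y_cont below_above_cont[OF assms])
  show "isCont (smoothing_flux c h) x"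
    unfolding smoothing_flux_def[abs_def] by (intro continuous_intros Y_cont below_above_cont[OF assms]) auto
qed

lemma smoothing_deriv:
  assumes "c > 0" "integrable lborel h" "isCont h x" "x \<notin> B"
  shows "(smoothing c h has_real_derivative smoothing_flux c h x / a x) (at x)"
    "(smoothing_flux c h has_real_derivative c^2 * smoothing c h x / a x - h x) (at x)"
proof -
  have eq: "smoothing c h = (\<lambda>x. (exp (- c * Y x) * below c h x + exp (c * Y x) * above c h x) / (2 * c))"
    using smoothing_split[OF assms(1,2)] by auto
  have e: "exp (- c * Y x) * exp (c * Y x) = 1" by (simp add: exp_add[symmetric])
  have e2: "exp (- c * Y x) * (exp (c * Y x) * h x) = h x" "exp (c * Y x) * (exp (- c * Y x) * h x) = h x"
    unfolding mult.assoc[symmetric] mult.commute[of "exp (c * Y x)" "exp (- c * Y x)"] e by simp_all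
  have e3: "exp (c * Y x) * (h x * exp (- c * Y x)) = h x" "exp (- c * Y x) * (h x * exp (c * Y x)) = h x"
    by (simp_all only: e2 mult.commute[of "h x"])
  note d = below_above_cont(3,4)[OF assms(1,2,3)] Y_deriv[OF assms(4)]

  have dE: "((\<lambda>x. exp (k * Y x)) has_real_derivative k / a x * exp (k * Y x)) (at x)" for k
  proof -
    have "((\<lambda>x. exp (k * Y x)) has_real_derivative exp (k * Y x) * (k * (1 / a x))) (at x)"
      by (intro DERIV_chain2[OF DERIV_exp] DERIV_cmult d(3))
    then show ?thesis by (simp add: mult.commute)
  qed
  have p1: "((\<lambda>x. exp (- c * Y x) * below c h x) has_real_derivative - c / a x * (exp (- c * Y x) * below c h x) + h x) (at x)"
    by (rule DERIV_cong[OF DERIV_mult[OF dE[of "- c"] d(1)]])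
      (simp only: e3 mult.assoc)
  have p2: "((\<lambda>x. exp (c * Y x) * above c h x) has_real_derivative c / a x * (exp (c * Y x) * above c h x) - h x) (at x)"
    by (rule DERIV_cong[OF DERIV_mult[OF dE[of c] d(2)]])
      (simp only: e3 mult.assoc minus_mult_left[symmetric, of "exp (- c * Y x) * h x"] diff_conv_add_uminus)
  have "((\<lambda>x. (exp (- c * Y x) * below c h x + exp (c * Y x) * above c h x) / (2 * c)) has_real_derivative
      (- c / a x * (exp (- c * Y x) * below c h x) + h x + (c / a x * (exp (c * Y x) * above c h x) - h x)) / (2 * c)) (at x)"
    by (intro DERIV_cdivide DERIV_add p1 p2)
  moreover have "(- c / a x * (exp (- c * Y x) * below c h x) + h x + (c / a x * (exp (c * Y x) * above c h x) - h x)) / (2 * c)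
      = smoothing_flux c h x / a x"
  proof -
    have "(- c / A * P + H + (c / A * Q - H)) / (2 * c) = (Q - P) / 2 / A" if "A > 0" for A P Q H :: real
    proof -
      have "- c / A * P + H + (c / A * Q - H) = c / A * (Q - P)" by (simp add: algebra_simps diff_divide_distrib)
      then show ?thesis using that assms(1) by simp
    qed
    from this[OF a_pos[of x]] show ?thesis unfolding smoothing_flux_def by blast
  qed
  ultimately show "(smoothing c h has_real_derivative smoothing_flux c h x / a x) (at x)"
    using eq by simp
  have "(smoothing_flux c h has_real_derivative
      (c / a x * (exp (c * Y x) * above c h x) - h x - (- c / a x * (exp (- c * Y x) * below c h x) + h x)) / 2) (at x)"
    unfolding smoothing_flux_def[abs_def] by (intro DERIV_cdivide DERIV_diff p1 p2)
  moreover have "(c / a x * (exp (c * Y x) * above c h x) - h x - (- c / a x * (exp (- c * Y x) * below c h x) + h x)) / 2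
      = c^2 * smoothing c h x / a x - h x"
  proof -
    have "(c / A * Q - H - (- c / A * P + H)) / 2 = c^2 * ((P + Q) / (2 * c)) / A - H" if "A > 0" for A P Q H :: real
    proof -
      have "c / A * Q - H - (- c / A * P + H) = c / A * (P + Q) - 2 * H" by (simp add: algebra_simps add_divide_distrib)
      moreover have "c^2 * ((P + Q) / (2 * c)) / A = c / A * (P + Q) / 2"
        using assms(1) by (simp add: power2_eq_square)
      ultimately show ?thesis by simp
    qed
    from this[OF a_pos[of x]] show ?thesis unfolding smoothing_split[OF assms(1,2)] by blast
  qed
  ultimately show "(smoothing_flux c h has_real_derivative c^2 * smoothing c h x / a x - h x) (at x)"
    by (simp only:)
qed

text \<open>The flux is half the difference of two nonnegative terms whose sum is \<open>2 c\<close> times the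
  smoothing.\<close>

lemma smoothing_flux_le:
  assumes "c > 0" "integrable lborel h" "\<And>z. 0 \<le> h z"
  shows "\<bar>smoothing_flux c h x\<bar> \<le> c * smoothing c h x"
proof -
  have "0 \<le> below c h x" "0 \<le> above c h x"
    unfolding below_def above_def set_lebesgue_integral_def using assms(3)
    by (auto intro!: integral_nonneg_AE)
  then have "0 \<le> exp (- c * Y x) * below c h x" "0 \<le> exp (c * Y x) * above c h x" by auto
  then have "\<bar>smoothing_flux c h x\<bar> \<le> (exp (- c * Y x) * below c h x + exp (c * Y x) * above c h x) / 2"
    unfolding smoothing_flux_def by (auto simp: abs_le_iff field_simps)
  then show ?thesis using assms(1) by (simp add: smoothing_split[OF assms(1,2)])
qed

text \<open>Integrating the equation for the flux over \<open>{- n..n}\<close> leaves the flux at the two end points, and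
  this is at most the mass of \<open>h\<close> outside the interval: in \<open>smoothing_flux\<close> the term with the wrong
  sign is dropped, and the exponential weights of the other one do not exceed \<open>1\<close>.\<close>

lemma smoothing_mass:
  assumes c: "c > 0" and h: "integrable lborel h" "\<And>z. 0 \<le> h z" "\<And>x. x \<notin> B \<Longrightarrow> isCont h x"
  shows "integrable lborel (\<lambda>x. smoothing c h x / a x)"
    "(LINT x|lborel. smoothing c h x / a x) \<le> (LINT z|lborel. h z) / c^2"
proof -
  define H where "H = (LINT z|lborel. h z)"
  have [measurable]: "smoothing c h \<in> borel_measurable borel"
    by (intro borel_measurable_continuous_onI continuous_at_imp_continuous_on ballI smoothing_cont[OF c h(1)])
  have nn: "0 \<le> smoothing c h x / a x" for x
    using smoothing_nonneg[OF c, of h x] h(2) a_pos[of x] by simp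
  have set_int: "set_integrable lborel S h" if "S \<in> sets borel" for S
    unfolding set_integrable_def using that by (intro integrable_mult_indicator h) simp
  have tail: "smoothing_flux c h x \<le> (LINT z:{x<..}|lborel. h z)"
    "- smoothing_flux c h x \<le> (LINT z:{..x}|lborel. h z)" for x
  proof -
    have weight: "exp (c * Y x) * above c h x \<le> (LINT z:{x<..}|lborel. h z)"
      "exp (- c * Y x) * below c h x \<le> (LINT z:{..x}|lborel. h z)"
    proof -
      have "set_integrable lborel {x<..} (\<lambda>z. exp (- c * Y z) * h z)"
        by (rule set_integrable_subset[OF exp_weight_integrable(2)[OF c h(1), of x]]) auto
      moreover have "exp (c * Y x) * (exp (- c * Y z) * h z) \<le> h z" if "x < z" for z
      proof -
        have "exp (c * Y x) * exp (- c * Y z) \<le> 1"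
          using Y_mono[of x z] that c by (simp add: exp_add[symmetric])
        then show ?thesis using h(2)[of z] by (simp add: mult.assoc[symmetric] mult_left_le_one_le)
      qed
      ultimately show "exp (c * Y x) * above c h x \<le> (LINT z:{x<..}|lborel. h z)"
        unfolding above_def set_integral_mult_right[symmetric] using set_int[of "{x<..}"]
        by (intro set_integral_mono set_integrable_mult_right) auto
      have "exp (- c * Y x) * (exp (c * Y z) * h z) \<le> h z" if "z \<le> x" for z
      proof -
        have "exp (- c * Y x) * exp (c * Y z) \<le> 1"
          using Y_mono[of z x] that c by (simp add: exp_add[symmetric])
        then show ?thesis using h(2)[of z] by (simp add: mult.assoc[symmetric] mult_left_le_one_le)
      qed
      then show "exp (- c * Y x) * below c h x \<le> (LINT z:{..x}|lborel. h z)"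
        unfolding below_def set_integral_mult_right[symmetric]
        using set_int[of "{..x}"] exp_weight_integrable(1)[OF c h(1), of x]
        by (intro set_integral_mono set_integrable_mult_right) auto
    qed
    have "0 \<le> below c h x" "0 \<le> above c h x"
      unfolding below_def above_def set_lebesgue_integral_def using h(2)
      by (auto intro!: integral_nonneg_AE)
    then have "0 \<le> exp (- c * Y x) * below c h x" "0 \<le> exp (c * Y x) * above c h x" by auto
    moreover have "(p - r) / 2 \<le> T \<and> - ((r - p) / 2) \<le> T" if "0 \<le> p" "0 \<le> r" "p \<le> T" for p r T :: real
    proof -
      have "p - r \<le> 2 * T" using that by linarith
      then have "(p - r) / 2 \<le> T" by simp
      moreover have "- ((r - p) / 2) = (p - r) / 2" by (simp add: minus_divide_left)
      ultimately show ?thesis by (simp only: conj_absorb)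
    qed
    ultimately show "smoothing_flux c h x \<le> (LINT z:{x<..}|lborel. h z)"
      "- smoothing_flux c h x \<le> (LINT z:{..x}|lborel. h z)"
      unfolding smoothing_flux_def using weight by blast+
  qed
  have window: "\<exists>I. ((\<lambda>x. smoothing c h x / a x) has_integral I) {- real n..real n} \<and> I \<le> H / c^2" for n
  proof -
    let ?I = "{- real n..real n}"
    have 1: "((\<lambda>x. c^2 * smoothing c h x / a x - h x) has_integral
        (smoothing_flux c h (real n) - smoothing_flux c h (- real n))) ?I"
      by (rule fundamental_theorem_of_calculus_interior_strong[OF finite_B])
        (use smoothing_deriv(2)[OF c h(1) h(3)] in \<open>auto simp: has_real_derivative_iff_has_vector_derivative
           intro!: continuous_at_imp_continuous_on smoothing_cont[OF c h(1)]\<close>)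
    have 2: "(h has_integral integral ?I h) ?I"
      by (rule integrable_integral[OF set_borel_integral_eq_integral(1)[OF set_int]]) simp
    have "((\<lambda>x. c^2 * smoothing c h x / a x) has_integral
        (smoothing_flux c h (real n) - smoothing_flux c h (- real n) + integral ?I h)) ?I"
      using has_integral_add[OF 1 2] by simp
    from has_integral_mult_right[OF this, of "1 / c^2"]
    have "((\<lambda>x. smoothing c h x / a x) has_integral
        (smoothing_flux c h (real n) - smoothing_flux c h (- real n) + integral ?I h) / c^2) ?I"
      using c by simp
    moreover have "smoothing_flux c h (real n) - smoothing_flux c h (- real n) + integral ?I h \<le> H"
    proof -
      have "H = (LINT z:{..real n} \<union> {real n<..}|lborel. h z)"
        unfolding H_def set_lebesgue_integral_def by (intro Bochner_Integration.integral_cong) (auto simp: indicator_def)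
      also have "\<dots> = (LINT z:{..real n}|lborel. h z) + (LINT z:{real n<..}|lborel. h z)"
        by (intro set_integral_Un set_int) auto
      also have "(LINT z:{..real n}|lborel. h z) = (LINT z:{..- real n}|lborel. h z) + integral ?I h"
        by (rule set_integral_split_left(1)[OF set_int[of "{..real n}"]]) auto
      finally show ?thesis using tail(1)[of "real n"] tail(2)[of "- real n"] by linarith
    qed
    ultimately show ?thesis using c by (intro exI conjI) (auto intro: divide_right_mono)
  qed
  show "integrable lborel (\<lambda>x. smoothing c h x / a x)"
    "(LINT x|lborel. smoothing c h x / a x) \<le> (LINT z|lborel. h z) / c^2"
    using nonneg_integrable_windows[OF _ nn window] unfolding H_def by simp_all
qed

end

text \<open>The initial condition can be tested only with functions that are smooth on the whole line, whereas
  a solution of the resolvent equation has kinks at the interfaces. The property that matters is that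
  on the phase of the source it coincides with some smooth function.\<close>

definition extends_smoothly :: "real set \<Rightarrow> (real \<Rightarrow> real) \<Rightarrow> bool" where
  "extends_smoothly I f \<longleftrightarrow> (\<exists>F. smooth F \<and> (\<forall>x\<in>I. f x = F x))"

text \<open>Variation of constants: \<open>exp(\<mu>x) \<phi>\<close> is an antiderivative of \<open>exp(\<mu>x) g\<close> on \<open>I\<close>, and the
  corresponding integral of the extension of \<open>g\<close> is defined on the whole line.\<close>

lemma first_order_extends_smoothly:
  fixes I :: "real set"
  assumes I: "open I" "is_interval I"
    and der: "\<And>x. x \<in> I \<Longrightarrow> (\<phi> has_real_derivative g x - \<mu> * \<phi> x) (at x)"
    and g: "extends_smoothly I g"
  shows "extends_smoothly I \<phi>"
proof (cases "I = {}")
  case True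
  then show ?thesis using smooth_const by (auto simp: extends_smoothly_def)
next
  case False
  then obtain x0 where "x0 \<in> I" by blast
  obtain G where G: "smooth G" "\<And>x. x \<in> I \<Longrightarrow> g x = G x"
    using g by (auto simp: extends_smoothly_def)
  have sm: "smooth (\<lambda>x. exp (\<mu> * x) * G x)" by (intro smooth_mult smooth_exp G)
  have "\<exists>P. \<forall>x::real. - \<infinity> < ereal x \<longrightarrow> ereal x < \<infinity> \<longrightarrow>
      (P has_vector_derivative exp (\<mu> * x) * G x) (at x)"
    using smooth_continuous[OF sm]
    by (intro einterval_antiderivative) (auto simp: continuous_on_eq_continuous_at)
  then obtain P where P: "\<And>x. (P has_real_derivative exp (\<mu> * x) * G x) (at x)"
    by (auto simp: has_real_derivative_iff_has_vector_derivative)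
  have smP: "smooth P" by (rule smooth_antideriv[OF P sm])
  have "((\<lambda>x. exp (\<mu> * x) * \<phi> x - P x) has_real_derivative 0) (at x within I)" if "x \<in> I" for x
  proof -
    have "((\<lambda>x. exp (\<mu> * x) * \<phi> x - P x) has_real_derivative 0) (at x)"
      using G(2)[OF that] by (auto intro!: derivative_eq_intros der[OF that] P simp: algebra_simps)
    then show ?thesis by (rule has_field_derivative_at_within)
  qed
  then obtain k where k: "\<And>x. x \<in> I \<Longrightarrow> exp (\<mu> * x) * \<phi> x - P x = k"
    using has_field_derivative_zero_constant[of I "\<lambda>x. exp (\<mu> * x) * \<phi> x - P x"] I
    by (auto simp: is_interval_convex_1)
  have "\<phi> x = exp (- \<mu> * x) * (k + P x)" if "x \<in> I" for x
  proof -
    have "exp (- \<mu> * x) * (exp (\<mu> * x) * \<phi> x) = exp (- \<mu> * x) * (k + P x)" using k[OF that] by simp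
    then show ?thesis by (simp add: mult.assoc[symmetric] exp_add[symmetric])
  qed
  moreover have "smooth (\<lambda>x. exp (- \<mu> * x) * (k + P x))"
    by (intro smooth_mult smooth_exp smooth_add smooth_const smP)
  ultimately show ?thesis unfolding extends_smoothly_def by blast
qed

context layered_medium
begin

text \<open>Besides the equation \<open>\<lambda> \<psi> - (a \<psi>')' = f\<close>, with flux \<open>m = a \<psi>'\<close>, the predicate records the
  estimates on which the applications rest: the mass bound controls iterated resolvents with the
  exact factor \<open>1/\<lambda>\<close> per step, and the bound by the integral of \<open>f\<close> is the source of the uniform
  bound on the solutions.\<close>

definition resolves :: "real \<Rightarrow> (real \<Rightarrow> real) \<Rightarrow> (real \<Rightarrow> real) \<Rightarrow> (real \<Rightarrow> real) \<Rightarrow> bool" where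
  "resolves lam f \<psi> m \<longleftrightarrow>
     continuous_on UNIV \<psi> \<and> continuous_on UNIV m \<and>
     (\<forall>x. x \<notin> B \<longrightarrow> (\<psi> has_real_derivative m x / a x) (at x) \<and>
        (m has_real_derivative lam * \<psi> x - f x) (at x)) \<and>
     (\<exists>C. \<forall>x. \<bar>\<psi> x\<bar> \<le> C \<and> \<bar>m x\<bar> \<le> C) \<and>
     (\<forall>x. 0 \<le> \<psi> x) \<and> integrable lborel \<psi> \<and>
     lam * (LINT x|lborel. \<psi> x) \<le> (LINT x|lborel. f x) \<and>
     (\<forall>x. \<psi> x \<le> (hi / lo + 1) / (2 * sqrt (lam * hi)) * (LINT x|lborel. f x))"

text \<open>With \<open>M = \<lambda> hi\<close> the equation reads \<open>(M/a) \<psi> - (a \<psi>')' = b \<psi> + f\<close>, where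
  \<open>b = M/a - \<lambda> \<ge> 0\<close> by the choice of \<open>M\<close>. It is solved by \<open>\<psi> = smoothing c (b \<psi> + f)\<close> with
  \<open>c = sqrt M\<close>, and since all data are nonnegative the fixed-point iteration starting at \<open>0\<close>
  increases. The mass balance bounds the integrals of the iterates, and the bounded kernel turns
  this into a pointwise bound, so that the iteration converges.\<close>

lemma resolvent_exists:
  assumes lam: "lam > 0" and f: "continuous_on UNIV f" "\<And>x. 0 \<le> f x" "integrable lborel f"
  shows "\<exists>\<psi> m. resolves lam f \<psi> m"
proof -
  define M c where "M = lam * hi" and "c = sqrt M"
  have M: "M > 0" using lam hi_pos by (simp add: M_def)
  then have c: "c > 0" "c^2 = M" by (auto simp: c_def)
  define F where "F = (LINT x|lborel. f x)"
  have F: "F \<ge> 0" unfolding F_def using f by (auto intro!: integral_nonneg_AE)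
  have [measurable]: "f \<in> borel_measurable borel" using f by auto
  define b where "b = (\<lambda>z. M / a z - lam)"
  have b: "0 \<le> b z" "b z \<le> M / lo" for z
  proof -
    have "lam * a z \<le> M" using a_le[of z] lam by (simp add: M_def)
    then show "0 \<le> b z" using a_pos[of z] by (simp add: b_def le_divide_eq)
    have "M / a z \<le> M / lo" using M a_ge[of z] lo_pos by (intro divide_left_mono) (auto simp: a_pos)
    then show "b z \<le> M / lo" using lam by (simp add: b_def)
  qed
  have [measurable]: "b \<in> borel_measurable borel" unfolding b_def by measurable
  define src where "src = (\<lambda>\<psi> z. b z * \<psi> z + f z)"
  have src_int: "integrable lborel (src \<psi>)" if "integrable lborel \<psi>" for \<psi>
    unfolding src_def
  proof (intro Bochner_Integration.integrable_add f)
    show "integrable lborel (\<lambda>z. b z * \<psi> z)"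
    proof (rule Bochner_Integration.integrable_bound[where f = "\<lambda>z. M / lo * \<psi> z"])
      show "AE z in lborel. norm (b z * \<psi> z) \<le> norm (M / lo * \<psi> z)"
        using b M lo_pos by (auto simp: abs_mult simp del: times_divide_eq_left intro!: AE_I2 mult_right_mono)
    qed (use that in auto)
  qed
  have src_nonneg: "0 \<le> src \<psi> z" if "\<And>z. 0 \<le> \<psi> z" for \<psi> z
    using that b f by (simp add: src_def)
  define it where "it = (\<lambda>n. ((\<lambda>\<psi>. smoothing c (src \<psi>)) ^^ n) (\<lambda>_. 0))"
  have it_Suc: "it (Suc n) = smoothing c (src (it n))" for n by (simp add: it_def)
  have src_cont: "isCont (src \<psi>) x" if "\<And>x. isCont \<psi> x" "x \<notin> B" for \<psi> x
    unfolding src_def b_def using f(1) a_pos[of x]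
    by (auto intro!: continuous_intros that(1) a_cont[OF that(2)] simp: continuous_on_eq_continuous_at)
  have smoothing_int: "integrable lborel (smoothing c h)"
    if h: "integrable lborel h" "\<And>z. 0 \<le> h z" "\<And>x. x \<notin> B \<Longrightarrow> isCont h x" for h
  proof (rule Bochner_Integration.integrable_bound[where f = "\<lambda>x. hi * (smoothing c h x / a x)"])
    show "integrable lborel (\<lambda>x. hi * (smoothing c h x / a x))"
      using smoothing_mass(1)[of c h] c(1) h by (intro integrable_mult_right) blast
    show "smoothing c h \<in> borel_measurable lborel"
      by (simp, intro borel_measurable_continuous_onI continuous_at_imp_continuous_on ballI smoothing_cont[OF c(1) h(1)])
    show "AE x in lborel. norm (smoothing c h x) \<le> norm (hi * (smoothing c h x / a x))"
    proof (rule AE_I2)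
      fix x
      have "smoothing c h x * a x \<le> smoothing c h x * hi"
        using smoothing_nonneg[OF c(1), of h x] h(2) a_le by (intro mult_left_mono) auto
      then have "smoothing c h x \<le> hi * (smoothing c h x / a x)"
        using a_pos[of x] by (simp add: field_simps)
      then show "norm (smoothing c h x) \<le> norm (hi * (smoothing c h x / a x))"
        using smoothing_nonneg[OF c(1), of h x] h(2) hi_pos a_pos[of x] by (simp add: abs_mult)
    qed
  qed
  have it: "(\<forall>x. 0 \<le> it n x) \<and> integrable lborel (it n) \<and> (\<forall>x. isCont (it n) x)" for n
  proof (induction n)
    case 0
    show ?case by (simp add: it_def)
  next
    case (Suc n)
    then show ?case
      unfolding it_Suc
      by (auto intro!: smoothing_nonneg[OF c(1)] smoothing_int smoothing_cont[OF c(1)] src_int src_nonneg src_cont)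
  qed
  have it_mono1: "it n x \<le> it (Suc n) x" for n x
  proof (induction n arbitrary: x)
    case 0
    show ?case using it[of "Suc 0"] by (simp add: it_def)
  next
    case (Suc n)
    have "src (it n) z \<le> src (it (Suc n)) z" for z
      using Suc[of z] b(1)[of z] by (simp add: src_def mult_left_mono)
    then have "smoothing c (src (it n)) x \<le> smoothing c (src (it (Suc n))) x"
      using it by (intro smoothing_mono[OF c(1)] src_int) auto
    then show ?case by (simp only: it_Suc)
  qed
  then have it_mono: "incseq (\<lambda>n. it n x)" for x by (rule incseq_SucI)
  have a_int: "integrable lborel (\<lambda>x. it n x / a x)" for n
  proof (rule Bochner_Integration.integrable_bound[where f = "\<lambda>x. it n x / lo"])
    have [measurable]: "it n \<in> borel_measurable borel" using it[of n] by auto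
    show "(\<lambda>x. it n x / a x) \<in> borel_measurable lborel" by simp
    show "AE x in lborel. norm (it n x / a x) \<le> norm (it n x / lo)"
      using it[of n] a_ge a_pos lo_pos by (auto simp: abs_of_pos intro!: AE_I2 divide_left_mono)
  qed (use it[of n] in auto)
  \<comment> \<open>One step changes the mass of \<open>M \<psi> / a\<close> by at most \<open>F - lam\<close> times the mass of \<open>\<psi>\<close>.
    As the iterates increase, this change is nonnegative.\<close>
  have mass: "lam * (LINT x|lborel. it n x) \<le> F" for n
  proof -
    have "(LINT x|lborel. it (Suc n) x / a x) \<le> (LINT z|lborel. src (it n) z) / M"
      using smoothing_mass(2)[of c "src (it n)"] src_int[of "it n"] src_nonneg[of "it n"] src_cont[of "it n"] it[of n] c
      unfolding it_Suc by auto
    moreover have "(LINT x|lborel. it n x / a x) \<le> (LINT x|lborel. it (Suc n) x / a x)"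
      using it_mono1 a_pos by (intro integral_mono a_int divide_right_mono) (auto simp: less_imp_le)
    moreover have "(LINT z|lborel. src (it n) z) = M * (LINT x|lborel. it n x / a x) - lam * (LINT x|lborel. it n x) + F"
    proof -
      have "src (it n) = (\<lambda>z. (M * (it n z / a z) - lam * it n z) + f z)"
        by (auto simp: src_def b_def algebra_simps)
      then have "(LINT z|lborel. src (it n) z) = (LINT z|lborel. (M * (it n z / a z) - lam * it n z) + f z)" by simp
      also have "\<dots> = (LINT z|lborel. M * (it n z / a z) - lam * it n z) + F"
        unfolding F_def using a_int[of n] it[of n] f
        by (intro Bochner_Integration.integral_add Bochner_Integration.integrable_diff integrable_mult_right) auto
      also have "(LINT z|lborel. M * (it n z / a z) - lam * it n z) = (LINT z|lborel. M * (it n z / a z)) - (LINT z|lborel. lam * it n z)"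
        using a_int[of n] it[of n] by (intro Bochner_Integration.integral_diff integrable_mult_right) auto
      finally show ?thesis by (simp only: integral_mult_right_zero)
    qed
    ultimately have "(LINT x|lborel. it n x / a x) \<le>
        (M * (LINT x|lborel. it n x / a x) - lam * (LINT x|lborel. it n x) + F) / M"
      by (metis order_trans)
    then show ?thesis using M by (simp add: le_divide_eq mult.commute)
  qed
  define K where "K = (hi / lo + 1) / (2 * c) * F"
  have src_bound: "(LINT z|lborel. src \<psi> z) \<le> (hi / lo + 1) * F"
    if "integrable lborel \<psi>" "\<And>z. 0 \<le> \<psi> z" "lam * (LINT x|lborel. \<psi> x) \<le> F" for \<psi>
  proof -
    have "(LINT z|lborel. src \<psi> z) \<le> (LINT z|lborel. M / lo * \<psi> z + f z)"
      using that b f unfolding src_def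
      by (intro integral_mono src_int[unfolded src_def] Bochner_Integration.integrable_add integrable_mult_right
          add_right_mono mult_right_mono) auto
    also have "\<dots> = M / lo * (LINT z|lborel. \<psi> z) + F"
      unfolding F_def using that f by (subst Bochner_Integration.integral_add) auto
    also have "M / lo * (LINT z|lborel. \<psi> z) = hi / lo * (lam * (LINT z|lborel. \<psi> z))"
      by (simp add: M_def)
    also have "\<dots> \<le> hi / lo * F"
      using that hi_pos lo_pos by (intro mult_left_mono) auto
    finally show ?thesis by (simp add: algebra_simps)
  qed
  have it_le: "it n x \<le> K" for n x
  proof -
    have "it (Suc n) x \<le> (LINT z|lborel. src (it n) z) / (2 * c)"
      unfolding it_Suc using it[of n] by (intro smoothing_le c src_int src_nonneg) auto
    also have "\<dots> \<le> ((hi / lo + 1) * F) / (2 * c)"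
      using it[of n] mass[of n] c(1) by (intro divide_right_mono src_bound) auto
    finally show ?thesis using it_mono1[of n x] by (simp add: K_def)
  qed
  define \<psi> where "\<psi> = (\<lambda>x. SUP n. it n x)"
  have lim: "(\<lambda>n. it n x) \<longlonglongrightarrow> \<psi> x" for x
    unfolding \<psi>_def using it_le[of _ x] by (intro LIMSEQ_incseq_SUP it_mono bdd_aboveI2) auto
  have it_le_psi: "it n x \<le> \<psi> x" for n x
    using incseq_le[OF it_mono lim] by blast
  have psi_nonneg: "0 \<le> \<psi> x" for x using it[of 0] it_le_psi[of 0 x] by (meson order_trans)
  have "incseq (\<lambda>n. LINT x|lborel. it n x)"
    using it it_mono1 by (intro incseq_SucI integral_mono) auto
  moreover have "(LINT x|lborel. it n x) \<le> F / lam" for n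
    using mass[of n] lam by (simp add: le_divide_eq mult.commute)
  ultimately obtain X where X: "(\<lambda>n. LINT x|lborel. it n x) \<longlonglongrightarrow> X"
    using incseq_convergent[of "\<lambda>n. LINT x|lborel. it n x" "F / lam"] by blast
  have meas: "\<psi> \<in> borel_measurable lborel"
    by (rule borel_measurable_LIMSEQ_real[OF lim]) (use it in \<open>blast intro: borel_measurable_integrable\<close>)
  have mc: "integrable lborel \<psi>" "(LINT x|lborel. \<psi> x) = X"
    using integrable_monotone_convergence[of lborel it \<psi> X] integral_monotone_convergence[of lborel it \<psi> X]
      it it_mono lim X meas by (auto simp: incseq_def mono_def)
  have psi_mass: "lam * (LINT x|lborel. \<psi> x) \<le> F"
    unfolding mc(2) by (rule LIMSEQ_le_const2[OF tendsto_mult_left[OF X]]) (use mass in auto)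
  have fix_eq: "\<psi> x = smoothing c (src \<psi>) x" for x
  proof -
    have "(\<lambda>n. smoothing c (src (it n)) x) \<longlonglongrightarrow> smoothing c (src \<psi>) x"
      unfolding smoothing_def
    proof (rule integral_dominated_convergence[where w = "\<lambda>z. kern c x z * src \<psi> z"])
      show "integrable lborel (\<lambda>z. kern c x z * src \<psi> z)"
        by (intro kern_integrable c src_int mc)
      then show "(\<lambda>z. kern c x z * src \<psi> z) \<in> borel_measurable lborel" by simp
      show "(\<lambda>z. kern c x z * src (it n) z) \<in> borel_measurable lborel" for n
        by (intro borel_measurable_integrable kern_integrable c src_int) (use it[of n] in auto)
      show "AE z in lborel. (\<lambda>n. kern c x z * src (it n) z) \<longlonglongrightarrow> kern c x z * src \<psi> z"
        unfolding src_def by (intro AE_I2 tendsto_intros lim)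
      show "AE z in lborel. norm (kern c x z * src (it n) z) \<le> kern c x z * src \<psi> z" for n
      proof (rule AE_I2)
        fix z
        have "src (it n) z \<le> src \<psi> z" "0 \<le> src (it n) z"
          using it_le_psi[of n z] it[of n] b(1)[of z] f(2)[of z] by (simp_all add: src_def mult_left_mono)
        then show "norm (kern c x z * src (it n) z) \<le> kern c x z * src \<psi> z"
          using kern_nonneg[OF c(1), of x z] by (simp add: abs_mult mult_left_mono)
      qed
    qed
    then have "(\<lambda>n. it (Suc n) x) \<longlonglongrightarrow> smoothing c (src \<psi>) x" by (simp add: it_Suc)
    then show ?thesis using LIMSEQ_unique LIMSEQ_Suc[OF lim] by blast
  qed
  define m where "m = smoothing_flux c (src \<psi>)"
  have psi_eq: "\<psi> = smoothing c (src \<psi>)" using fix_eq by auto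
  have i: "integrable lborel (src \<psi>)" by (rule src_int[OF mc(1)])
  have psi_cont: "isCont \<psi> x" for x
    using smoothing_cont(1)[OF c(1) i] psi_eq by simp
  have m_cont: "isCont m x" for x
    unfolding m_def by (rule smoothing_cont(2)[OF c(1) i])
  have der: "(\<psi> has_real_derivative m x / a x) (at x)" "(m has_real_derivative lam * \<psi> x - f x) (at x)"
    if x: "x \<notin> B" for x
  proof -
    note sc = src_cont[OF psi_cont x]
    show "(\<psi> has_real_derivative m x / a x) (at x)"
      using smoothing_deriv(1)[OF c(1) i sc x] psi_eq by (simp add: m_def)
    have "(m has_real_derivative c^2 * \<psi> x / a x - src \<psi> x) (at x)"
      using smoothing_deriv(2)[OF c(1) i sc x] fix_eq[of x] by (simp add: m_def)
    also have "c^2 * \<psi> x / a x - src \<psi> x = lam * \<psi> x - f x"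
      by (simp add: c src_def b_def algebra_simps)
    finally show "(m has_real_derivative lam * \<psi> x - f x) (at x)" .
  qed
  have psi_le: "\<psi> x \<le> K" for x
    by (rule LIMSEQ_le_const2[OF lim]) (use it_le in auto)
  have "\<bar>m x\<bar> \<le> c * K" for x
  proof -
    have "\<bar>m x\<bar> \<le> c * \<psi> x"
      using smoothing_flux_le[OF c(1) i, of x] src_nonneg[of \<psi>] psi_nonneg fix_eq[of x] by (simp add: m_def)
    also have "\<dots> \<le> c * K" using psi_le c by (intro mult_left_mono) auto
    finally show ?thesis .
  qed
  then have "\<bar>\<psi> x\<bar> \<le> max K (c * K) \<and> \<bar>m x\<bar> \<le> max K (c * K)" for x
    using psi_le[of x] psi_nonneg[of x] by (simp add: le_max_iff_disj)
  moreover have "K = (hi / lo + 1) / (2 * sqrt (lam * hi)) * (LINT x|lborel. f x)"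
    by (simp add: K_def c_def M_def F_def)
  ultimately have "resolves lam f \<psi> m"
    unfolding resolves_def using psi_cont m_cont der psi_nonneg mc(1) psi_mass psi_le F_def
    by (auto intro!: continuous_at_imp_continuous_on)
  then show ?thesis by blast
qed

text \<open>On \<open>I\<close>, where \<open>a\<close> is constant, the second-order equation factors into two first-order equations:
  \<open>m - a \<mu> \<psi>\<close> satisfies one with rate \<open>\<mu>\<close>, and \<open>\<psi>\<close> one with rate \<open>- \<mu>\<close>, where
  \<open>a \<mu>\<^sup>2 = \<lambda>\<close>.\<close>

lemma resolves_extends_smoothly:
  assumes res: "resolves lam f \<psi> m" "lam > 0"
    and I: "open I" "is_interval I" "I \<inter> B = {}" and const: "\<And>x. x \<in> I \<Longrightarrow> a x = a0"
    and f: "extends_smoothly I f"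
  shows "extends_smoothly I \<psi>"
proof (cases "I = {}")
  case True
  then show ?thesis using smooth_const by (auto simp: extends_smoothly_def)
next
  case False
  then have a0: "a0 > 0" using const a_pos by (metis ex_in_conv)
  define \<mu> where "\<mu> = sqrt (lam / a0)"
  have mu: "a0 * \<mu> * \<mu> = lam" using a0 assms(2) by (simp add: \<mu>_def mult.assoc)
  have scale: "extends_smoothly I (\<lambda>x. k * g x)" if g: "extends_smoothly I g" for k g
  proof -
    obtain G where "smooth G" "\<forall>x\<in>I. g x = G x" using g by (auto simp: extends_smoothly_def)
    then show ?thesis unfolding extends_smoothly_def
      by (intro exI[of _ "\<lambda>x. k * G x"]) (auto intro!: smooth_mult smooth_const)
  qed
  have der: "(\<psi> has_real_derivative m x / a0) (at x)" "(m has_real_derivative lam * \<psi> x - f x) (at x)"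
    if "x \<in> I" for x
    using res I const[OF that] that by (auto simp: resolves_def)
  have "extends_smoothly I (\<lambda>x. m x - a0 * \<mu> * \<psi> x)"
  proof (rule first_order_extends_smoothly[OF I(1,2), where \<mu> = \<mu> and g = "\<lambda>x. (-1) * f x"])
    fix x assume x: "x \<in> I"
    have "((\<lambda>x. m x - a0 * \<mu> * \<psi> x) has_real_derivative lam * \<psi> x - f x - a0 * \<mu> * (m x / a0)) (at x)"
      by (intro DERIV_diff DERIV_cmult der x)
    also have "lam * \<psi> x - f x - a0 * \<mu> * (m x / a0) = (-1) * f x - \<mu> * (m x - a0 * \<mu> * \<psi> x)"
      using a0 by (simp add: mu[symmetric] algebra_simps)
    finally show "((\<lambda>x. m x - a0 * \<mu> * \<psi> x) has_real_derivative (-1) * f x - \<mu> * (m x - a0 * \<mu> * \<psi> x)) (at x)" .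
  qed (rule scale[OF f])
  then have E: "extends_smoothly I (\<lambda>x. 1 / a0 * (m x - a0 * \<mu> * \<psi> x))" by (rule scale)
  show ?thesis
  proof (rule first_order_extends_smoothly[OF I(1,2) _ E])
    fix x assume x: "x \<in> I"
    show "(\<psi> has_real_derivative 1 / a0 * (m x - a0 * \<mu> * \<psi> x) - (- \<mu>) * \<psi> x) (at x)"
      using der(1)[OF x] a0 by (simp add: field_simps)
  qed
qed

end

section \<open>A Post-Widder positivity criterion\<close>

lemma power_div_fact_le:
  fixes x :: real
  assumes "j \<le> m" "real m \<le> x"
  shows "x ^ j / fact j \<le> x ^ m / fact m"
  using assms(1)
proof (induction rule: inc_induct)
  case base
  show ?case by simp
next
  case (step k)
  have x: "0 \<le> x" using assms(2) by (meson of_nat_0_le_iff order_trans)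
  have "real (Suc k) \<le> x" using step.hyps(2) assms(2) by (meson Suc_leI of_nat_mono order_trans)
  then have "x ^ k / fact k * 1 \<le> x ^ k / fact k * (x / real (Suc k))"
    using x by (intro mult_left_mono) (auto simp: le_divide_eq)
  also have "\<dots> = x ^ Suc k / fact (Suc k)"
    by (simp add: field_simps)
  finally show ?case using step.IH by simp
qed

text \<open>If each \<open>p (k + 1)\<close> is an antiderivative of \<open>- p k\<close>, repeated integration by parts of
  \<open>p 0 t * t ^ m / fact m\<close> produces this sum.\<close>

lemma telescoping_deriv:
  fixes p :: "nat \<Rightarrow> real \<Rightarrow> real"
  assumes "\<And>k. (p (Suc k) has_real_derivative - p k t) (at t)"
  shows "((\<lambda>t. \<Sum>j\<le>m. p (Suc m - j) t * t ^ j / fact j) has_real_derivative - (p 0 t * t ^ m / fact m)) (at t)"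
  using assms
proof (induction m arbitrary: p)
  case 0
  then show ?case by simp
next
  case (Suc m)
  have eq: "(\<Sum>j\<le>Suc m. p (Suc (Suc m) - j) t * t ^ j / fact j) =
      (\<Sum>j\<le>m. p (Suc (Suc m - j)) t * t ^ j / fact j) + p 1 t * (t ^ Suc m / fact (Suc m))" for t
    by (auto simp: Suc_diff_le intro!: sum.cong)
  have 1: "((\<lambda>t. \<Sum>j\<le>m. p (Suc (Suc m - j)) t * t ^ j / fact j) has_real_derivative
      - (p (Suc 0) t * t ^ m / fact m)) (at t)"
    by (rule Suc.IH[of "\<lambda>k. p (Suc k)"]) (rule Suc.prems)
  have 2: "((\<lambda>t. t ^ Suc m / fact (Suc m)) has_real_derivative t ^ m / fact m) (at t)"
    by (rule DERIV_cong[OF DERIV_cdivide[OF DERIV_power[OF DERIV_ident]]]) (simp del: of_nat_Suc)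
  have 3: "(p 1 has_real_derivative - p 0 t) (at t)" using Suc.prems[of 0] by simp
  have "((\<lambda>t. (\<Sum>j\<le>m. p (Suc (Suc m - j)) t * t ^ j / fact j) + p 1 t * (t ^ Suc m / fact (Suc m)))
      has_real_derivative - (p (Suc 0) t * t ^ m / fact m) + (- p 0 t * (t ^ Suc m / fact (Suc m)) + t ^ m / fact m * p 1 t)) (at t)"
    by (intro DERIV_add DERIV_mult 1 2 3)
  then show ?case
    unfolding eq by (rule DERIV_cong) simp
qed

text \<open>The profile of the weights in the Post-Widder formula: \<open>s ^ m * exp (- m s / t0)\<close> is its
  \<open>m\<close>-th power, and so concentrates at the maximum \<open>t0\<close> as \<open>m\<close> grows.\<close>

lemma peak_profile:
  fixes t0 :: real
  assumes h_def: "h = (\<lambda>s. s * exp (- s / t0))" and "0 < t0"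
  shows "\<And>s t. 0 \<le> s \<Longrightarrow> s \<le> t \<Longrightarrow> t \<le> t0 \<Longrightarrow> h s \<le> h t"
    and "\<And>s t. t0 \<le> s \<Longrightarrow> s \<le> t \<Longrightarrow> h t \<le> h s"
    and "\<And>s. 0 \<le> s \<Longrightarrow> s \<noteq> t0 \<Longrightarrow> h s < h t0"
proof -
  have d: "(h has_real_derivative exp (- s / t0) * (1 - s / t0)) (at s)" for s
    unfolding h_def using assms(2)
    by (auto intro!: derivative_eq_intros simp: algebra_simps)
  have c: "continuous_on S h" for S
    using d by (meson DERIV_atLeastAtMost_imp_continuous_on DERIV_isCont continuous_at_imp_continuous_on)
  show "h s \<le> h t" if "0 \<le> s" "s \<le> t" "t \<le> t0" for s t
    by (rule DERIV_nonneg_imp_nondecreasing[OF that(2)])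
      (use d that assms(2) in \<open>force intro!: mult_nonneg_nonneg simp: divide_le_eq\<close>)
  show "h t \<le> h s" if "t0 \<le> s" "s \<le> t" for s t
    by (rule DERIV_nonpos_imp_nonincreasing[OF that(2)])
      (use d that assms(2) in \<open>force intro!: mult_nonneg_nonpos simp: le_divide_eq\<close>)
  show "h s < h t0" if "0 \<le> s" "s \<noteq> t0" for s
  proof (cases "s < t0")
    case True
    show ?thesis
      by (rule DERIV_pos_imp_increasing_open[OF True _ c])
        (use d assms(2) in \<open>force intro!: mult_pos_pos simp: divide_less_eq\<close>)
  next
    case False
    then have "t0 < s" using that by simp
    then show ?thesis
      by (rule DERIV_neg_imp_decreasing_open[OF _ _ c])
        (use d assms(2) in \<open>force intro!: mult_pos_neg simp: less_divide_eq\<close>)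
  qed
qed

text \<open>The functions \<open>G lam k\<close> stand for the pairings of a solution with the \<open>k\<close>-th iterated resolvent of
  a fixed function. Integrating \<open>g(s) s\<^sup>m exp(- lam s)\<close> by parts repeatedly over \<open>(0, T)\<close> leaves a positive multiple of
  the nonnegative initial value \<open>c lam (m + 1)\<close> and terms at the final time \<open>T\<close>. For \<open>lam = m / t0\<close> the
  weights are the powers \<open>h(s) ^ m\<close> of a profile with its peak at \<open>t0\<close>, whereas the terms at \<open>T\<close> are
  of the order \<open>h(T) ^ m\<close>. If \<open>g\<close> were negative near \<open>t0\<close>, this neighbourhood would dominate
  everything else for large \<open>m\<close> and make the integral too negative.\<close>

lemma post_widder_nonneg:
  fixes G :: "real \<Rightarrow> nat \<Rightarrow> real \<Rightarrow> real" and g :: "real \<Rightarrow> real"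
  assumes t0: "0 < t0" "t0 < T"
    and G0: "\<And>lam. 0 < lam \<Longrightarrow> G lam 0 = g"
    and der: "\<And>lam k t. 0 < lam \<Longrightarrow> 0 < t \<Longrightarrow>
      (G lam (Suc k) has_real_derivative lam * G lam (Suc k) t - G lam k t) (at t)"
    and cont: "continuous_on {0<..} g"
    and init: "\<And>lam k. 0 < lam \<Longrightarrow> (G lam k \<longlongrightarrow> c lam k) (at_right 0)" "\<And>lam k. 0 < lam \<Longrightarrow> 0 \<le> c lam k"
    and bound: "\<And>lam k. 0 < lam \<Longrightarrow> \<bar>G lam k T\<bar> \<le> C / lam ^ k"
  shows "0 \<le> g t0"
proof (rule ccontr)
  assume "\<not> 0 \<le> g t0"
  define \<delta> where "\<delta> = - g t0 / 2"
  have \<delta>: "\<delta> > 0" "g t0 < - \<delta>" using \<open>\<not> 0 \<le> g t0\<close> by (auto simp: \<delta>_def)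
  define h where "h = (\<lambda>s. s * exp (- s / t0))"
  note h_props = peak_profile[OF h_def t0(1)]
  have C: "C \<ge> 0" using bound[of 1 0] by simp
  have h_cont: "continuous_on S h" for S
    unfolding h_def using t0 by (intro continuous_intros) auto
  have h_pos: "0 < s \<Longrightarrow> 0 < h s" for s by (simp add: h_def)
  have isg: "isCont g t" if "0 < t" for t
    using cont that by (simp add: continuous_on_eq_continuous_at)
  obtain M where M: "M \<ge> 0" "\<And>t. 0 < t \<Longrightarrow> t \<le> T \<Longrightarrow> \<bar>g t\<bar> \<le> M"
  proof -
    have "(g \<longlongrightarrow> c 1 0) (at_right 0)" using init(1)[of 1 0] G0[of 1] by simp
    then have "\<forall>\<^sub>F t in at_right 0. dist (g t) (c 1 0) < 1" by (rule tendstoD) simp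
    then obtain b where b: "b > 0" "\<And>t. 0 < t \<Longrightarrow> t < b \<Longrightarrow> dist (g t) (c 1 0) < 1"
      unfolding eventually_at_right_field by auto
    have "compact (g ` {b..T})"
      using b by (intro compact_continuous_image continuous_on_subset[OF cont]) auto
    then obtain K where K: "\<forall>y\<in>g ` {b..T}. \<bar>y\<bar> \<le> K" by (metis bounded_iff compact_imp_bounded real_norm_def)
    have "\<bar>g t\<bar> \<le> max (\<bar>c 1 0\<bar> + 1) K" if "0 < t" "t \<le> T" for t
    proof (cases "t < b")
      case True
      then show ?thesis using b(2)[OF that(1) True] by (auto simp: dist_real_def)
    next
      case False
      then have "\<bar>g t\<bar> \<le> K" using K that by force
      then show ?thesis by simp
    qed
    then show ?thesis by (intro that[of "max (\<bar>c 1 0\<bar> + 1) K"]) auto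
  qed
  obtain \<eta> where \<eta>: "0 < \<eta>" "\<eta> < t0" "t0 + \<eta> < T" "\<And>t. \<bar>t - t0\<bar> \<le> \<eta> \<Longrightarrow> g t < - \<delta>"
  proof -
    have "\<forall>\<^sub>F t in at t0. g t < - \<delta>"
      using isg[OF t0(1)] \<delta>(2) unfolding isCont_def by (rule order_tendstoD)
    then obtain d where d: "d > 0" "\<And>t. t \<noteq> t0 \<Longrightarrow> dist t t0 < d \<Longrightarrow> g t < - \<delta>"
      unfolding eventually_at by auto
    have "\<exists>e>0. e < d \<and> e < t0 \<and> e < T - t0"
      using d t0 by (intro exI[of _ "min d (min t0 (T - t0)) / 2"]) auto
    then obtain e where "e > 0" "e < d" "e < t0" "e < T - t0" by blast
    then show ?thesis using d(2) \<delta>(2)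
      by (intro that[of e]) (auto simp: dist_real_def, metis dist_real_def order_le_less_trans)
  qed
  \<comment> \<open>The profile is at most \<open>h1\<close> at distance \<open>\<eta>\<close> or more from the peak, and at least \<open>h2 > h1\<close> within
    distance \<open>\<theta>\<close>; the ratio \<open>h2 / h1\<close> decides for large \<open>m\<close>.\<close>
  define h1 where "h1 = max (h (t0 - \<eta>)) (h (t0 + \<eta>))"
  have h1: "0 < h1" "h1 < h t0" using h_pos[of "t0 - \<eta>"] h_props(3) \<eta> t0 by (auto simp: h1_def less_max_iff_disj)
  have h_out: "h t \<le> h1" if "0 \<le> t" "\<eta> \<le> \<bar>t - t0\<bar>" for t
  proof (cases "t \<le> t0")
    case True
    then have "h t \<le> h (t0 - \<eta>)" using that \<eta> by (intro h_props(1)) auto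
    then show ?thesis by (simp add: h1_def)
  next
    case False
    then have "h t \<le> h (t0 + \<eta>)" using that \<eta> by (intro h_props(2)) auto
    then show ?thesis by (simp add: h1_def)
  qed
  define h2 where "h2 = (h1 + h t0) / 2"
  have h2: "h1 < h2" "h2 < h t0" using h1 by (auto simp: h2_def)
  obtain \<theta> where \<theta>: "0 < \<theta>" "\<theta> < \<eta>" "\<And>t. \<bar>t - t0\<bar> \<le> \<theta> \<Longrightarrow> h2 \<le> h t"
  proof -
    have "isCont h t0" using h_cont[of UNIV] by (simp add: continuous_on_eq_continuous_at)
    then have "\<forall>\<^sub>F t in at t0. h2 < h t"
      using h2(2) unfolding isCont_def by (rule order_tendstoD)
    then obtain d where d: "d > 0" "\<And>t. t \<noteq> t0 \<Longrightarrow> dist t t0 < d \<Longrightarrow> h2 < h t"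
      unfolding eventually_at by auto
    have "\<exists>e>0. e < d \<and> e < \<eta>"
      using d \<eta> by (intro exI[of _ "min d \<eta> / 2"]) auto
    then obtain e where e: "e > 0" "e < d" "e < \<eta>" by blast
    have "h2 \<le> h t" if "\<bar>t - t0\<bar> \<le> e" for t
      using d(2)[of t] h2(2) e that by (cases "t = t0") (auto simp: dist_real_def less_imp_le)
    then show ?thesis using e by (intro that[of e]) auto
  qed
  \<comment> \<open>The interval of radius \<open>\<theta>\<close> contributes at most \<open>- 2 \<delta> \<theta> h2\<^sup>m\<close> to the integral, the rest of
    \<open>(0, T)\<close> at most \<open>M T h1\<^sup>m\<close>, and the terms at time \<open>T\<close> at most \<open>2 C t0 h1\<^sup>m\<close>.\<close>
  have key: "2 * \<delta> * \<theta> * h2 ^ m \<le> (M * T + 2 * C * t0) * h1 ^ m" if m: "m \<ge> 1" for m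
  proof -
    define lam where "lam = real m / t0"
    have lam: "lam > 0" using m t0 by (simp add: lam_def)
    define p where "p = (\<lambda>k t. exp (- lam * t) * G lam k t)"
    define S where "S = (\<lambda>t. \<Sum>j\<le>m. p (Suc m - j) t * t ^ j / fact j)"
    have p_der: "(p (Suc k) has_real_derivative - p k t) (at t)" if "0 < t" for k t
    proof -
      have "(p (Suc k) has_real_derivative
          (exp (- lam * t) * (- lam)) * G lam (Suc k) t + (lam * G lam (Suc k) t - G lam k t) * exp (- lam * t)) (at t)"
        unfolding p_def
        by (intro DERIV_mult der[OF lam that] DERIV_chain2[OF DERIV_exp]) (auto intro!: derivative_eq_intros)
      then show ?thesis by (rule DERIV_cong) (simp add: p_def algebra_simps)
    qed
    have S_der: "(S has_real_derivative - (p 0 t * t ^ m / fact m)) (at t)" if "0 < t" for t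
      unfolding S_def by (rule telescoping_deriv[of p, OF p_der[OF that]])
    have p0: "p 0 t * t ^ m = g t * h t ^ m" for t
    proof -
      have "exp (- lam * t) = exp (- t / t0) ^ m"
        by (simp add: lam_def exp_of_nat_mult[symmetric] mult.commute)
      then show ?thesis by (simp add: p_def G0[OF lam] h_def power_mult_distrib)
    qed
    have f_cont: "continuous_on {\<epsilon>..T} (\<lambda>t. g t * h t ^ m)" if "0 < \<epsilon>" for \<epsilon>
      using that by (intro continuous_intros h_cont continuous_on_subset[OF cont]) auto
    have f_out: "g t * h t ^ m \<le> M * h1 ^ m" if "0 < t" "t \<le> T" for t
    proof (cases "\<bar>t - t0\<bar> \<le> \<eta>")
      case True
      then have "g t * h t ^ m \<le> 0"
        using \<eta>(4)[OF True] \<delta> h_pos[OF that(1)] by (intro mult_nonpos_nonneg) auto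
      moreover have "0 \<le> M * h1 ^ m" using M h1 by auto
      ultimately show ?thesis by linarith
    next
      case False
      have "h t ^ m \<le> h1 ^ m" using h_out[of t] that False h_pos[OF that(1)] by (intro power_mono) auto
      moreover have "g t \<le> M" using M(2)[OF that] by simp
      ultimately show ?thesis
        using h_pos[OF that(1)] M h1 by (intro mult_mono) auto
    qed
    have f_in: "g t * h t ^ m \<le> - (\<delta> * h2 ^ m)" if "\<bar>t - t0\<bar> \<le> \<theta>" for t
    proof -
      have "0 < t" using that \<theta> \<eta> by auto
      have "\<delta> * h2 ^ m \<le> (- g t) * h t ^ m"
        using \<eta>(4)[of t] \<theta>(2) \<theta>(3)[OF that] that \<delta> h1 h2
        by (intro mult_mono power_mono) auto
      then show ?thesis by simp
    qed
    have le: "S \<epsilon> * fact m \<le> M * h1 ^ m * T - 2 * \<theta> * (\<delta> * h2 ^ m) + S T * fact m"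
      if \<epsilon>: "0 < \<epsilon>" "\<epsilon> < t0 - \<theta>" for \<epsilon>
    proof -
      have "((\<lambda>t. g t * h t ^ m) has_integral - S T * fact m - - S \<epsilon> * fact m) {\<epsilon>..T}"
      proof (rule fundamental_theorem_of_calculus)
        fix t assume "t \<in> {\<epsilon>..T}"
        then have "0 < t" using \<epsilon> by auto
        have "((\<lambda>t. - S t * fact m) has_real_derivative - (- (p 0 t * t ^ m / fact m)) * fact m) (at t)"
          by (intro DERIV_cmult_right DERIV_minus S_der \<open>0 < t\<close>)
        then have "((\<lambda>t. - S t * fact m) has_real_derivative g t * h t ^ m) (at t)"
          by (simp add: p0)
        then show "((\<lambda>t. - S t * fact m) has_vector_derivative g t * h t ^ m) (at t within {\<epsilon>..T})"
          by (simp add: has_real_derivative_iff_has_vector_derivative has_vector_derivative_at_within)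
      qed (use \<epsilon> t0 \<theta> in auto)
      then have 1: "integral {\<epsilon>..T} (\<lambda>t. g t * h t ^ m) = S \<epsilon> * fact m - S T * fact m"
        by (simp add: integral_unique)
      have i: "(\<lambda>t. g t * h t ^ m) integrable_on {\<epsilon>..T}"
        by (intro integrable_continuous_real f_cont \<epsilon>)
      have sub: "(\<lambda>t. g t * h t ^ m) integrable_on {u..v}" if "\<epsilon> \<le> u" "v \<le> T" for u v
        by (rule integrable_subinterval_real[OF i]) (use that in auto)
      have part: "integral {u..v} (\<lambda>t. g t * h t ^ m) \<le> k * (v - u)"
        if "\<epsilon> \<le> u" "u \<le> v" "v \<le> T" "\<And>t. t \<in> {u..v} \<Longrightarrow> g t * h t ^ m \<le> k" for u v k
        using integral_le[OF sub[OF that(1,3)] integrable_const_ivl[of k u v]] that by (simp add: mult.commute)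
      have "integral {\<epsilon>..T} (\<lambda>t. g t * h t ^ m) = integral {\<epsilon>..t0-\<theta>} (\<lambda>t. g t * h t ^ m) +
          (integral {t0-\<theta>..t0+\<theta>} (\<lambda>t. g t * h t ^ m) + integral {t0+\<theta>..T} (\<lambda>t. g t * h t ^ m))"
        using Henstock_Kurzweil_Integration.integral_combine[OF _ _ i, of "t0-\<theta>"]
          Henstock_Kurzweil_Integration.integral_combine[OF _ _ sub[of "t0-\<theta>" T], of "t0+\<theta>"] \<epsilon> \<theta> \<eta> by simp
      also have "\<dots> \<le> M * h1 ^ m * (t0 - \<theta> - \<epsilon>) + (- (\<delta> * h2 ^ m) * (t0 + \<theta> - (t0 - \<theta>)) + M * h1 ^ m * (T - (t0 + \<theta>)))"
        using \<epsilon> \<theta> \<eta> by (intro add_mono part f_out f_in) auto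
      also have "\<dots> = M * h1 ^ m * (T - 2 * \<theta> - \<epsilon>) - 2 * \<theta> * (\<delta> * h2 ^ m)"
        by (simp add: algebra_simps)
      also have "M * h1 ^ m * (T - 2 * \<theta> - \<epsilon>) \<le> M * h1 ^ m * T"
        using M h1 \<theta> \<epsilon> by (intro mult_left_mono) auto
      finally show ?thesis using 1 by linarith
    qed
    have ST: "S T * fact m \<le> 2 * C * t0 * h1 ^ m"
    proof -
      have T: "0 < T" using t0 by simp
      have lT: "real m \<le> lam * T" using t0 m by (simp add: lam_def le_divide_eq mult_left_mono)
      have termwise: "p (Suc m - j) T * T ^ j / fact j \<le> C * exp (- lam * T) / lam * (T ^ m / fact m)" if "j \<le> m" for j
      proof -
        have "p (Suc m - j) T * T ^ j / fact j \<le> (exp (- lam * T) * (C / lam ^ (Suc m - j))) * T ^ j / fact j"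
          unfolding p_def using bound[OF lam, of "Suc m - j"] T
          by (intro divide_right_mono mult_right_mono mult_left_mono) auto
        also have "\<dots> = C * exp (- lam * T) / lam ^ Suc m * ((lam * T) ^ j / fact j)"
          using that lam by (simp add: power_mult_distrib power_diff Suc_diff_le field_simps)
        also have "\<dots> \<le> C * exp (- lam * T) / lam ^ Suc m * ((lam * T) ^ m / fact m)"
          using C lam by (intro mult_left_mono power_div_fact_le that lT) auto
        also have "\<dots> = C * exp (- lam * T) / lam * (T ^ m / fact m)"
          using lam by (simp add: power_mult_distrib)
        finally show ?thesis .
      qed
      have "S T \<le> (\<Sum>j\<le>m. C * exp (- lam * T) / lam * (T ^ m / fact m))"
        unfolding S_def by (intro sum_mono termwise) simp
      also have "\<dots> = real (Suc m) * (C * exp (- lam * T) / lam * (T ^ m / fact m))" by simp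
      finally have "S T * fact m \<le> real (Suc m) * (C * exp (- lam * T) / lam * (T ^ m / fact m)) * fact m"
        by (intro mult_right_mono) auto
      also have "\<dots> = (real (Suc m) / lam) * C * (T ^ m * exp (- lam * T))"
        by simp
      also have "T ^ m * exp (- lam * T) = h T ^ m"
        by (simp add: h_def power_mult_distrib lam_def exp_of_nat_mult[symmetric] mult.commute)
      also have "(real (Suc m) / lam) * C * h T ^ m \<le> (2 * t0) * C * h1 ^ m"
      proof (intro mult_mono power_mono mult_right_mono)
        show "real (Suc m) / lam \<le> 2 * t0" using m t0 by (simp add: lam_def field_simps)
        show "h T \<le> h1" using t0 \<eta> by (intro h_out) auto
      qed (use C h_pos[OF T] t0 in auto)
      finally show ?thesis by (simp add: mult_ac)
    qed
    have "((\<lambda>t. S t * fact m) \<longlongrightarrow> (\<Sum>j\<le>m. (exp (- lam * 0) * c lam (Suc m - j)) * 0 ^ j / fact j) * fact m) (at_right 0)"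
      unfolding S_def p_def by (intro tendsto_intros init lam) auto
    moreover have "\<forall>\<^sub>F \<epsilon> in at_right 0. S \<epsilon> * fact m \<le> M * h1 ^ m * T - 2 * \<theta> * (\<delta> * h2 ^ m) + S T * fact m"
      using \<theta> \<eta> le unfolding eventually_at_right_field by (intro exI[of _ "t0 - \<theta>"]) auto
    ultimately have "(\<Sum>j\<le>m. (exp (- lam * 0) * c lam (Suc m - j)) * 0 ^ j / fact j) * fact m
        \<le> M * h1 ^ m * T - 2 * \<theta> * (\<delta> * h2 ^ m) + S T * fact m"
      by (rule tendsto_upperbound) simp
    moreover have "0 \<le> (\<Sum>j\<le>m. (exp (- lam * 0) * c lam (Suc m - j)) * 0 ^ j / fact j) * fact m"
      using init(2)[OF lam] by (intro mult_nonneg_nonneg sum_nonneg) auto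
    ultimately have "2 * \<theta> * (\<delta> * h2 ^ m) \<le> M * h1 ^ m * T + 2 * C * t0 * h1 ^ m"
      using ST by linarith
    then show ?thesis by (simp add: algebra_simps)
  qed
  have "1 < h2 / h1" using h1 h2 by simp
  then obtain n where n: "(M * T + 2 * C * t0) / (2 * \<delta> * \<theta>) < (h2 / h1) ^ n"
    using real_arch_pow by blast
  also have "(h2 / h1) ^ n \<le> (h2 / h1) ^ Suc n"
    using \<open>1 < h2 / h1\<close> by (intro power_increasing) auto
  finally have "M * T + 2 * C * t0 < (h2 / h1) ^ Suc n * (2 * \<delta> * \<theta>)"
    using \<delta> \<theta> by (simp add: divide_less_eq)
  then have "(M * T + 2 * C * t0) * h1 ^ Suc n < (h2 / h1) ^ Suc n * (2 * \<delta> * \<theta>) * h1 ^ Suc n"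
    using h1 by (intro mult_strict_right_mono) auto
  also have "\<dots> = 2 * \<delta> * \<theta> * h2 ^ Suc n"
    using h1 by (simp add: power_divide)
  finally show False using key[of "Suc n"] by simp
qed

section \<open>Positivity, uniqueness and total mass\<close>

lemma nonneg_of_pairings:
  assumes cont: "continuous_on UNIV h"
    and pair: "\<And>f. test_function f \<Longrightarrow> (\<And>x. 0 \<le> f x) \<Longrightarrow> 0 \<le> (LINT x|lborel. h x * f x)"
  shows "0 \<le> (h x :: real)"
proof (rule ccontr)
  assume "\<not> 0 \<le> h x"
  then have neg: "h x < h x / 2" "h x / 2 < 0" by auto
  have "isCont h x" using cont by (simp add: continuous_on_eq_continuous_at)
  then have "\<forall>\<^sub>F z in at x. h z < h x / 2"
    using neg(1) unfolding isCont_def by (rule order_tendstoD)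
  then obtain d where d: "d > 0" "\<And>z. z \<noteq> x \<Longrightarrow> dist z x < d \<Longrightarrow> h z < h x / 2"
    unfolding eventually_at by auto
  obtain f where f: "test_function f" "\<And>z. 0 \<le> f z" "\<And>z. z \<notin> {x - d<..<x + d} \<Longrightarrow> f z = 0"
    "0 < (LINT z|lborel. f z)"
    by (rule bump[OF d(1), of x]) blast
  have int: "integrable lborel f" by (rule test_function_integrable[OF f(1)])
  obtain R where R: "\<And>x. \<bar>x\<bar> > R \<Longrightarrow> f x = 0" using test_function_bounded_support[OF f(1)] by metis
  have int2: "integrable lborel (\<lambda>z. h z * f z)"
    by (rule integrable_compact_support[of _ R])
      (use R continuous_on_mult[OF cont smooth_continuous[OF test_function_smooth[OF f(1)]]] in auto)
  have "(LINT z|lborel. h z * f z) \<le> (LINT z|lborel. h x / 2 * f z)"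
  proof (rule integral_mono[OF int2])
    fix z
    show "h z * f z \<le> h x / 2 * f z"
    proof (cases "z \<in> {x - d<..<x + d}")
      case True
      then have "dist z x < d" unfolding dist_real_def abs_less_iff by auto
      then have "h z \<le> h x / 2" using d(2)[of z] neg by (cases "z = x") auto
      then show ?thesis using f(2) by (rule mult_right_mono)
    qed (simp add: f(3))
  qed (use int in auto)
  also have "\<dots> = h x / 2 * (LINT z|lborel. f z)" by simp
  also have "\<dots> < 0" using neg f(4) by (intro mult_neg_pos)
  finally show False using pair[OF f(1,2)] by simp
qed

context layered_medium
begin

definition homogeneous_patch :: "real set \<Rightarrow> bool" where
  "homogeneous_patch I \<longleftrightarrow> open I \<and> is_interval I \<and> I \<inter> B = {} \<and> (\<exists>a0. \<forall>x\<in>I. a x = a0)"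

text \<open>A point source at \<open>y\<close> inside the homogeneous patch \<open>I\<close>: outside \<open>I\<close> the initial value \<open>0\<close> is
  attained uniformly, inside only in the sense of distributions.\<close>

definition starts_from :: "real set \<Rightarrow> real \<Rightarrow> (real \<Rightarrow> real \<Rightarrow> real) \<Rightarrow> bool" where
  "starts_from I y u \<longleftrightarrow> homogeneous_patch I \<and> y \<in> I \<and>
     (\<forall>\<epsilon>>0. \<exists>\<delta>>0. \<forall>x t. x \<notin> I \<and> 0 < t \<and> t < \<delta> \<longrightarrow> \<bar>u x t\<bar> < \<epsilon>) \<and>
     (\<forall>\<phi>. test_function \<phi> \<longrightarrow> (pairing u \<phi> \<longlongrightarrow> \<phi> y) (at_right 0))"

text \<open>Compare \<open>\<psi>\<close> with the test function \<open>F * cutoff\<close>, where \<open>F\<close> is a smooth extension of \<open>\<psi>\<close> from \<open>I\<close>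
  and the cutoff is \<open>1\<close> on a large interval. Outside \<open>I\<close> the difference is paired with
  values of \<open>u\<close> that tend uniformly to \<open>0\<close>; inside \<open>I\<close> it lives far out, where \<open>u\<close> is small
  by the uniform decay at infinity.\<close>

lemma initial_pairing:
  assumes sol: "solution u J" and st: "starts_from I y u"
    and \<psi>: "continuous_on UNIV \<psi>" "integrable lborel \<psi>" "extends_smoothly I \<psi>"
  shows "(pairing u \<psi> \<longlongrightarrow> \<psi> y) (at_right 0)"
proof (rule tendstoI)
  fix e :: real assume "e > 0"
  define N where "N = (LINT x|lborel. \<bar>\<psi> x\<bar>) + 1"
  have N: "N > 0" by (simp add: N_def add_nonneg_pos)
  define e1 where "e1 = e / 3 / N"
  have e1: "e1 > 0" "e1 * (LINT x|lborel. \<bar>\<psi> x\<bar>) \<le> e / 3"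
  proof -
    show "e1 > 0" using \<open>e > 0\<close> N by (simp add: e1_def)
    then have "e1 * (LINT x|lborel. \<bar>\<psi> x\<bar>) \<le> e1 * N" by (simp add: N_def)
    also have "\<dots> = e / 3" using N by (simp add: e1_def)
    finally show "e1 * (LINT x|lborel. \<bar>\<psi> x\<bar>) \<le> e / 3" .
  qed
  obtain R where R: "R > 0" "\<And>x t. \<bar>x\<bar> \<ge> R \<Longrightarrow> 0 < t \<Longrightarrow> t \<le> 1 \<Longrightarrow> \<bar>u x t\<bar> < e1"
    using solution_decay[OF sol zero_less_one e1(1)] by metis
  define R' where "R' = max R \<bar>y\<bar>"
  obtain F where F: "smooth F" "\<And>x. x \<in> I \<Longrightarrow> \<psi> x = F x"
    using \<psi>(3) by (auto simp: extends_smoothly_def)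
  obtain cutoff where chi: "test_function cutoff" "\<And>x. 0 \<le> cutoff x" "\<And>x. cutoff x \<le> 1" "\<And>x. x \<in> {-R'..R'} \<Longrightarrow> cutoff x = 1"
    by (rule plateau[of "-R'" R' 1]) (use R in \<open>auto simp: R'_def\<close>)
  define \<phi> where "\<phi> = (\<lambda>x. F x * cutoff x)"
  have phi: "test_function \<phi>"
    unfolding \<phi>_def by (rule test_function_mult_smooth[OF chi(1) F(1)])
  have "y \<in> I" using st by (simp add: starts_from_def)
  have phi_y: "\<phi> y = \<psi> y"
  proof -
    have "\<bar>y\<bar> \<le> R'" by (simp add: R'_def)
    then have "cutoff y = 1" by (intro chi(4)) (simp add: abs_le_iff)
    then show ?thesis using F(2)[OF \<open>y \<in> I\<close>] by (simp add: \<phi>_def)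
  qed
  define D where "D = (\<lambda>x. \<psi> x - \<phi> x)"
  have D_int: "integrable lborel D"
    unfolding D_def using \<psi>(2) test_function_integrable[OF phi] by simp
  define K where "K = (LINT x|lborel. \<bar>D x\<bar>) + 1"
  have K: "K > 0" by (simp add: K_def add_nonneg_pos)
  define e2 where "e2 = e / 3 / K"
  have e2: "e2 > 0" "e2 * (LINT x|lborel. \<bar>D x\<bar>) < e / 3"
  proof -
    show "e2 > 0" using \<open>e > 0\<close> K by (simp add: e2_def)
    then have "e2 * (LINT x|lborel. \<bar>D x\<bar>) < e2 * K" by (simp add: K_def)
    also have "\<dots> = e / 3" using K by (simp add: e2_def)
    finally show "e2 * (LINT x|lborel. \<bar>D x\<bar>) < e / 3" .
  qed
  obtain \<delta> where \<delta>: "\<delta> > 0" "\<And>x t. x \<notin> I \<Longrightarrow> 0 < t \<Longrightarrow> t < \<delta> \<Longrightarrow> \<bar>u x t\<bar> < e2"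
    using st e2(1) unfolding starts_from_def by metis
  have close: "\<bar>pairing u \<psi> t - pairing u \<phi> t\<bar> < 2 * (e / 3)" if t: "0 < t" "t < \<delta>" "t < 1" for t
  proof -
    have "pairing u \<psi> t - pairing u \<phi> t = (LINT x|lborel. u x t * D x)"
      unfolding pairing_def D_def
      using pairing_integrable[OF sol t(1) \<psi>(2)] pairing_integrable[OF sol t(1) test_function_integrable[OF phi]]
      by (simp add: right_diff_distrib)
    also have "\<bar>\<dots>\<bar> \<le> (LINT x|lborel. \<bar>u x t * D x\<bar>)"
      by (rule integral_abs_bound)
    also have "\<dots> \<le> (LINT x|lborel. e2 * \<bar>D x\<bar> + e1 * \<bar>\<psi> x\<bar>)"
    proof (rule integral_mono)
      show "integrable lborel (\<lambda>x. \<bar>u x t * D x\<bar>)"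
        by (intro integrable_abs pairing_integrable[OF sol t(1)] D_int)
      show "integrable lborel (\<lambda>x. e2 * \<bar>D x\<bar> + e1 * \<bar>\<psi> x\<bar>)" using D_int \<psi>(2) by auto
      fix x
      show "\<bar>u x t * D x\<bar> \<le> e2 * \<bar>D x\<bar> + e1 * \<bar>\<psi> x\<bar>"
      proof (cases "x \<in> I")
        case False
        then have "\<bar>u x t\<bar> \<le> e2" using \<delta>(2)[of x t] t by auto
        then have "\<bar>u x t * D x\<bar> \<le> e2 * \<bar>D x\<bar>" by (simp add: abs_mult mult_right_mono)
        then show ?thesis using e1(1) by (simp add: add_increasing2)
      next
        case True
        then have Dx: "D x = \<psi> x * (1 - cutoff x)" using F(2) by (simp add: D_def \<phi>_def algebra_simps)
        show ?thesis
        proof (cases "\<bar>x\<bar> \<le> R'")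
          case True
          then show ?thesis using Dx chi(4)[of x] e1 e2 by (auto simp: abs_le_iff)
        next
          case False
          then have "R \<le> \<bar>x\<bar>" by (simp add: R'_def)
          then have "\<bar>u x t\<bar> \<le> e1" using R(2)[of x t] t by simp
          moreover have "\<bar>D x\<bar> \<le> \<bar>\<psi> x\<bar>"
            using Dx chi(2,3)[of x] by (simp add: abs_mult mult_left_le)
          ultimately have "\<bar>u x t * D x\<bar> \<le> e1 * \<bar>\<psi> x\<bar>"
            using e1(1) by (simp add: abs_mult mult_mono)
          then show ?thesis using e2(1) by (simp add: add_increasing)
        qed
      qed
    qed
    also have "\<dots> = e2 * (LINT x|lborel. \<bar>D x\<bar>) + e1 * (LINT x|lborel. \<bar>\<psi> x\<bar>)"
      using D_int \<psi>(2) by simp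
    also have "\<dots> < 2 * (e / 3)" using e1 e2 by linarith
    finally show ?thesis .
  qed
  have "(pairing u \<phi> \<longlongrightarrow> \<phi> y) (at_right 0)"
    using st phi by (simp add: starts_from_def)
  then have ev1: "\<forall>\<^sub>F t in at_right 0. dist (pairing u \<phi> t) (\<phi> y) < e / 3"
    using \<open>e > 0\<close> by (intro tendstoD) auto
  have ev2: "\<forall>\<^sub>F t in at_right 0. 0 < t \<and> t < \<delta> \<and> t < (1::real)"
    using \<delta>(1) unfolding eventually_at_right_field by (intro exI[of _ "min \<delta> 1"]) auto
  show "\<forall>\<^sub>F t in at_right 0. dist (pairing u \<psi> t) (\<psi> y) < e"
    using ev1 ev2
  proof eventually_elim
    case (elim t)
    then show ?case using close[of t] phi_y unfolding dist_real_def by linarith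
  qed
qed

definition admissible :: "real set \<Rightarrow> (real \<Rightarrow> real) \<Rightarrow> bool" where
  "admissible I f \<longleftrightarrow> continuous_on UNIV f \<and> (\<forall>x. 0 \<le> f x) \<and> integrable lborel f \<and> extends_smoothly I f"

definition resolvent :: "real \<Rightarrow> (real \<Rightarrow> real) \<Rightarrow> real \<Rightarrow> real" where
  "resolvent lam f = (SOME \<psi>. \<exists>m. resolves lam f \<psi> m)"

lemma test_function_admissible:
  "test_function f \<Longrightarrow> (\<And>x. 0 \<le> f x) \<Longrightarrow> admissible I f"
  unfolding admissible_def extends_smoothly_def
  using test_function_integrable test_function_smooth smooth_continuous by blast

lemma resolvent_resolves:
  assumes "lam > 0" "admissible I f"
  obtains m where "resolves lam f (resolvent lam f) m"
proof -
  have "\<exists>\<psi> m. resolves lam f \<psi> m"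
    using assms by (intro resolvent_exists) (auto simp: admissible_def)
  then have "\<exists>m. resolves lam f (resolvent lam f) m"
    unfolding resolvent_def by (rule someI_ex)
  then show ?thesis using that by blast
qed

lemma resolvent_admissible:
  assumes "lam > 0" "homogeneous_patch I" "admissible I f"
  shows "admissible I (resolvent lam f)"
proof -
  obtain m where m: "resolves lam f (resolvent lam f) m" by (rule resolvent_resolves[OF assms(1,3)]) blast
  obtain a0 where "open I" "is_interval I" "I \<inter> B = {}" "\<And>x. x \<in> I \<Longrightarrow> a x = a0"
    using assms(2) by (auto simp: homogeneous_patch_def)
  then have "extends_smoothly I (resolvent lam f)"
    using resolves_extends_smoothly[OF m assms(1)] assms(3) by (auto simp: admissible_def)
  then show ?thesis
    using m by (auto simp: admissible_def resolves_def)
qed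

lemma pairing_resolvent_deriv:
  assumes sol: "solution u J" and "0 < t" "lam > 0" "admissible I f"
  shows "(pairing u (resolvent lam f) has_real_derivative lam * pairing u (resolvent lam f) t - pairing u f t) (at t)"
proof -
  obtain m where m: "resolves lam f (resolvent lam f) m" by (rule resolvent_resolves[OF assms(3,4)]) blast
  define \<psi> where "\<psi> = resolvent lam f"
  obtain C where C: "\<And>x. \<bar>\<psi> x\<bar> \<le> C" "\<And>x. \<bar>m x\<bar> \<le> C"
    using m unfolding resolves_def \<psi>_def by blast
  have f: "continuous_on UNIV f" "integrable lborel f" using assms(4) by (auto simp: admissible_def)
  have \<psi>: "continuous_on UNIV \<psi>" "continuous_on UNIV m" "integrable lborel \<psi>"
    "\<And>x. x \<notin> B \<Longrightarrow> (\<psi> has_real_derivative m x / a x) (at x)"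
    "\<And>x. x \<notin> B \<Longrightarrow> (m has_real_derivative lam * \<psi> x - f x) (at x)"
    using m by (auto simp: resolves_def \<psi>_def)
  have "(pairing u \<psi> has_real_derivative pairing u (\<lambda>x. lam * \<psi> x - f x) t) (at t)"
    by (rule pairing_deriv[OF sol assms(2) \<psi>(1,2) _ \<psi>(4,5) C \<psi>(3)])
      (use \<psi> f in \<open>auto intro!: continuous_intros\<close>)
  moreover have "pairing u (\<lambda>x. lam * \<psi> x - f x) t = lam * pairing u \<psi> t - pairing u f t"
  proof -
    have "pairing u (\<lambda>x. lam * \<psi> x - f x) t = (LINT x|lborel. lam * (u x t * \<psi> x) - u x t * f x)"
      unfolding pairing_def by (intro Bochner_Integration.integral_cong) (auto simp: algebra_simps)
    also have "\<dots> = lam * pairing u \<psi> t - pairing u f t"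
      unfolding pairing_def
      by (subst Bochner_Integration.integral_diff)
        (auto intro!: integrable_mult_right pairing_integrable[OF sol assms(2)] \<psi> f)
    finally show ?thesis .
  qed
  ultimately show ?thesis by (simp add: \<psi>_def)
qed

text \<open>The coefficients \<open>(1, 0)\<close> give positivity of one solution, \<open>(1, -1)\<close> and \<open>(-1, 1)\<close> give equality
  of two. The initial values of the iterated pairings are \<open>k1 + k2\<close> times values of iterated
  resolvents at the common source, hence nonnegative in all three cases.\<close>

lemma pairing_combination_nonneg:
  assumes sol: "solution u J" "solution w L" and st: "starts_from I y u" "starts_from I y w"
    and f: "test_function f" "\<And>x. 0 \<le> f x"
    and "0 \<le> k1 + k2" "0 < t"
  shows "0 \<le> k1 * pairing u f t + k2 * pairing w f t"
proof -
  define chain where "chain = (\<lambda>lam n. (resolvent lam ^^ n) f)"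
  have patch: "homogeneous_patch I" "y \<in> I" using st by (auto simp: starts_from_def)
  have adm: "admissible I (chain lam n)" if "lam > 0" for lam n
    by (induction n) (auto simp: chain_def test_function_admissible[OF f] resolvent_admissible[OF that patch(1)])
  have chain_Suc: "chain lam (Suc n) = resolvent lam (chain lam n)" for lam n by (simp add: chain_def)
  have mass: "lam ^ n * (LINT x|lborel. chain lam n x) \<le> (LINT x|lborel. f x)" if lam: "lam > 0" for lam n
  proof (induction n)
    case 0
    then show ?case by (simp add: chain_def)
  next
    case (Suc n)
    obtain m where "resolves lam (chain lam n) (chain lam (Suc n)) m"
      unfolding chain_Suc by (rule resolvent_resolves[OF lam adm[OF lam]]) blast
    then have "lam * (LINT x|lborel. chain lam (Suc n) x) \<le> (LINT x|lborel. chain lam n x)"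
      by (simp add: resolves_def)
    then have "lam ^ n * (lam * (LINT x|lborel. chain lam (Suc n) x)) \<le> lam ^ n * (LINT x|lborel. chain lam n x)"
      using lam by (intro mult_left_mono) auto
    then show ?case using Suc by (simp add: mult.assoc mult.commute[of lam])
  qed
  define T where "T = t + 1"
  have T: "0 < T" using \<open>0 < t\<close> by (simp add: T_def)
  have bd: "\<exists>M\<ge>0. \<forall>lam n. lam > 0 \<longrightarrow> \<bar>pairing v (chain lam n) T\<bar> \<le> M / lam ^ n"
    if v: "solution v K" for v K
  proof -
    obtain M where M: "M > 0" "\<And>x. \<bar>v x T\<bar> \<le> M"
      by (rule solution_bounded[OF v T, of T]) (metis atLeastAtMost_iff order_refl)
    have "\<bar>pairing v (chain lam n) T\<bar> \<le> (M * (LINT x|lborel. f x)) / lam ^ n" if lam: "lam > 0" for lam n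
    proof -
      have c: "integrable lborel (chain lam n)" "\<And>x. 0 \<le> chain lam n x"
        using adm[OF lam] by (auto simp: admissible_def)
      have "\<bar>pairing v (chain lam n) T\<bar> \<le> (LINT x|lborel. \<bar>v x T * chain lam n x\<bar>)"
        unfolding pairing_def by (rule integral_abs_bound)
      also have "\<dots> \<le> (LINT x|lborel. M * chain lam n x)"
        using M(2) c pairing_integrable[OF v T c(1)]
        by (intro integral_mono integrable_abs) (auto simp: abs_mult intro!: mult_right_mono)
      also have "\<dots> = M * (LINT x|lborel. chain lam n x)" by simp
      also have "\<dots> \<le> M * ((LINT x|lborel. f x) / lam ^ n)"
        using mass[OF lam, of n] lam M by (intro mult_left_mono) (auto simp: le_divide_eq mult.commute)
      finally show ?thesis by simp
    qed
    moreover have "0 \<le> M * (LINT x|lborel. f x)"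
      using M f by (intro mult_nonneg_nonneg integral_nonneg_AE) auto
    ultimately show ?thesis by blast
  qed
  obtain M1 where M1: "M1 \<ge> 0" "\<And>lam n. lam > 0 \<Longrightarrow> \<bar>pairing u (chain lam n) T\<bar> \<le> M1 / lam ^ n"
    using bd[OF sol(1)] by blast
  obtain M2 where M2: "M2 \<ge> 0" "\<And>lam n. lam > 0 \<Longrightarrow> \<bar>pairing w (chain lam n) T\<bar> \<le> M2 / lam ^ n"
    using bd[OF sol(2)] by blast
  have "0 \<le> k1 * pairing u f t + k2 * pairing w f t"
  proof (rule post_widder_nonneg[where ?t0.0 = t and g = "\<lambda>t. k1 * pairing u f t + k2 * pairing w f t" and T = T and G = "\<lambda>lam n t. k1 * pairing u (chain lam n) t + k2 * pairing w (chain lam n) t"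
        and c = "\<lambda>lam n. (k1 + k2) * chain lam n y" and C = "\<bar>k1\<bar> * M1 + \<bar>k2\<bar> * M2"])
    show "0 < t" "t < T" using \<open>0 < t\<close> by (auto simp: T_def)
    show "(\<lambda>t. k1 * pairing u (chain lam 0) t + k2 * pairing w (chain lam 0) t) =
        (\<lambda>t. k1 * pairing u f t + k2 * pairing w f t)" for lam
      by (simp add: chain_def)
    show "((\<lambda>t. k1 * pairing u (chain lam (Suc n)) t + k2 * pairing w (chain lam (Suc n)) t) has_real_derivative
        lam * (k1 * pairing u (chain lam (Suc n)) t + k2 * pairing w (chain lam (Suc n)) t) -
        (k1 * pairing u (chain lam n) t + k2 * pairing w (chain lam n) t)) (at t)"
      if "0 < lam" "0 < t" for lam n t
    proof -
      have "((\<lambda>t. k1 * pairing u (chain lam (Suc n)) t + k2 * pairing w (chain lam (Suc n)) t) has_real_derivative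
        k1 * (lam * pairing u (chain lam (Suc n)) t - pairing u (chain lam n) t) +
        k2 * (lam * pairing w (chain lam (Suc n)) t - pairing w (chain lam n) t)) (at t)"
        unfolding chain_Suc
        by (intro DERIV_add DERIV_cmult pairing_resolvent_deriv[OF sol(1) that(2,1) adm[OF that(1)]]
            pairing_resolvent_deriv[OF sol(2) that(2,1) adm[OF that(1)]])
      then show ?thesis by (rule DERIV_cong) (simp add: algebra_simps)
    qed
    show "continuous_on {0<..} (\<lambda>t. k1 * pairing u f t + k2 * pairing w f t)"
    proof -
      have "continuous_on {0<..} (pairing v f)" if v: "solution v K" for v K
      proof -
        have "isCont (pairing v f) s" if "0 < s" for s
        proof -
          have "s \<in> interior {s/2..2 * s}" using that by auto
          then show ?thesis
            using continuous_on_interior[OF pairing_cont[OF v test_function_integrable[OF f(1)], of "s/2" "2 * s"]] that by auto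
        qed
        then show ?thesis by (intro continuous_at_imp_continuous_on) auto
      qed
      then show ?thesis using sol by (intro continuous_intros) auto
    qed
    show "((\<lambda>t. k1 * pairing u (chain lam n) t + k2 * pairing w (chain lam n) t) \<longlongrightarrow> (k1 + k2) * chain lam n y) (at_right 0)"
      if "0 < lam" for lam n
    proof -
      have "((\<lambda>t. k1 * pairing u (chain lam n) t + k2 * pairing w (chain lam n) t) \<longlongrightarrow> k1 * chain lam n y + k2 * chain lam n y) (at_right 0)"
        using adm[OF that, of n] unfolding admissible_def
        by (intro tendsto_intros initial_pairing[OF sol(1) st(1)] initial_pairing[OF sol(2) st(2)]) auto
      then show ?thesis by (simp add: algebra_simps)
    qed
    show "0 \<le> (k1 + k2) * chain lam n y" if "0 < lam" for lam n
      using adm[OF that, of n] assms(7) by (auto simp: admissible_def)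
    show "\<bar>k1 * pairing u (chain lam n) T + k2 * pairing w (chain lam n) T\<bar> \<le> (\<bar>k1\<bar> * M1 + \<bar>k2\<bar> * M2) / lam ^ n"
      if "0 < lam" for lam n
    proof -
      have "\<bar>k1 * pairing u (chain lam n) T + k2 * pairing w (chain lam n) T\<bar> \<le>
          \<bar>k1\<bar> * \<bar>pairing u (chain lam n) T\<bar> + \<bar>k2\<bar> * \<bar>pairing w (chain lam n) T\<bar>"
        by (metis abs_mult abs_triangle_ineq)
      also have "\<dots> \<le> \<bar>k1\<bar> * (M1 / lam ^ n) + \<bar>k2\<bar> * (M2 / lam ^ n)"
        using M1(2)[OF that] M2(2)[OF that] by (intro add_mono mult_left_mono) auto
      finally show ?thesis by (simp add: add_divide_distrib)
    qed
  qed
  then show ?thesis by simp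
qed

lemma combination_nonneg:
  assumes sol: "solution u J" "solution w L" and st: "starts_from I y u" "starts_from I y w"
    and "0 \<le> k1 + k2" "0 < t"
  shows "0 \<le> k1 * u x t + k2 * w x t"
proof (rule nonneg_of_pairings[where h = "\<lambda>x. k1 * u x t + k2 * w x t"])
  show "continuous_on UNIV (\<lambda>x. k1 * u x t + k2 * w x t)"
    by (intro continuous_intros solution_cont_x(1)[OF sol(1) \<open>0 < t\<close>] solution_cont_x(1)[OF sol(2) \<open>0 < t\<close>])
  fix f :: "real \<Rightarrow> real" assume f: "test_function f" "\<And>x. 0 \<le> f x"
  have "(LINT x|lborel. (k1 * u x t + k2 * w x t) * f x) = (LINT x|lborel. k1 * (u x t * f x) + k2 * (w x t * f x))"
    by (intro Bochner_Integration.integral_cong) (auto simp: algebra_simps)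
  also have "\<dots> = k1 * pairing u f t + k2 * pairing w f t"
    unfolding pairing_def
    using pairing_integrable[OF sol(1) \<open>0 < t\<close> test_function_integrable[OF f(1)]]
      pairing_integrable[OF sol(2) \<open>0 < t\<close> test_function_integrable[OF f(1)]] by simp
  finally show "0 \<le> (LINT x|lborel. (k1 * u x t + k2 * w x t) * f x)"
    using pairing_combination_nonneg[OF sol st f assms(5,6)] by simp
qed

theorem solution_nonneg:
  assumes "solution u J" "starts_from I y u" "0 < t"
  shows "0 \<le> u x t"
  using combination_nonneg[OF assms(1,1,2,2), of 1 0 t x] assms(3) by simp

theorem solution_unique:
  assumes "solution u J" "solution w L" "starts_from I y u" "starts_from I y w" "0 < t"
  shows "u x t = w x t"
  using combination_nonneg[OF assms(1-4), of 1 "-1" t x] combination_nonneg[OF assms(1-4), of "-1" 1 t x] assms(5) by simp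

text \<open>The mass in \<open>{- n..n}\<close> changes by the flux through the two end points, which is uniformly small
  down to time \<open>0\<close> for large \<open>n\<close>. Its limit at time \<open>0\<close> is \<open>1\<close>: since \<open>u\<close> is nonnegative, the mass
  lies between the pairings with two test functions that are \<open>1\<close> at the source, one supported in the
  interval and one equal to \<open>1\<close> on it.\<close>

theorem solution_mass:
  assumes sol: "solution u J" and st: "starts_from I y u" and t: "0 < t"
  shows "has_bochner_integral lborel (\<lambda>x. u x t) 1"
proof -
  define mass where "mass = (\<lambda>n t. integral {- real n..real n} (\<lambda>x. u x t))"
  have u_int: "(\<lambda>x. u x s) integrable_on {p..q}" if "0 < s" for s p q
    using solution_cont_x(1)[OF sol that] by (auto intro!: integrable_continuous_real intro: continuous_on_subset)
  have nn: "0 \<le> u x s" if "0 < s" for x s by (rule solution_nonneg[OF sol st that])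
  define f where "f = (\<lambda>s n x. indicator {- real n..real n} x * u x s)"
  have window: "(LINT x|lborel. f s n x) = mass n s" "integrable lborel (f s n)" if "0 < s" for s n
  proof -
    have "set_integrable lborel {- real n..real n} (\<lambda>x. u x s)"
      by (rule borel_integrable_atLeastAtMost') (use solution_cont_x(1)[OF sol that] in \<open>auto intro: continuous_on_subset\<close>)
    then show "(LINT x|lborel. f s n x) = mass n s" "integrable lborel (f s n)"
      using set_borel_integral_eq_integral(2)[of "{- real n..real n}" "\<lambda>x. u x s"]
      by (simp_all add: f_def mass_def set_lebesgue_integral_def set_integrable_def)
  qed
  have limit0: "(mass n \<longlongrightarrow> 1) (at_right 0)" if n: "\<bar>y\<bar> < real n" for n
  proof -
    obtain \<phi>1 where p1: "test_function \<phi>1" "\<And>x. 0 \<le> \<phi>1 x" "\<And>x. \<phi>1 x \<le> 1" "\<And>x. x \<in> {y..y} \<Longrightarrow> \<phi>1 x = 1"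
      "\<And>x. x \<notin> {y - (real n - \<bar>y\<bar>)<..<y + (real n - \<bar>y\<bar>)} \<Longrightarrow> \<phi>1 x = 0"
      by (rule plateau[of y y "real n - \<bar>y\<bar>"]) (use n in auto)
    obtain \<phi>2 where p2: "test_function \<phi>2" "\<And>x. 0 \<le> \<phi>2 x" "\<And>x. \<phi>2 x \<le> 1" "\<And>x. x \<in> {- real n..real n} \<Longrightarrow> \<phi>2 x = 1"
      by (rule plateau[of "- real n" "real n" 1]) auto
    have l1: "(pairing u \<phi>1 \<longlongrightarrow> 1) (at_right 0)"
      using st p1(1,4) unfolding starts_from_def by (metis atLeastAtMost_iff order_refl)
    have l2: "(pairing u \<phi>2 \<longlongrightarrow> 1) (at_right 0)"
      using st p2(1) p2(4)[of y] n unfolding starts_from_def by (metis abs_le_iff atLeastAtMost_iff less_imp_le minus_le_iff)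
    have le: "pairing u \<phi>1 s \<le> mass n s \<and> mass n s \<le> pairing u \<phi>2 s" if s: "0 < s" for s
      unfolding window(1)[OF s, symmetric] pairing_def
    proof (intro conjI integral_mono window(2) s pairing_integrable[OF sol s] test_function_integrable p1 p2)
      fix x
      show "u x s * \<phi>1 x \<le> f s n x"
      proof (cases "x \<in> {- real n..real n}")
        case True
        then show ?thesis using nn[OF s, of x] p1(3)[of x] by (simp add: f_def mult_left_le)
      next
        case False
        then have "\<phi>1 x = 0" by (intro p1(5)) auto
        then show ?thesis using False by (simp add: f_def)
      qed
      show "f s n x \<le> u x s * \<phi>2 x"
        using nn[OF s, of x] p2(2)[of x] p2(4)[of x] by (auto simp: f_def indicator_def)
    qed
    have "\<forall>\<^sub>F s in at_right 0. (0::real) < s" by (rule eventually_at_right_less)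
    then have "\<forall>\<^sub>F s in at_right 0. pairing u \<phi>1 s \<le> mass n s" "\<forall>\<^sub>F s in at_right 0. mass n s \<le> pairing u \<phi>2 s"
      by (eventually_elim, use le in blast)+
    then show ?thesis
      using tendsto_sandwich[OF _ _ l1 l2] by blast
  qed
  have diff: "mass n t - mass n s = integral {s..t} (\<lambda>r. J (real n) r) - integral {s..t} (\<lambda>r. J (- real n) r)"
    if s: "0 < s" "s \<le> t" for n s
  proof -
    have "((\<lambda>x. u x t * 1 - u x s * 1 - integral {s..t} (\<lambda>r. u x r * 0)) has_integral
      (integral {s..t} (\<lambda>r. J (real n) r * 1 - u (real n) r * 0) -
       integral {s..t} (\<lambda>r. J (- real n) r * 1 - u (- real n) r * 0))) {- real n..real n}"
      by (rule green[OF sol s, where E = "\<lambda>_ _. 0"]) (auto intro!: continuous_intros)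
    from integral_unique[OF this] show ?thesis
      using Henstock_Kurzweil_Integration.integral_diff[OF u_int[OF t] u_int[OF s(1)]]
      by (simp add: mass_def)
  qed
  have conv: "(\<lambda>n. mass n t) \<longlonglongrightarrow> 1"
  proof (rule tendstoI)
    fix e :: real assume "e > 0"
    define \<epsilon> where "\<epsilon> = e / (4 * t)"
    have eps: "\<epsilon> > 0" using \<open>e > 0\<close> t by (simp add: \<epsilon>_def)
    obtain R where R: "R > 0" "\<And>x r. \<bar>x\<bar> \<ge> R \<Longrightarrow> 0 < r \<Longrightarrow> r \<le> t \<Longrightarrow> \<bar>J x r\<bar> < \<epsilon>"
      using solution_decay[OF sol t eps] by metis
    obtain N where N: "max R (\<bar>y\<bar> + 1) \<le> real N" using real_arch_simple by blast
    have "dist (mass n t) 1 < e" if n: "n \<ge> N" for n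
    proof -
      have nR: "R \<le> real n" "\<bar>y\<bar> < real n" using N n by auto
      have flux: "\<bar>integral {s..t} (\<lambda>r. J x r)\<bar> \<le> \<epsilon> * t" if s: "0 < s" "s \<le> t" and x: "R \<le> \<bar>x\<bar>" for s x
      proof -
        have "continuous_on {s..t} (\<lambda>r. J x r)" using solution_cont_t(2)[OF sol s(1)] .
        then have "norm (integral {s..t} (\<lambda>r. J x r)) \<le> \<epsilon> * (t - s)"
          using R(2)[OF x] s by (intro integral_bound) (auto simp: less_imp_le)
        also have "\<dots> \<le> \<epsilon> * t" using eps s by (intro mult_left_mono) auto
        finally show ?thesis by simp
      qed
      have "\<forall>\<^sub>F s in at_right 0. \<bar>mass n t - mass n s\<bar> \<le> 2 * (\<epsilon> * t)"
        unfolding eventually_at_right_field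
      proof (intro exI[of _ t] conjI allI impI t)
        fix s assume s: "0 < s" "s < t"
        then show "\<bar>mass n t - mass n s\<bar> \<le> 2 * (\<epsilon> * t)"
          using diff[of s n] flux[of s "real n"] flux[of s "- real n"] nR by auto
      qed
      moreover have "((\<lambda>s. \<bar>mass n t - mass n s\<bar>) \<longlongrightarrow> \<bar>mass n t - 1\<bar>) (at_right 0)"
        by (intro tendsto_intros limit0 nR)
      ultimately have "\<bar>mass n t - 1\<bar> \<le> 2 * (\<epsilon> * t)"
        by (metis tendsto_upperbound trivial_limit_at_right_real)
      also have "\<dots> < e" using t \<open>e > 0\<close> by (simp add: \<epsilon>_def)
      finally show ?thesis by (simp add: dist_real_def)
    qed
    then show "\<forall>\<^sub>F n in sequentially. dist (mass n t) 1 < e"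
      by (rule eventually_sequentiallyI)
  qed
  obtain C where C: "\<And>n. mass n t \<le> C"
    using convergent_imp_Bseq[OF convergentI[OF conv]] by (auto simp: Bseq_def abs_le_iff)
  have "integrable lborel (\<lambda>x. u x t)"
  proof (rule nonneg_integrable_windows(1)[OF _ nn[OF t]])
    show "(\<lambda>x. u x t) \<in> borel_measurable lborel"
      using borel_measurable_continuous_onI[OF solution_cont_x(1)[OF sol t]] by simp
    show "\<exists>I. ((\<lambda>x. u x t) has_integral I) {- real n..real n} \<and> I \<le> C" for n
      using integrable_integral[OF u_int[OF t]] C[of n] by (auto simp: mass_def)
  qed
  then show ?thesis
    using LIMSEQ_unique[OF conv] integral_symmetric_tendsto by (simp add: has_bochner_integral_iff mass_def)
qed

end

section \<open>Duality, symmetry and the semigroup property\<close>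

context layered_medium
begin

definition kernel_from :: "real \<Rightarrow> (real \<Rightarrow> real \<Rightarrow> real) \<Rightarrow> bool" where
  "kernel_from y u \<longleftrightarrow> (\<exists>I J. solution u J \<and> starts_from I y u)"

lemma kernel_nonneg: "kernel_from y u \<Longrightarrow> 0 < t \<Longrightarrow> 0 \<le> u x t"
  by (auto simp: kernel_from_def intro: solution_nonneg)

lemma kernel_mass: "kernel_from y u \<Longrightarrow> 0 < t \<Longrightarrow> has_bochner_integral lborel (\<lambda>x. u x t) 1"
  by (auto simp: kernel_from_def intro: solution_mass)

lemma kernel_integrable:
  assumes "kernel_from y u" "0 < t"
  shows "integrable lborel (\<lambda>x. u x t)" "(LINT x|lborel. u x t) = 1"
  using kernel_mass[OF assms] by (auto simp: has_bochner_integral_iff)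

lemma kernel_product_integrable:
  assumes "kernel_from y u" "kernel_from y' w" "0 < s" "0 < t"
  shows "integrable lborel (\<lambda>x. u x s * w x t)"
proof -
  obtain I J where "solution u J" using assms(1) by (auto simp: kernel_from_def)
  from pairing_integrable[OF this assms(3) kernel_integrable(1)[OF assms(2,4)]] show ?thesis .
qed

text \<open>As a nonnegative density of mass \<open>1\<close> that converges to the Dirac measure at \<open>y\<close>, \<open>w\<close> loses all mass
  away from \<open>y\<close>, so it converges to this measure also when tested with bounded continuous
  functions.\<close>

lemma kernel_tendsto_start:
  assumes w: "kernel_from y w" and u: "solution u J" and t: "0 < t"
  shows "((\<lambda>\<tau>. LINT z|lborel. w z \<tau> * u z (t - \<tau>)) \<longlongrightarrow> u y t) (at_right 0)"
proof (rule tendstoI)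
  fix e :: real assume "e > 0"
  obtain I K where wI: "solution w K" "starts_from I y w" using w by (auto simp: kernel_from_def)
  obtain M where M: "M > 0" "\<And>x r. r \<in> {t/2..t} \<Longrightarrow> \<bar>u x r\<bar> \<le> M"
    by (rule solution_bounded[OF u, of "t/2" t]) (use t in auto)
  have "isCont (\<lambda>(x, t). u x t) (y, t)"
  proof -
    have "continuous_on (UNIV \<times> {0<..}) (\<lambda>(x, t). u x t)"
      using solution_cont(1)[OF u order_refl] .
    moreover have "open (UNIV \<times> {0::real<..})" by (intro open_Times) auto
    ultimately show ?thesis using t continuous_on_eq_continuous_at by fastforce
  qed
  then have "\<exists>d>0. \<forall>p. dist p (y, t) < d \<longrightarrow> dist ((\<lambda>(x, t). u x t) p) ((\<lambda>(x, t). u x t) (y, t)) < e / 3"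
    using \<open>e > 0\<close> unfolding continuous_at_eps_delta by (meson divide_pos_pos zero_less_numeral)
  then obtain d where d: "d > 0" "\<And>p. dist p (y, t) < d \<Longrightarrow> dist ((\<lambda>(x, t). u x t) p) (u y t) < e / 3"
    by auto
  have near: "\<bar>u z r - u y t\<bar> < e / 3" if "\<bar>z - y\<bar> < d / 2" "\<bar>r - t\<bar> < d / 2" for z r
  proof -
    have "dist (z, r) (y, t) \<le> dist z y + dist r t"
      unfolding dist_Pair_Pair by (rule sqrt_sum_squares_le_sum) auto
    also have "\<dots> < d" using that by (simp add: dist_real_def)
    finally show ?thesis using d(2)[of "(z, r)"] by (simp add: dist_real_def)
  qed
  obtain \<phi> where phi: "test_function \<phi>" "\<And>x. 0 \<le> \<phi> x" "\<And>x. \<phi> x \<le> 1" "\<And>x. x \<in> {y..y} \<Longrightarrow> \<phi> x = 1"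
      "\<And>x. x \<notin> {y - d/2<..<y + d/2} \<Longrightarrow> \<phi> x = 0"
    by (rule plateau[of y y "d/2"]) (use d in auto)
  have "(pairing w \<phi> \<longlongrightarrow> 1) (at_right 0)"
    using wI(2) phi(1,4) unfolding starts_from_def by (metis atLeastAtMost_iff order_refl)
  then have ev1: "\<forall>\<^sub>F \<tau> in at_right 0. dist (pairing w \<phi> \<tau>) 1 < e / (6 * M)"
    using \<open>e > 0\<close> M by (intro tendstoD) auto
  have ev2: "\<forall>\<^sub>F \<tau> in at_right 0. 0 < \<tau> \<and> \<tau> < t / 2 \<and> \<tau> < d / 2"
    using t d(1) unfolding eventually_at_right_field by (intro exI[of _ "min (t/2) (d/2)"]) auto
  show "\<forall>\<^sub>F \<tau> in at_right 0. dist (LINT z|lborel. w z \<tau> * u z (t - \<tau>)) (u y t) < e"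
    using ev1 ev2
  proof eventually_elim
    case (elim \<tau>)
    then have tau: "0 < \<tau>" "\<tau> < t / 2" "\<tau> < d / 2" by auto
    note wi = kernel_integrable[OF w tau(1)]
    have wphi: "integrable lborel (\<lambda>z. w z \<tau> * \<phi> z)"
      by (rule pairing_integrable[OF wI(1) tau(1) test_function_integrable[OF phi(1)]])
    have wu: "integrable lborel (\<lambda>z. w z \<tau> * u z (t - \<tau>))"
    proof (rule Bochner_Integration.integrable_bound[where f = "\<lambda>z. M * w z \<tau>"])
      show "(\<lambda>z. w z \<tau> * u z (t - \<tau>)) \<in> borel_measurable lborel"
        using wi borel_measurable_continuous_onI[OF solution_cont_x(1)[OF u, of "t - \<tau>"]] tau
        by (intro borel_measurable_times) auto
      show "AE z in lborel. norm (w z \<tau> * u z (t - \<tau>)) \<le> norm (M * w z \<tau>)"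
      proof (rule AE_I2)
        fix z
        have "\<bar>u z (t - \<tau>)\<bar> \<le> M" using tau by (intro M(2)) auto
        then show "norm (w z \<tau> * u z (t - \<tau>)) \<le> norm (M * w z \<tau>)"
          using mult_right_mono[of "\<bar>u z (t - \<tau>)\<bar>" M "\<bar>w z \<tau>\<bar>"] M(1) by (simp add: abs_mult mult.commute)
      qed
    qed (use wi in auto)
    have "(LINT z|lborel. w z \<tau> * u z (t - \<tau>)) - u y t = (LINT z|lborel. w z \<tau> * u z (t - \<tau>) - u y t * w z \<tau>)"
      using wu wi by simp
    also have "\<bar>\<dots>\<bar> \<le> (LINT z|lborel. \<bar>w z \<tau> * u z (t - \<tau>) - u y t * w z \<tau>\<bar>)"
      by (rule integral_abs_bound)
    also have "\<dots> \<le> (LINT z|lborel. e / 3 * w z \<tau> + 2 * M * (w z \<tau> - w z \<tau> * \<phi> z))"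
    proof (rule integral_mono)
      show "integrable lborel (\<lambda>z. \<bar>w z \<tau> * u z (t - \<tau>) - u y t * w z \<tau>\<bar>)"
        using wu wi by auto
      show "integrable lborel (\<lambda>z. e / 3 * w z \<tau> + 2 * M * (w z \<tau> - w z \<tau> * \<phi> z))"
        using wi wphi by auto
      fix z
      have wz: "0 \<le> w z \<tau>" by (rule kernel_nonneg[OF w tau(1)])
      have eq: "\<bar>w z \<tau> * u z (t - \<tau>) - u y t * w z \<tau>\<bar> = w z \<tau> * \<bar>u z (t - \<tau>) - u y t\<bar>"
        using wz by (metis abs_mult abs_of_nonneg mult.commute right_diff_distrib)
      have rest: "0 \<le> 2 * M * (w z \<tau> - w z \<tau> * \<phi> z)"
        using M(1) wz phi(2,3)[of z] by (simp add: mult_left_le)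
      show "\<bar>w z \<tau> * u z (t - \<tau>) - u y t * w z \<tau>\<bar> \<le> e / 3 * w z \<tau> + 2 * M * (w z \<tau> - w z \<tau> * \<phi> z)"
      proof (cases "\<bar>z - y\<bar> < d / 2")
        case True
        then have "\<bar>u z (t - \<tau>) - u y t\<bar> \<le> e / 3" using near[of z "t - \<tau>"] tau by simp
        then have "w z \<tau> * \<bar>u z (t - \<tau>) - u y t\<bar> \<le> e / 3 * w z \<tau>"
          using wz mult_left_mono by (metis mult.commute)
        then show ?thesis using eq rest by linarith
      next
        case False
        have "z \<notin> {y - d/2<..<y + d/2}"
        proof
          assume "z \<in> {y - d/2<..<y + d/2}"
          then have "\<bar>z - y\<bar> < d / 2" unfolding greaterThanLessThan_iff abs_less_iff by linarith
          then show False using False by simp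
        qed
        then have "\<phi> z = 0" by (rule phi(5))
        moreover have "\<bar>u z (t - \<tau>)\<bar> \<le> M" "\<bar>u y t\<bar> \<le> M" using tau t by (auto intro!: M(2))
        then have "\<bar>u z (t - \<tau>) - u y t\<bar> \<le> 2 * M" by linarith
        then have "w z \<tau> * \<bar>u z (t - \<tau>) - u y t\<bar> \<le> w z \<tau> * (2 * M)"
          using wz by (rule mult_left_mono)
        moreover have "0 \<le> e / 3 * w z \<tau>" using wz \<open>e > 0\<close> by auto
        ultimately show ?thesis using eq by (simp add: mult_ac)
      qed
    qed
    also have "\<dots> = e / 3 + 2 * M * (1 - pairing w \<phi> \<tau>)"
      using wi wphi by (simp add: pairing_def)
    also have "\<dots> < e"
    proof -
      have "1 - pairing w \<phi> \<tau> < e / (6 * M)" using elim by (auto simp: dist_real_def abs_less_iff)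
      then have "2 * M * (1 - pairing w \<phi> \<tau>) < 2 * M * (e / (6 * M))"
        using M(1) by (intro mult_strict_left_mono) auto
      also have "2 * M * (e / (6 * M)) = e / 3" using M(1) by simp
      finally show ?thesis using \<open>e > 0\<close> by linarith
    qed
    finally show ?case by (simp add: dist_real_def)
  qed
qed

text \<open>Green's identity for \<open>w\<close> and the time reversal of \<open>u\<close>, which solves the backward equation.\<close>

lemma duality_invariant:
  assumes w: "kernel_from x w" and u: "kernel_from y u" and s: "0 < s1" "s1 \<le> s2" "s2 < t"
  shows "(LINT z|lborel. w z s1 * u z (t - s1)) = (LINT z|lborel. w z s2 * u z (t - s2))"
proof -
  obtain I K where sw: "solution w K" using w by (auto simp: kernel_from_def)
  obtain I' J where su: "solution u J" using u by (auto simp: kernel_from_def)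
  obtain D where D: "continuous_on ((- B) \<times> {0<..}) (\<lambda>(x, t). D x t)"
    "\<And>x t. x \<notin> B \<Longrightarrow> t > 0 \<Longrightarrow> ((\<lambda>z. u z t) has_real_derivative J x t / a x) (at x)"
    "\<And>x t. x \<notin> B \<Longrightarrow> t > 0 \<Longrightarrow> ((\<lambda>z. J z t) has_real_derivative D x t) (at x)"
    "\<And>x t. x \<notin> B \<Longrightarrow> t > 0 \<Longrightarrow> (u x has_real_derivative D x t) (at t)"
    using su unfolding solution_def by blast
  have rev: "continuous_on (A \<times> {s1..s2}) (\<lambda>(x, r). f x (t - r))"
    if f: "continuous_on (A \<times> {0<..}) (\<lambda>(x, r). f x r)" for f :: "real \<Rightarrow> real \<Rightarrow> real" and A
  proof -
    have "continuous_on (A \<times> {s1..s2}) (\<lambda>p. (\<lambda>(x, r). f x r) (fst p, t - snd p))"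
      by (rule continuous_on_compose2[OF f]) (use s in \<open>auto intro!: continuous_intros\<close>)
    then show ?thesis by (simp add: split_beta)
  qed
  define bd where "bd = (\<lambda>x r. K x r * u x (t - r) - w x r * J x (t - r))"
  have g: "((\<lambda>x. w x s2 * u x (t - s2) - w x s1 * u x (t - s1)) has_integral
      (integral {s1..s2} (bd (real n)) - integral {s1..s2} (bd (- real n)))) {- real n..real n}" for n
  proof -
    have "((\<lambda>x. w x s2 * u x (t - s2) - w x s1 * u x (t - s1) - integral {s1..s2} (\<lambda>r. w x r * 0)) has_integral
      (integral {s1..s2} (bd (real n)) - integral {s1..s2} (bd (- real n)))) {- real n..real n}"
      unfolding bd_def
    proof (rule green[OF sw s(1,2), where E = "\<lambda>x r. D x (t - r)"])
      show "continuous_on (UNIV \<times> {s1..s2}) (\<lambda>(x, r). u x (t - r))"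
        "continuous_on (UNIV \<times> {s1..s2}) (\<lambda>(x, r). J x (t - r))"
        by (intro rev solution_cont[OF su] order_refl)+
      show "continuous_on ((- B) \<times> {s1..s2}) (\<lambda>(x, r). D x (t - r))" by (rule rev[OF D(1)])
      fix x r assume x: "x \<notin> B" and r: "r \<in> {s1..s2}"
      then have tr: "0 < t - r" using s by auto
      show "((\<lambda>x. u x (t - r)) has_real_derivative J x (t - r) / a x) (at x)"
        "((\<lambda>x. J x (t - r)) has_real_derivative D x (t - r)) (at x)"
        by (rule D(2,3)[OF x tr])+
      have "((\<lambda>r. u x (t - r)) has_real_derivative D x (t - r) * (- 1)) (at r within {s1..s2})"
        by (rule DERIV_chain2[where f = "u x" and g = "\<lambda>r. t - r"])
          (auto intro!: derivative_eq_intros D(4)[OF x tr])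
      then show "((\<lambda>r. u x (t - r)) has_real_derivative 0 - D x (t - r)) (at r within {s1..s2})" by simp
    qed simp
    then show ?thesis by simp
  qed
  have small: "\<exists>R. \<forall>x r. \<bar>x\<bar> \<ge> R \<and> r \<in> {s1..s2} \<longrightarrow> \<bar>bd x r\<bar> \<le> \<epsilon>" if "\<epsilon> > 0" for \<epsilon>
  proof -
    define \<eta> where "\<eta> = min 1 (\<epsilon> / 2)"
    have eta: "0 < \<eta>" "\<eta> \<le> 1" "\<eta> \<le> \<epsilon> / 2" using that by (auto simp: \<eta>_def)
    have "0 < t" using s by auto
    obtain R1 where R1: "\<And>x r. \<bar>x\<bar> \<ge> R1 \<Longrightarrow> 0 < r \<Longrightarrow> r \<le> t \<Longrightarrow> \<bar>u x r\<bar> < \<eta>"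
      "\<And>x r. \<bar>x\<bar> \<ge> R1 \<Longrightarrow> 0 < r \<Longrightarrow> r \<le> t \<Longrightarrow> \<bar>J x r\<bar> < \<eta>"
      using solution_decay[OF su \<open>0 < t\<close> eta(1)] by metis
    obtain R2 where R2: "\<And>x r. \<bar>x\<bar> \<ge> R2 \<Longrightarrow> 0 < r \<Longrightarrow> r \<le> t \<Longrightarrow> \<bar>w x r\<bar> < \<eta>"
      "\<And>x r. \<bar>x\<bar> \<ge> R2 \<Longrightarrow> 0 < r \<Longrightarrow> r \<le> t \<Longrightarrow> \<bar>K x r\<bar> < \<eta>"
      using solution_decay[OF sw \<open>0 < t\<close> eta(1)] by metis
    have "\<bar>bd x r\<bar> \<le> \<epsilon>" if x: "\<bar>x\<bar> \<ge> max R1 R2" and r: "r \<in> {s1..s2}" for x r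
    proof -
      have "\<bar>K x r\<bar> * \<bar>u x (t - r)\<bar> \<le> \<eta> * 1" "\<bar>w x r\<bar> * \<bar>J x (t - r)\<bar> \<le> \<eta> * 1"
        using R1[of x "t - r"] R2[of x r] x r s eta by (intro mult_mono; force)+
      then show ?thesis using eta(3) unfolding bd_def abs_mult[symmetric] by linarith
    qed
    then show ?thesis by blast
  qed
  have "continuous_on {s1..s2} (bd x)" for x
    unfolding bd_def
    by (intro continuous_intros solution_cont_t[OF sw s(1)]
        continuous_on_slices(2)[OF rev[OF solution_cont(1)[OF su order_refl]], of x UNIV, simplified]
        continuous_on_slices(2)[OF rev[OF solution_cont(2)[OF su order_refl]], of x UNIV, simplified])
  then have "(\<lambda>n. integral {s1..s2} (bd (real n)) - integral {s1..s2} (bd (- real n))) \<longlonglongrightarrow> 0"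
    using small by (rule boundary_integrals_vanish[OF _ _ s(2)])
  moreover have "0 < s2" "0 < t - s1" "0 < t - s2" using s by auto
  note i = kernel_product_integrable[OF w u s(1) this(2)] kernel_product_integrable[OF w u this(1,3)]
  have "(\<lambda>n. integral {- real n..real n} (\<lambda>x. w x s2 * u x (t - s2) - w x s1 * u x (t - s1)))
      \<longlonglongrightarrow> (LINT z|lborel. w z s2 * u z (t - s2) - w z s1 * u z (t - s1))"
    by (intro integral_symmetric_tendsto Bochner_Integration.integrable_diff i)
  ultimately have "(LINT z|lborel. w z s2 * u z (t - s2) - w z s1 * u z (t - s1)) = 0"
    using LIMSEQ_unique unfolding integral_unique[OF g] by auto
  then show ?thesis using i by simp
qed

theorem duality:
  assumes w: "kernel_from x w" and u: "kernel_from y u" and s: "0 < s" "s < t"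
  shows "(LINT z|lborel. w z s * u z (t - s)) = u x t"
proof -
  obtain I J where su: "solution u J" using u by (auto simp: kernel_from_def)
  have "((\<lambda>\<tau>. LINT z|lborel. w z \<tau> * u z (t - \<tau>)) \<longlongrightarrow> u x t) (at_right 0)"
    by (rule kernel_tendsto_start[OF w su]) (use s in auto)
  moreover have "\<forall>\<^sub>F \<tau> in at_right 0. (LINT z|lborel. w z \<tau> * u z (t - \<tau>)) = (LINT z|lborel. w z s * u z (t - s))"
    unfolding eventually_at_right_field
    by (intro exI[of _ s] conjI allI impI s duality_invariant[OF w u]) (use s in auto)
  then have "((\<lambda>\<tau>. LINT z|lborel. w z \<tau> * u z (t - \<tau>)) \<longlongrightarrow> (LINT z|lborel. w z s * u z (t - s))) (at_right 0)"
    by (rule tendsto_eventually)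
  ultimately show ?thesis
    using tendsto_unique[OF trivial_limit_at_right_real] by blast
qed

corollary symmetry:
  assumes w: "kernel_from x w" and u: "kernel_from y u" and t: "0 < t"
  shows "u x t = w y t"
proof -
  have "u x t = (LINT z|lborel. w z (t/2) * u z (t - t/2))"
    by (rule duality[OF w u, symmetric]) (use t in auto)
  also have "\<dots> = (LINT z|lborel. u z (t/2) * w z (t - t/2))" by (simp add: mult.commute)
  also have "\<dots> = w y t"
    by (rule duality[OF u w]) (use t in auto)
  finally show ?thesis .
qed

text \<open>By duality \<open>u y (p + q)\<close> is the scalar product of \<open>u(\<cdot>,p)\<close> and \<open>u(\<cdot>,q)\<close>, so twice this value is
  at most the sum of the two squared norms.\<close>

lemma diagonal_midpoint_convex:
  assumes u: "kernel_from y u" and "0 < r" "r < t"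
  shows "2 * u y t \<le> u y (t - r) + u y (t + r)"
proof -
  have diag: "u y (2 * s) = (LINT z|lborel. u z s * u z s)" if "0 < s" for s
    using duality[OF u u, of s "2 * s"] that by simp
  define p q where "p = (t - r) / 2" and "q = (t + r) / 2"
  have pq: "0 < p" "0 < q" using assms by (auto simp: p_def q_def)
  note i = kernel_product_integrable[OF u u pq] kernel_product_integrable[OF u u pq(1) pq(1)]
    kernel_product_integrable[OF u u pq(2) pq(2)]
  have t: "t = p + q" "t - r = 2 * p" "t + r = 2 * q" by (auto simp: p_def q_def field_simps)
  have "2 * u y t = (LINT z|lborel. 2 * (u z p * u z q))"
    using duality[OF u u pq(1), of t] pq by (simp add: t(1))
  also have "\<dots> \<le> (LINT z|lborel. u z p * u z p + u z q * u z q)"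
  proof (intro integral_mono)
    fix z
    have "0 \<le> (u z p - u z q)^2" by simp
    then show "2 * (u z p * u z q) \<le> u z p * u z p + u z q * u z q"
      by (simp add: power2_eq_square algebra_simps)
  qed (use i in auto)
  also have "\<dots> = u y (t - r) + u y (t + r)"
    unfolding t(2,3) using i diag[OF pq(1)] diag[OF pq(2)] by simp
  finally show ?thesis .
qed

text \<open>A bound on the diagonal values that does not depend on the source. The fraction \<open>(hi / lo + 1) / (2 * sqrt hi)\<close> is the pointwise
  bound for the resolvent at \<open>\<lambda> = 1\<close>.\<close>

definition kernel_bound :: "real \<Rightarrow> real" where
  "kernel_bound t = 1 + (hi / lo + 1) / (2 * sqrt hi) * exp (2 * t) / t"

text \<open>The resolvent bounds a time average of the diagonal values: for a bump \<open>f\<close> of integral \<open>F\<close> at the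
  source, \<open>exp(-r) \<langle>u(r), R\<^sub>1 f\<rangle>\<close> is at most a constant times \<open>F\<close>, nonnegative, and decreases at the
  rate \<open>exp(-r) \<langle>u(r), f\<rangle>\<close>, which is almost \<open>exp(-r) F u(y,r)\<close> if the bump is narrow.
  Midpoint convexity bounds the value at \<open>t\<close> by the averages over intervals centred at \<open>t\<close>.\<close>

lemma diagonal_bound:
  assumes u: "kernel_from y u" and t: "0 < t"
  shows "u y t \<le> kernel_bound t"
proof (cases "u y t \<le> 1")
  case True
  have "0 \<le> (hi / lo + 1) / (2 * sqrt hi) * exp (2 * t) / t"
    using hi_pos lo_pos t by (intro divide_nonneg_nonneg mult_nonneg_nonneg) auto
  then show ?thesis using True by (simp add: kernel_bound_def)
next
  case False
  define k where "k = (hi / lo + 1) / (2 * sqrt hi)"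
  obtain I J where su: "solution u J" "starts_from I y u" using u by (auto simp: kernel_from_def)
  have "uniformly_continuous_on ({y-1..y+1} \<times> {t/2..3*t/2}) (\<lambda>(x, r). u x r)"
    using t by (intro compact_uniformly_continuous solution_cont[OF su(1)] compact_Times) auto
  then obtain d where d: "d > 0" "\<And>p p'. p \<in> {y-1..y+1} \<times> {t/2..3*t/2} \<Longrightarrow> p' \<in> {y-1..y+1} \<times> {t/2..3*t/2} \<Longrightarrow>
      dist p' p < d \<Longrightarrow> dist ((\<lambda>(x, r). u x r) p') ((\<lambda>(x, r). u x r) p) < 1"
    unfolding uniformly_continuous_on_def using zero_less_one by metis
  define \<delta> where "\<delta> = min d 1"
  have \<delta>: "\<delta> > 0" "\<delta> \<le> 1" "\<delta> \<le> d" using d(1) by (auto simp: \<delta>_def)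
  obtain f where f: "test_function f" "\<And>x. 0 \<le> f x" "\<And>x. x \<notin> {y - \<delta><..<y + \<delta>} \<Longrightarrow> f x = 0"
    "0 < (LINT x|lborel. f x)"
    by (rule bump[OF \<delta>(1), of y]) blast
  note fi = test_function_integrable[OF f(1)]
  define F where "F = (LINT x|lborel. f x)"
  have F: "F > 0" using f(4) by (simp add: F_def)
  have pf: "(u y r - 1) * F \<le> pairing u f r" if r: "r \<in> {t/2..3*t/2}" for r
  proof -
    have "0 < r" using r t by auto
    have "(u y r - 1) * F = (LINT x|lborel. (u y r - 1) * f x)" by (simp add: F_def)
    also have "\<dots> \<le> (LINT x|lborel. u x r * f x)"
    proof (intro integral_mono integrable_mult_right fi pairing_integrable[OF su(1) \<open>0 < r\<close>])
      fix x
      show "(u y r - 1) * f x \<le> u x r * f x"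
      proof (cases "x \<in> {y - \<delta><..<y + \<delta>}")
        case True
        have "dist ((\<lambda>(x, r). u x r) (x, r)) ((\<lambda>(x, r). u x r) (y, r)) < 1"
          by (rule d(2)) (use True r \<delta> in \<open>auto simp: dist_Pair_Pair dist_real_def\<close>)
        then have "u y r - 1 \<le> u x r" by (simp add: dist_real_def abs_less_iff)
        then show ?thesis using f(2) by (intro mult_right_mono) auto
      qed (simp add: f(3))
    qed
    finally show ?thesis by (simp add: pairing_def)
  qed
  have adm: "admissible I f" by (rule test_function_admissible[OF f(1,2)])
  define \<psi> where "\<psi> = resolvent 1 f"
  obtain m where m: "resolves 1 f \<psi> m"
    unfolding \<psi>_def by (rule resolvent_resolves[OF zero_less_one adm]) blast
  have psi: "integrable lborel \<psi>" "\<And>x. 0 \<le> \<psi> x" "\<And>x. \<psi> x \<le> k * F"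
    using m by (auto simp: resolves_def k_def F_def)
  have pair_nonneg: "0 \<le> pairing u h r" if "\<And>x. 0 \<le> h x" "0 < r" for h r
    unfolding pairing_def using kernel_nonneg[OF u that(2)] that(1)
    by (intro integral_nonneg_AE AE_I2 mult_nonneg_nonneg) auto
  define p where "p = (\<lambda>r. exp (- r) * pairing u \<psi> r)"
  have p_deriv: "(p has_real_derivative - (exp (- r) * pairing u f r)) (at r)" if "0 < r" for r
  proof -
    have "(p has_real_derivative (- exp (- r)) * pairing u \<psi> r + (1 * pairing u \<psi> r - pairing u f r) * exp (- r)) (at r)"
      unfolding p_def \<psi>_def
      by (intro DERIV_mult pairing_resolvent_deriv[OF su(1) that zero_less_one adm])
        (auto intro!: derivative_eq_intros)
    then show ?thesis by (rule DERIV_cong) (simp add: algebra_simps)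
  qed
  define c where "c = exp (- (2 * t)) * ((2 * u y t - 2) * F)"
  \<comment> \<open>The decrease of \<open>p\<close> over the interval of radius \<open>h\<close> around \<open>t\<close>, minus a lower bound for it that
    is linear in \<open>h\<close> by midpoint convexity.\<close>
  define P where "P = (\<lambda>h. p (t - h) - p (t + h) - c * h)"
  have "P 0 \<le> P (t/2)"
  proof (rule DERIV_nonneg_imp_nondecreasing[where f = P and a = 0 and b = "t/2"])
    fix h assume h: "0 \<le> h" "h \<le> t/2"
    have pos: "0 < t - h" "0 < t + h" using h t by auto
    have "(P has_real_derivative - (exp (- (t - h)) * pairing u f (t - h)) * (- 1) - - (exp (- (t + h)) * pairing u f (t + h)) * 1 - c) (at h)"
      unfolding P_def
      by (intro DERIV_diff DERIV_chain2[of p _ "\<lambda>h. t - h"] DERIV_chain2[of p _ "\<lambda>h. t + h"] p_deriv pos)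
        (auto intro!: derivative_eq_intros)
    moreover have "0 \<le> - (exp (- (t - h)) * pairing u f (t - h)) * (- 1) - - (exp (- (t + h)) * pairing u f (t + h)) * 1 - c"
    proof -
      have "2 * u y t \<le> u y (t - h) + u y (t + h)"
        using diagonal_midpoint_convex[OF u, of h t] h t by (cases "h = 0") auto
      then have "(2 * u y t - 2) * F \<le> (u y (t - h) - 1 + (u y (t + h) - 1)) * F"
        using F by (intro mult_right_mono) auto
      also have "\<dots> \<le> pairing u f (t - h) + pairing u f (t + h)"
        unfolding distrib_right by (intro add_mono pf) (use h t in auto)
      finally have "c \<le> exp (- (2 * t)) * (pairing u f (t - h) + pairing u f (t + h))"
        unfolding c_def by (intro mult_left_mono) auto
      also have "\<dots> \<le> exp (- (t - h)) * pairing u f (t - h) + exp (- (t + h)) * pairing u f (t + h)"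
        unfolding distrib_left using h t pair_nonneg[OF f(2)] pos by (intro add_mono mult_right_mono) auto
      finally show ?thesis by simp
    qed
    ultimately show "\<exists>y. (P has_real_derivative y) (at h) \<and> 0 \<le> y" by blast
  qed (use t in auto)
  moreover have "0 \<le> p (t + t/2)"
    unfolding p_def using pair_nonneg[OF psi(2), of "t + t/2"] t by simp
  moreover have "p (t - t/2) \<le> 1 * (k * F)"
    unfolding p_def
  proof (rule mult_mono)
    have t2: "0 < t - t/2" using t by simp
    have "pairing u \<psi> (t - t/2) \<le> (LINT x|lborel. u x (t - t/2) * (k * F))"
      unfolding pairing_def
    proof (rule integral_mono[OF pairing_integrable[OF su(1) t2 psi(1)]])
      show "integrable lborel (\<lambda>x. u x (t - t/2) * (k * F))"
        by (intro integrable_mult_left kernel_integrable[OF u t2])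
      show "u x (t - t/2) * \<psi> x \<le> u x (t - t/2) * (k * F)" for x
        by (intro mult_left_mono psi kernel_nonneg[OF u t2])
    qed
    then show "pairing u \<psi> (t - t/2) \<le> k * F" using kernel_integrable[OF u t2] by simp
    show "0 \<le> pairing u \<psi> (t - t/2)" by (rule pair_nonneg[OF psi(2) t2])
  qed (use t in auto)
  ultimately have "c * (t / 2) \<le> k * F" unfolding P_def by simp
  then have "(exp (- (2 * t)) * (u y t - 1) * t) * F \<le> k * F"
    by (simp add: c_def algebra_simps)
  then have "exp (- (2 * t)) * (u y t - 1) * t \<le> k" using F by simp
  then have "exp (2 * t) * (exp (- (2 * t)) * (u y t - 1) * t) \<le> exp (2 * t) * k"
    by (intro mult_left_mono) auto
  then have "(u y t - 1) * t \<le> exp (2 * t) * k"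
    by (simp add: mult.assoc[symmetric] exp_add[symmetric])
  then have "u y t - 1 \<le> k * exp (2 * t) / t"
    using t by (simp add: le_divide_eq mult.commute)
  then show ?thesis by (simp add: kernel_bound_def k_def)
qed

text \<open>Duality at half the time and \<open>2 p q \<le> p\<^sup>2 + q\<^sup>2\<close> reduce this to the diagonal.\<close>

lemma off_diagonal_bound:
  assumes u: "kernel_from y u" and w: "kernel_from x w" and t: "0 < t"
  shows "u x t \<le> kernel_bound t"
proof -
  have t2: "0 < t/2" using t by simp
  have "u x t = (LINT z|lborel. w z (t/2) * u z (t/2))"
    using duality[OF w u, of "t/2" t] t by simp
  also have "\<dots> \<le> (LINT z|lborel. (w z (t/2) * w z (t/2) + u z (t/2) * u z (t/2)) / 2)"
  proof (intro integral_mono)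
    fix z
    have "0 \<le> (w z (t/2) - u z (t/2))^2" by simp
    then show "w z (t/2) * u z (t/2) \<le> (w z (t/2) * w z (t/2) + u z (t/2) * u z (t/2)) / 2"
      by (simp add: power2_eq_square algebra_simps)
  qed (use kernel_product_integrable[OF w u t2 t2] kernel_product_integrable[OF w w t2 t2]
        kernel_product_integrable[OF u u t2 t2] in auto)
  also have "\<dots> = ((LINT z|lborel. w z (t/2) * w z (t/2)) + (LINT z|lborel. u z (t/2) * u z (t/2))) / 2"
    using kernel_product_integrable[OF w w t2 t2] kernel_product_integrable[OF u u t2 t2] by simp
  also have "\<dots> = (w x t + u y t) / 2"
    using duality[OF w w, of "t/2" t] duality[OF u u, of "t/2" t] t by simp
  also have "\<dots> \<le> kernel_bound t"
    using diagonal_bound[OF w t] diagonal_bound[OF u t] by simp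
  finally show ?thesis .
qed

text \<open>If \<open>x\<close> is not an interface, symmetry replaces \<open>G y x (t - s)\<close> by \<open>G x y (t - s)\<close> for all \<open>y\<close> off the
  null set \<open>B\<close>, and duality evaluates the integral. An interface \<open>x\<close> is approximated by other points,
  with \<open>kernel_bound (t - s) * G y0 y s\<close> as the dominating function.\<close>

theorem semigroup:
  assumes G: "\<And>y. y \<notin> B \<Longrightarrow> kernel_from y (G y)" and y0: "y0 \<notin> B" and s: "0 < s" "s < t"
  shows "has_bochner_integral lborel (\<lambda>y. G y0 y s * G y x (t - s)) (G y0 x t)"
proof -
  have ts: "0 < t - s" "0 < t" using s by auto
  have off: "has_bochner_integral lborel (\<lambda>y. if y \<in> B then 0 else G y0 y s * G y x (t - s)) (G y0 x t)"
    if x: "x \<notin> B" for x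
  proof -
    have i: "integrable lborel (\<lambda>y. G x y (t - s) * G y0 y s)"
      by (rule kernel_product_integrable[OF G[OF x] G[OF y0] ts(1) s(1)])
    have v: "(LINT y|lborel. G x y (t - s) * G y0 y s) = G y0 x t"
      using duality[OF G[OF x] G[OF y0] ts(1), of t] s by simp
    have eq: "(if y \<in> B then 0 else G y0 y s * G y x (t - s)) = (if y \<in> B then 0 else G x y (t - s) * G y0 y s)" for y
      using symmetry[OF G[OF x] G, of y "t - s"] ts by (auto simp: mult.commute)
    have "has_bochner_integral lborel (\<lambda>y. G x y (t - s) * G y0 y s) (G y0 x t)"
      using i v by (simp add: has_bochner_integral_iff)
    then show ?thesis
      unfolding eq
      by (subst has_bochner_integral_discrete_difference[of B _ _ "\<lambda>y. G x y (t - s) * G y0 y s"])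
        (use finite_B in \<open>auto simp: countable_finite\<close>)
  qed
  obtain X where X: "\<And>n. X n \<notin> B" "X \<longlonglongrightarrow> x"
  proof -
    have "x islimpt - B"
    proof -

      have "x islimpt (B \<union> - B)" by (simp add: islimpt_UNIV)
      then show ?thesis using islimpt_Un finite_B islimpt_finite by metis
    qed
    then show ?thesis using that islimpt_sequential[of x "- B"] by auto
  qed
  obtain I J where su: "solution (G y0) J" using G[OF y0] by (auto simp: kernel_from_def)
  define f where "f = (\<lambda>n y. if y \<in> B then 0 else G y0 y s * G y (X n) (t - s))"
  define g where "g = (\<lambda>y. if y \<in> B then 0 else G y0 y s * G y x (t - s))"
  have f: "integrable lborel (f n)" "(LINT y|lborel. f n y) = G y0 (X n) t" for n
    using off[OF X(1)[of n]] by (auto simp: f_def has_bochner_integral_iff)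
  have lim: "(\<lambda>n. f n y) \<longlonglongrightarrow> g y" for y
  proof (cases "y \<in> B")
    case True
    then show ?thesis by (simp add: f_def g_def)
  next
    case False
    obtain I' J' where sy: "solution (G y) J'" using G[OF False] by (auto simp: kernel_from_def)
    have "isCont (\<lambda>x. G y x (t - s)) x"
      using solution_cont_x(1)[OF sy ts(1)] by (simp add: continuous_on_eq_continuous_at)
    then have "(\<lambda>n. G y (X n) (t - s)) \<longlonglongrightarrow> G y x (t - s)"
      using X(2) by (rule isCont_tendsto_compose)
    then show ?thesis using False by (auto simp: f_def g_def intro!: tendsto_intros)
  qed
  have bound: "norm (f n y) \<le> kernel_bound (t - s) * G y0 y s" for n y
  proof (cases "y \<in> B")
    case True
    have "0 \<le> G y0 y0 (t - s)" by (rule kernel_nonneg[OF G[OF y0] ts(1)])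
    then have "0 \<le> kernel_bound (t - s)" using diagonal_bound[OF G[OF y0] ts(1)] by linarith
    then show ?thesis using True kernel_nonneg[OF G[OF y0] s(1)] by (simp add: f_def)
  next
    case False
    have "0 \<le> G y (X n) (t - s)" "G y (X n) (t - s) \<le> kernel_bound (t - s)"
      by (rule kernel_nonneg[OF G[OF False] ts(1)], rule off_diagonal_bound[OF G[OF False] G[OF X(1)] ts(1)])
    then show ?thesis using False kernel_nonneg[OF G[OF y0] s(1), of y]
      by (simp add: f_def abs_mult mult.commute mult_left_mono)
  qed
  have gm: "g \<in> borel_measurable lborel"
    by (rule borel_measurable_LIMSEQ_real[OF lim]) (use f(1) in \<open>blast intro: borel_measurable_integrable\<close>)
  have fm: "f n \<in> borel_measurable lborel" for n
    using f(1) by (rule borel_measurable_integrable)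
  have wi: "integrable lborel (\<lambda>y. kernel_bound (t - s) * G y0 y s)"
    by (intro integrable_mult_right kernel_integrable(1)[OF G[OF y0] s(1)])
  have g: "integrable lborel g" "(\<lambda>n. LINT y|lborel. f n y) \<longlonglongrightarrow> (LINT y|lborel. g y)"
    by (rule integrable_dominated_convergence[OF gm fm wi AE_I2[OF lim] AE_I2[OF bound]],
        rule integral_dominated_convergence[OF gm fm wi AE_I2[OF lim] AE_I2[OF bound]])
  have "isCont (\<lambda>x. G y0 x t) x"
    using solution_cont_x(1)[OF su ts(2)] by (simp add: continuous_on_eq_continuous_at)
  then have "(\<lambda>n. G y0 (X n) t) \<longlonglongrightarrow> G y0 x t"
    using X(2) by (rule isCont_tendsto_compose)
  then have "(LINT y|lborel. g y) = G y0 x t"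
    using LIMSEQ_unique[OF g(2)[unfolded f(2)]] by simp
  then have "has_bochner_integral lborel g (G y0 x t)"
    using g(1) by (simp add: has_bochner_integral_iff)
  then show ?thesis
    by (subst has_bochner_integral_discrete_difference[of B _ _ g])
      (use finite_B in \<open>auto simp: countable_finite g_def\<close>)
qed

end

section \<open>From the multiphase system to the layered medium\<close>

lemma (in layered_medium) shifted_medium:
  "layered_medium (\<lambda>x. a (x + y)) ((\<lambda>x. x - y) ` B) lo hi"
proof
  show "finite ((\<lambda>x. x - y) ` B)" using finite_B by simp
  show "0 < lo" "\<And>x. lo \<le> a (x + y)" "\<And>x. a (x + y) \<le> hi" using lo_pos a_ge a_le by auto
  fix x assume "x \<notin> (\<lambda>x. x - y) ` B"
  then have "x + y \<notin> B" by force
  then have "isCont a (x + y)" by (rule a_cont)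
  then show "isCont (\<lambda>x. a (x + y)) x"
    by (intro isCont_o2[where g = a and f = "\<lambda>x. x + y"]) auto
qed

text \<open>The system with interfaces moved by \<open>- y\<close> is the original one seen from \<open>y\<close>, so its solution with
  source \<open>z\<close> becomes, after translation, a solution of the original system with source \<open>z + y\<close>.\<close>

lemma (in layered_medium) kernel_translate:
  assumes "layered_medium.kernel_from (\<lambda>x. a (x + y)) ((\<lambda>x. x - y) ` B) z u"
  shows "kernel_from (z + y) (\<lambda>x t. u (x - y) t)"
proof -
  interpret shift: layered_medium "\<lambda>x. a (x + y)" "(\<lambda>x. x - y) ` B" lo hi
    by (rule shifted_medium)
  obtain I J where sol: "shift.solution u J" and st: "shift.starts_from I z u"
    using assms unfolding shift.kernel_from_def by blast
  have B: "x - y \<notin> (\<lambda>x. x - y) ` B \<longleftrightarrow> x \<notin> B" for x by auto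
  have cont: "continuous_on (A \<times> {0<..}) (\<lambda>(x, t). f (x - y) t)"
    if f: "continuous_on (A' \<times> {0<..}) (\<lambda>(x, t). f x t)" and "\<And>x. x \<in> A \<Longrightarrow> x - y \<in> A'"
    for f :: "real \<Rightarrow> real \<Rightarrow> real" and A A'
  proof -
    have "continuous_on (A \<times> {0<..}) (\<lambda>p. (\<lambda>(x, t). f x t) (fst p - y, snd p))"
      by (rule continuous_on_compose2[OF f]) (use that in \<open>auto intro!: continuous_intros\<close>)
    then show ?thesis by (simp add: split_beta)
  qed
  have shift_deriv: "((\<lambda>z. f (z - y)) has_real_derivative d) (at x)"
    if "(f has_real_derivative d) (at (x - y))" for f :: "real \<Rightarrow> real" and d x
    using that DERIV_shift[of f d x "- y"] by simp
  have "solution (\<lambda>x t. u (x - y) t) (\<lambda>x t. J (x - y) t)"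
  proof -
    obtain D where D: "continuous_on ((- (\<lambda>x. x - y) ` B) \<times> {0<..}) (\<lambda>(x, t). D x t)"
      "\<And>x t. x \<notin> (\<lambda>x. x - y) ` B \<Longrightarrow> t > 0 \<Longrightarrow> ((\<lambda>z. u z t) has_real_derivative J x t / a (x + y)) (at x)"
      "\<And>x t. x \<notin> (\<lambda>x. x - y) ` B \<Longrightarrow> t > 0 \<Longrightarrow> ((\<lambda>z. J z t) has_real_derivative D x t) (at x)"
      "\<And>x t. x \<notin> (\<lambda>x. x - y) ` B \<Longrightarrow> t > 0 \<Longrightarrow> (u x has_real_derivative D x t) (at t)"
      using sol unfolding shift.solution_def by blast
    have 1: "continuous_on (UNIV \<times> {0<..}) (\<lambda>(x, t). u (x - y) t)"
      "continuous_on (UNIV \<times> {0<..}) (\<lambda>(x, t). J (x - y) t)"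
      using shift.solution_cont[OF sol order_refl, of UNIV] by (auto intro: cont)
    have 2: "continuous_on ((- B) \<times> {0<..}) (\<lambda>(x, t). D (x - y) t)"
      by (rule cont[OF D(1)]) auto
    have 3: "((\<lambda>z. u (z - y) t) has_real_derivative J (x - y) t / a x) (at x) \<and>
        ((\<lambda>z. J (z - y) t) has_real_derivative D (x - y) t) (at x) \<and>
        ((\<lambda>r. u (x - y) r) has_real_derivative D (x - y) t) (at t)" if "x \<notin> B" "t > 0" for x t
      using shift_deriv[OF D(2)[of "x - y" t]] shift_deriv[OF D(3)[of "x - y" t]] D(4)[of "x - y" t] B[of x] that
      by simp
    have 4: "\<exists>R. \<forall>x t. \<bar>x\<bar> \<ge> R \<and> 0 < t \<and> t \<le> T \<longrightarrow> \<bar>u (x - y) t\<bar> < \<epsilon> \<and> \<bar>J (x - y) t\<bar> < \<epsilon>"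
      if T: "T > 0" and e: "\<epsilon> > 0" for T \<epsilon>
    proof -
      obtain R where R: "\<And>x t. \<bar>x\<bar> \<ge> R \<Longrightarrow> 0 < t \<Longrightarrow> t \<le> T \<Longrightarrow> \<bar>u x t\<bar> < \<epsilon>"
        "\<And>x t. \<bar>x\<bar> \<ge> R \<Longrightarrow> 0 < t \<Longrightarrow> t \<le> T \<Longrightarrow> \<bar>J x t\<bar> < \<epsilon>"
        using shift.solution_decay[OF sol T e] by metis
      have "R \<le> \<bar>x - y\<bar>" if "\<bar>x\<bar> \<ge> R + \<bar>y\<bar>" for x using that by linarith
      then show ?thesis using R by (intro exI[of _ "R + \<bar>y\<bar>"]) blast
    qed
    show ?thesis
      unfolding solution_def using 1 2 3 4 by blast
  qed
  moreover have "starts_from ((\<lambda>x. x + y) ` I) (z + y) (\<lambda>x t. u (x - y) t)"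
  proof -
    have mem: "x \<in> (\<lambda>x. x + y) ` I \<longleftrightarrow> x - y \<in> I" for x by force
    have patch: "open I" "is_interval I" "I \<inter> (\<lambda>x. x - y) ` B = {}" "\<exists>a0. \<forall>x\<in>I. a (x + y) = a0"
      and "z \<in> I" using st by (auto simp: shift.starts_from_def shift.homogeneous_patch_def)
    have "homogeneous_patch ((\<lambda>x. x + y) ` I)"
      unfolding homogeneous_patch_def
    proof (intro conjI)
      show "open ((\<lambda>x. x + y) ` I)"
        using open_translation[OF patch(1), of y] by (simp add: add.commute)
      show "is_interval ((\<lambda>x. x + y) ` I)"
        using patch(2) convex_translation[of I y] by (simp add: is_interval_convex_1 add.commute)
      show "(\<lambda>x. x + y) ` I \<inter> B = {}" using patch(3) by force
      show "\<exists>a0. \<forall>x\<in>(\<lambda>x. x + y) ` I. a x = a0" using patch(4) by auto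
    qed
    moreover have "\<exists>\<delta>>0. \<forall>x t. x \<notin> (\<lambda>x. x + y) ` I \<and> 0 < t \<and> t < \<delta> \<longrightarrow> \<bar>u (x - y) t\<bar> < \<epsilon>" if "\<epsilon> > 0" for \<epsilon>
      using st that unfolding shift.starts_from_def mem by blast
    moreover have "(pairing (\<lambda>x t. u (x - y) t) \<phi> \<longlongrightarrow> \<phi> (z + y)) (at_right 0)" if phi: "test_function \<phi>" for \<phi>
    proof -
      have sm: "smooth (\<lambda>x. \<phi> (x + y))"
        using smooth_affine_comp[OF test_function_smooth[OF phi], of 1 y] by simp
      obtain R where R: "R > 0" "\<And>x. \<bar>x\<bar> > R \<Longrightarrow> \<phi> x = 0"
        using test_function_bounded_support[OF phi] by metis
      have "{x. \<phi> (x + y) \<noteq> 0} \<subseteq> {- R - \<bar>y\<bar>..R + \<bar>y\<bar>}"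
      proof
        fix x assume "x \<in> {x. \<phi> (x + y) \<noteq> 0}"
        then have "\<bar>x + y\<bar> \<le> R" using R(2)[of "x + y"] by force
        then show "x \<in> {- R - \<bar>y\<bar>..R + \<bar>y\<bar>}" by auto
      qed
      then have "bounded (closure {x. \<phi> (x + y) \<noteq> 0})"
        by (meson bounded_closure bounded_closed_interval bounded_subset)
      then have tf: "test_function (\<lambda>x. \<phi> (x + y))"
        using sm by (simp add: test_function_def smooth_def compact_eq_bounded_closed)
      have eq: "pairing (\<lambda>x t. u (x - y) t) \<phi> t = pairing u (\<lambda>x. \<phi> (x + y)) t" for t
        unfolding pairing_def
        using lborel_integral_real_affine[of 1 "\<lambda>x. u (x - y) t * \<phi> x" y] by (simp add: add.commute)
      have "(pairing u (\<lambda>x. \<phi> (x + y)) \<longlongrightarrow> \<phi> (z + y)) (at_right 0)"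
        using st tf unfolding shift.starts_from_def by blast
      then show ?thesis unfolding eq[abs_def] .
    qed
    ultimately show ?thesis
      using \<open>z \<in> I\<close> unfolding starts_from_def by blast
  qed
  ultimately show ?thesis unfolding kernel_from_def by blast
qed

text \<open>Phases are half-open here: an interface is assigned to the phase on its right, which has the
  smaller index since the boundaries are listed in decreasing order.\<close>

definition phase_index :: "(nat \<Rightarrow> ereal) \<Rightarrow> real \<Rightarrow> nat" where
  "phase_index q x = (LEAST k. 1 \<le> k \<and> q k \<le> ereal x)"

definition diffusivity :: "(nat \<Rightarrow> real) \<Rightarrow> (nat \<Rightarrow> ereal) \<Rightarrow> real \<Rightarrow> real" where
  "diffusivity \<sigma> q x = 1 / 2 * (\<sigma> (phase_index q x))\<^sup>2"

definition interfaces :: "nat \<Rightarrow> (nat \<Rightarrow> ereal) \<Rightarrow> real set" where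
  "interfaces N q = {x. \<exists>k\<in>{1..<N}. ereal x = q k}"

lemma open_phase: "open (phase q k)"
proof -
  have "phase q k = ereal -` {q k<..<q (k - 1)}" by (auto simp: phase_def)
  then show ?thesis using open_ereal_vimage[of "{q k<..<q (k - 1)}"] by simp
qed

lemma closed_closed_phase: "closed (closed_phase q k)"
proof -
  have "- closed_phase q k = ereal -` ({..<q k} \<union> {q (k - 1)<..})"
    by (auto simp: closed_phase_def not_le)
  moreover have "open (ereal -` ({..<q k} \<union> {q (k - 1)<..}))"
    by (intro open_ereal_vimage open_Un) auto
  ultimately show ?thesis by (simp only: closed_def)
qed

lemma interval_phase: "is_interval (phase q k)"
  unfolding is_interval_1
proof (intro ballI allI impI)
  fix a b x assume "a \<in> phase q k" "b \<in> phase q k" "a \<le> x \<and> x \<le> b"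
  then have "q k < ereal a" "ereal a \<le> ereal x" "ereal x \<le> ereal b" "ereal b < q (k - 1)"
    by (auto simp: phase_def)
  then have "q k < ereal x" "ereal x < q (k - 1)"
    by (blast intro: order_less_le_trans order_le_less_trans)+
  then show "x \<in> phase q k" by (simp add: phase_def)
qed

lemma phase_subset: "phase q k \<subseteq> closed_phase q k"
  by (auto simp: phase_def closed_phase_def)

locale multiphase =
  fixes N :: nat and \<sigma> :: "nat \<Rightarrow> real" and q :: "nat \<Rightarrow> ereal"
  assumes N: "N \<ge> 1" and \<sigma>_pos: "\<And>k. k \<in> {1..N} \<Longrightarrow> \<sigma> k > 0"
    and q_0: "q 0 = \<infinity>" and q_N: "q N = -\<infinity>"
    and q_decreasing: "\<And>k. k < N \<Longrightarrow> q (Suc k) < q k"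
begin

lemma q_less: "j < k \<Longrightarrow> k \<le> N \<Longrightarrow> q k < q j"
proof (induction k)
  case (Suc k)
  have "q (Suc k) < q k" using Suc by (intro q_decreasing) auto
  moreover have "q k \<le> q j" using Suc by (cases "j = k") (auto simp: less_Suc_eq)
  ultimately show ?case by (rule order_less_le_trans)
qed simp

lemma q_le: "j \<le> k \<Longrightarrow> k \<le> N \<Longrightarrow> q k \<le> q j"
  using q_less[of j k] by (cases "j = k") (auto intro: less_imp_le)

lemma phase_index:
  shows "phase_index q x \<in> {1..N}" "q (phase_index q x) \<le> ereal x" "ereal x < q (phase_index q x - 1)"
proof -
  have ex: "1 \<le> N \<and> q N \<le> ereal x" using N q_N by simp
  from LeastI[of "\<lambda>k. 1 \<le> k \<and> q k \<le> ereal x", OF ex] Least_le[of "\<lambda>k. 1 \<le> k \<and> q k \<le> ereal x", OF ex]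
  show a: "phase_index q x \<in> {1..N}" "q (phase_index q x) \<le> ereal x"
    by (auto simp: phase_index_def)
  show "ereal x < q (phase_index q x - 1)"
  proof (cases "phase_index q x = 1")
    case True
    then show ?thesis using q_0 by simp
  next
    case False
    then have "\<not> (1 \<le> phase_index q x - 1 \<and> q (phase_index q x - 1) \<le> ereal x)"
      using a(1) not_less_Least[of "phase_index q x - 1" "\<lambda>k. 1 \<le> k \<and> q k \<le> ereal x"]
      by (auto simp: phase_index_def)
    then show ?thesis using a(1) False by auto
  qed
qed

lemma phase_index_eq:
  assumes "k \<in> {1..N}" "q k \<le> ereal x" "ereal x < q (k - 1)"
  shows "phase_index q x = k"
proof (rule ccontr)
  assume "phase_index q x \<noteq> k"
  then consider "phase_index q x < k" | "k < phase_index q x" by linarith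
  then show False
  proof cases
    case 1
    then have "q (k - 1) \<le> q (phase_index q x)"
      using assms(1) by (intro q_le) auto
    then show False using phase_index(2)[of x] assms(3) by (meson leD order_trans)
  next
    case 2
    then have "q (phase_index q x - 1) \<le> q k"
      using phase_index(1)[of x] by (intro q_le) auto
    then show False using phase_index(3)[of x] assms(2) by (meson leD order_trans)
  qed
qed

lemma phase_index_phase: "k \<in> {1..N} \<Longrightarrow> x \<in> phase q k \<Longrightarrow> phase_index q x = k"
  by (intro phase_index_eq) (auto simp: phase_def)

lemma in_closed_phase_index: "x \<in> closed_phase q (phase_index q x)"
  using phase_index(2,3)[of x] by (auto simp: closed_phase_def)

text \<open>The closed phases overlap only at the interfaces, where the transmission conditions identify the
  two adjacent components.\<close>

lemma closed_phase_cases: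
  assumes "k \<in> {1..N}" "x \<in> closed_phase q k"
  obtains "phase_index q x = k" | j where "k = Suc j" "j \<in> {1..<N}" "ereal x = q j" "phase_index q x = j"
proof (cases "ereal x < q (k - 1)")
  case True
  then show ?thesis using that(1) phase_index_eq[OF assms(1)] assms(2) by (auto simp: closed_phase_def)
next
  case False
  then have eq: "ereal x = q (k - 1)" using assms(2) by (auto simp: closed_phase_def)
  then have "k \<noteq> 1" using q_0 by auto
  then have j: "k = Suc (k - 1)" "k - 1 \<in> {1..<N}" using assms(1) by auto
  have "phase_index q x = k - 1"
    using j eq q_less[of "k - 1 - 1" "k - 1"] by (intro phase_index_eq) auto
  then show ?thesis using that(2)[OF j eq] by simp
qed

lemma off_interface_phase:
  assumes "x \<notin> interfaces N q"
  shows "x \<in> phase q (phase_index q x)"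
proof -
  have "q (phase_index q x) \<noteq> ereal x"
  proof
    assume eq: "q (phase_index q x) = ereal x"
    then have "phase_index q x \<noteq> N" using q_N by auto
    then have "phase_index q x \<in> {1..<N}" using phase_index(1)[of x] by auto
    then show False using assms eq[symmetric] by (auto simp: interfaces_def)
  qed
  then show ?thesis using phase_index(2,3)[of x] by (simp add: phase_def)
qed

lemma phase_off_interface:
  assumes "k \<in> {1..N}" "x \<in> phase q k"
  shows "x \<notin> interfaces N q"
proof
  assume "x \<in> interfaces N q"
  then obtain j where j: "j \<in> {1..<N}" "ereal x = q j" by (auto simp: interfaces_def)
  then have "phase_index q x = j"
    using q_less[of "j - 1" j] by (intro phase_index_eq) auto
  then have "j = k" using phase_index_phase[OF assms] by simp
  then show False using assms(2) j(2) by (simp add: phase_def)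
qed

lemma diffusivity_phase: "k \<in> {1..N} \<Longrightarrow> x \<in> phase q k \<Longrightarrow> diffusivity \<sigma> q x = 1 / 2 * (\<sigma> k)\<^sup>2"
  by (simp add: diffusivity_def phase_index_phase)

definition lo :: real where "lo = Min ((\<lambda>k. 1 / 2 * (\<sigma> k)\<^sup>2) ` {1..N})"
definition hi :: real where "hi = Max ((\<lambda>k. 1 / 2 * (\<sigma> k)\<^sup>2) ` {1..N})"

sublocale medium: layered_medium "diffusivity \<sigma> q" "interfaces N q" lo hi
proof
  show "finite (interfaces N q)"
  proof (rule finite_subset)
    show "interfaces N q \<subseteq> (\<lambda>k. real_of_ereal (q k)) ` {1..<N}"
      unfolding interfaces_def by (auto intro!: image_eqI) (metis real_of_ereal.simps(1))
  qed simp
  have "lo \<in> (\<lambda>k. 1 / 2 * (\<sigma> k)\<^sup>2) ` {1..N}" unfolding lo_def using N by (intro Min_in) auto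
  then obtain k where k: "k \<in> {1..N}" "lo = 1 / 2 * (\<sigma> k)\<^sup>2" by blast
  show "0 < lo" unfolding k(2) using \<sigma>_pos[OF k(1)] by simp
  have mem: "diffusivity \<sigma> q x \<in> (\<lambda>k. 1 / 2 * (\<sigma> k)\<^sup>2) ` {1..N}" for x
    unfolding diffusivity_def by (rule imageI) (rule phase_index(1))
  show "lo \<le> diffusivity \<sigma> q x" "diffusivity \<sigma> q x \<le> hi" for x
    unfolding lo_def hi_def by (rule Min_le Max_ge; use mem in simp)+
  fix x assume "x \<notin> interfaces N q"
  then have x: "x \<in> phase q (phase_index q x)" by (rule off_interface_phase)
  have "\<forall>\<^sub>F z in nhds x. diffusivity \<sigma> q z = diffusivity \<sigma> q x"
    using eventually_nhds_in_open[OF open_phase x]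
    by eventually_elim (metis diffusivity_phase phase_index(1) x)
  then show "isCont (diffusivity \<sigma> q) x"
    by (simp add: isCont_cong[of "diffusivity \<sigma> q" "\<lambda>_. diffusivity \<sigma> q x"])
qed

lemma glue_continuous:
  fixes f :: "nat \<Rightarrow> real \<Rightarrow> real \<Rightarrow> real"
  assumes f: "\<And>k. k \<in> {1..N} \<Longrightarrow> continuous_on (closed_phase q k \<times> {0<..}) (\<lambda>(x, t). f k x t)"
    and eq: "\<And>k x t. k \<in> {1..N} \<Longrightarrow> x \<in> closed_phase q k \<Longrightarrow> 0 < t \<Longrightarrow> g x t = f k x t"
  shows "continuous_on (UNIV \<times> {0<..}) (\<lambda>(x, t). g x t)"
proof -
  have closed_piece: "continuous_on (UNIV \<times> {s..}) (\<lambda>(x, t). g x t)" if s: "0 < s" for s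
  proof -
    have "continuous_on (\<Union>k\<in>{1..N}. closed_phase q k \<times> {s..}) (\<lambda>(x, t). g x t)"
    proof (rule continuous_on_closed_Union)
      fix k assume k: "k \<in> {1..N}"
      show "closed (closed_phase q k \<times> {s..})" by (intro closed_Times closed_closed_phase) auto
      have "continuous_on (closed_phase q k \<times> {s..}) (\<lambda>(x, t). f k x t)"
        by (rule continuous_on_subset[OF f[OF k]]) (use s in auto)
      then show "continuous_on (closed_phase q k \<times> {s..}) (\<lambda>(x, t). g x t)"
        by (rule continuous_on_eq) (use eq[OF k] s in auto)
    qed simp
    moreover have "(\<Union>k\<in>{1..N}. closed_phase q k \<times> {s..}) = UNIV \<times> {s..}"
      using in_closed_phase_index phase_index(1) by blast
    ultimately show ?thesis by simp
  qed
  show ?thesis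
  proof (intro continuous_at_imp_continuous_on ballI)
    fix p :: "real \<times> real" assume "p \<in> UNIV \<times> {0<..}"
    then have "p \<in> UNIV \<times> {snd p / 2<..}" "0 < snd p / 2" by (auto simp: mem_Times_iff)
    moreover have "continuous_on (UNIV \<times> {snd p / 2<..}) (\<lambda>(x, t). g x t)"
      by (rule continuous_on_subset[OF closed_piece[OF calculation(2)]]) auto
    moreover have "open (UNIV \<times> {snd p / 2<..} :: (real \<times> real) set)" by (intro open_Times) auto
    ultimately show "isCont (\<lambda>(x, t). g x t) p"
      using continuous_on_eq_continuous_at by blast
  qed
qed

end

text \<open>The components of one solution of the system, with the conditions that \<open>multiphase_solution\<close> puts
  on them. Equality of adjacent components at an interface is part of the gluing of \<open>u\<close>.\<close>

locale multiphase_components = multiphase +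
  fixes l :: nat and v v' :: "nat \<Rightarrow> real \<Rightarrow> real \<Rightarrow> real" and u :: "real \<Rightarrow> real \<Rightarrow> real"
  assumes l: "l \<in> {1..N}" "0 \<in> phase q l"
    and heat: "k \<in> {1..N} \<Longrightarrow> heat_solution_on_phase q k (\<sigma> k) (v k) (v' k)"
    and transmission: "k \<in> {1..<N} \<Longrightarrow> ereal x = q k \<Longrightarrow> 0 < t \<Longrightarrow>
      1 / 2 * (\<sigma> k)\<^sup>2 * v' k x t = 1 / 2 * (\<sigma> (Suc k))\<^sup>2 * v' (Suc k) x t"
    and component_decay: "0 < T \<Longrightarrow> uniform_limit {0<..T} (v 1) (\<lambda>_. 0) at_top"
      "0 < T \<Longrightarrow> uniform_limit {0<..T} (v' 1) (\<lambda>_. 0) at_top"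
      "0 < T \<Longrightarrow> uniform_limit {0<..T} (v N) (\<lambda>_. 0) at_bot"
      "0 < T \<Longrightarrow> uniform_limit {0<..T} (v' N) (\<lambda>_. 0) at_bot"
    and zero_initially: "k \<in> {1..N} \<Longrightarrow> k \<noteq> l \<Longrightarrow> x \<in> closed_phase q k \<Longrightarrow>
      ((\<lambda>(z, t). v k z t) \<longlongrightarrow> 0) (at (x, 0) within closed_phase q k \<times> {0<..})"
    and u: "k \<in> {1..N} \<Longrightarrow> x \<in> closed_phase q k \<Longrightarrow> 0 < t \<Longrightarrow> u x t = v k x t"
    and dirac: "tends_to_dirac u"
begin

definition flux :: "real \<Rightarrow> real \<Rightarrow> real" where
  "flux x t = diffusivity \<sigma> q x * v' (phase_index q x) x t"

text \<open>The flux may be computed from either of two adjacent components; this is the second transmission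
  condition.\<close>

lemma flux_phase:
  assumes "k \<in> {1..N}" "x \<in> closed_phase q k" "0 < t"
  shows "flux x t = 1 / 2 * (\<sigma> k)\<^sup>2 * v' k x t"
  using assms(1,2)
proof (cases rule: closed_phase_cases)
  case 1
  then show ?thesis by (simp add: flux_def diffusivity_def)
next
  case (2 j)
  then show ?thesis using transmission[of j x t] assms(3) by (simp add: flux_def diffusivity_def)
qed

lemma solution_equations:
  shows "continuous_on (UNIV \<times> {0<..}) (\<lambda>(x, t). u x t)" "continuous_on (UNIV \<times> {0<..}) (\<lambda>(x, t). flux x t)"
    "\<exists>D. continuous_on ((- interfaces N q) \<times> {0<..}) (\<lambda>(x, t). D x t) \<and>
      (\<forall>x t. x \<notin> interfaces N q \<and> 0 < t \<longrightarrow>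
        ((\<lambda>z. u z t) has_real_derivative flux x t / diffusivity \<sigma> q x) (at x) \<and>
        ((\<lambda>z. flux z t) has_real_derivative D x t) (at x) \<and> (u x has_real_derivative D x t) (at t))"
proof -
  have v_cont: "continuous_on (closed_phase q k \<times> {0<..}) (\<lambda>(x, t). v k x t)"
    "continuous_on (closed_phase q k \<times> {0<..}) (\<lambda>(x, t). v' k x t)"
    "\<And>x t. x \<in> closed_phase q k \<Longrightarrow> 0 < t \<Longrightarrow> ((\<lambda>z. v k z t) has_real_derivative v' k x t) (at x within closed_phase q k)"
    if "k \<in> {1..N}" for k
    using heat[OF that] by (auto simp: heat_solution_on_phase_def)
  have "\<forall>k\<in>{1..N}. \<exists>v''. continuous_on (phase q k \<times> {0<..}) (\<lambda>(x, t). v'' x t) \<and>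
        (\<forall>x\<in>phase q k. \<forall>t>0.
           ((\<lambda>z. v' k z t) has_real_derivative v'' x t) (at x) \<and>
           ((\<lambda>r. v k x r) has_real_derivative 1 / 2 * (\<sigma> k)\<^sup>2 * v'' x t) (at t))"
    using heat unfolding heat_solution_on_phase_def by blast
  then obtain v'' where v'': "\<And>k. k \<in> {1..N} \<Longrightarrow> continuous_on (phase q k \<times> {0<..}) (\<lambda>(x, t). v'' k x t)"
    "\<And>k x t. k \<in> {1..N} \<Longrightarrow> x \<in> phase q k \<Longrightarrow> 0 < t \<Longrightarrow> ((\<lambda>z. v' k z t) has_real_derivative v'' k x t) (at x)"
    "\<And>k x t. k \<in> {1..N} \<Longrightarrow> x \<in> phase q k \<Longrightarrow> 0 < t \<Longrightarrow> ((\<lambda>r. v k x r) has_real_derivative 1 / 2 * (\<sigma> k)\<^sup>2 * v'' k x t) (at t)"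
    by (subst (asm) bchoice_iff) blast
  define D where "D = (\<lambda>x t. diffusivity \<sigma> q x * v'' (phase_index q x) x t)"
  show "continuous_on (UNIV \<times> {0<..}) (\<lambda>(x, t). u x t)"
    by (rule glue_continuous[OF v_cont(1) u])
  show "continuous_on (UNIV \<times> {0<..}) (\<lambda>(x, t). flux x t)"
  proof (rule glue_continuous[where f = "\<lambda>k x t. 1 / 2 * (\<sigma> k)\<^sup>2 * v' k x t", OF _ flux_phase])
    fix k assume "k \<in> {1..N}"
    then have "continuous_on (closed_phase q k \<times> {0<..}) (\<lambda>p. 1 / 2 * (\<sigma> k)\<^sup>2 * (\<lambda>(x, t). v' k x t) p)"
      by (intro continuous_intros v_cont(2))
    then show "continuous_on (closed_phase q k \<times> {0<..}) (\<lambda>(x, t). 1 / 2 * (\<sigma> k)\<^sup>2 * v' k x t)"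
      by (simp add: split_beta)
  qed
  have D_cont: "continuous_on ((- interfaces N q) \<times> {0<..}) (\<lambda>(x, t). D x t)"
  proof (intro continuous_at_imp_continuous_on ballI)
    fix p :: "real \<times> real" assume p: "p \<in> (- interfaces N q) \<times> {0<..}"
    define k where "k = phase_index q (fst p)"
    have k: "k \<in> {1..N}" unfolding k_def by (rule phase_index(1))
    have p_in: "p \<in> phase q k \<times> {0<..}"
      using p off_interface_phase[of "fst p"] by (auto simp: mem_Times_iff k_def)
    have "continuous_on (phase q k \<times> {0<..}) (\<lambda>p. 1 / 2 * (\<sigma> k)\<^sup>2 * (\<lambda>(x, t). v'' k x t) p)"
      by (intro continuous_intros v''(1) k)
    then have "continuous_on (phase q k \<times> {0<..}) (\<lambda>(x, t). D x t)"
      by (rule continuous_on_eq)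
        (use k in \<open>auto simp: D_def diffusivity_phase phase_index_phase\<close>)
    moreover have "open (phase q k \<times> {0::real<..})" by (intro open_Times open_phase) auto
    ultimately show "isCont (\<lambda>(x, t). D x t) p"
      using p_in continuous_on_eq_continuous_at by blast
  qed
  have der: "((\<lambda>z. u z t) has_real_derivative flux x t / diffusivity \<sigma> q x) (at x) \<and>
      ((\<lambda>z. flux z t) has_real_derivative D x t) (at x) \<and> (u x has_real_derivative D x t) (at t)"
    if x: "x \<notin> interfaces N q" and t: "0 < t" for x t
  proof (intro conjI)
    define k where "k = phase_index q x"
    have k: "k \<in> {1..N}" unfolding k_def by (rule phase_index(1))
    have xk: "x \<in> phase q k" unfolding k_def by (rule off_interface_phase[OF x])
    have xc: "z \<in> closed_phase q k" if "z \<in> phase q k" for z using that phase_subset by blast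
    have dk: "diffusivity \<sigma> q x = 1 / 2 * (\<sigma> k)\<^sup>2" by (rule diffusivity_phase[OF k xk])
    have "((\<lambda>z. v k z t) has_real_derivative v' k x t) (at x within phase q k)"
      by (rule DERIV_subset[OF v_cont(3)[OF k xc[OF xk] t] phase_subset])
    then have "((\<lambda>z. v k z t) has_real_derivative v' k x t) (at x)"
      using at_within_open[OF xk open_phase] by simp
    then have "((\<lambda>z. u z t) has_real_derivative v' k x t) (at x)"
      by (rule has_field_derivative_transform_within_open[OF _ open_phase xk]) (use u[OF k xc t] in auto)
    moreover have "flux x t / diffusivity \<sigma> q x = v' k x t"
      unfolding flux_phase[OF k xc[OF xk] t] dk using \<sigma>_pos[OF k] by simp
    ultimately show "((\<lambda>z. u z t) has_real_derivative flux x t / diffusivity \<sigma> q x) (at x)" by simp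
    have Dk: "D x t = 1 / 2 * (\<sigma> k)\<^sup>2 * v'' k x t" using dk by (simp add: D_def k_def)
    have "((\<lambda>z. 1 / 2 * (\<sigma> k)\<^sup>2 * v' k z t) has_real_derivative D x t) (at x)"
      unfolding Dk by (intro DERIV_cmult v''(2) k xk t)
    then show "((\<lambda>z. flux z t) has_real_derivative D x t) (at x)"
      by (rule has_field_derivative_transform_within_open[OF _ open_phase xk]) (use flux_phase[OF k xc t] in auto)
    have "((\<lambda>r. v k x r) has_real_derivative D x t) (at t)"
      unfolding Dk by (rule v''(3)[OF k xk t])
    then show "(u x has_real_derivative D x t) (at t)"
      by (rule has_field_derivative_transform_within_open[of _ _ _ "{0<..}"]) (use t u[OF k xc[OF xk]] in auto)
  qed
  show "\<exists>D. continuous_on ((- interfaces N q) \<times> {0<..}) (\<lambda>(x, t). D x t) \<and>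
      (\<forall>x t. x \<notin> interfaces N q \<and> 0 < t \<longrightarrow>
        ((\<lambda>z. u z t) has_real_derivative flux x t / diffusivity \<sigma> q x) (at x) \<and>
        ((\<lambda>z. flux z t) has_real_derivative D x t) (at x) \<and> (u x has_real_derivative D x t) (at t))"
    using D_cont der by blast
qed

lemma uniform_decay:
  assumes T: "T > 0" and e: "\<epsilon> > 0"
  shows "\<exists>R. \<forall>x t. \<bar>x\<bar> \<ge> R \<and> 0 < t \<and> t \<le> T \<longrightarrow> \<bar>u x t\<bar> < \<epsilon> \<and> \<bar>flux x t\<bar> < \<epsilon>"
proof -
  define \<eta> where "\<eta> = \<epsilon> / (1 + hi)"
  have hi: "0 < hi" by (rule medium.hi_pos)
  have eta: "0 < \<eta>" "\<eta> \<le> \<epsilon>" "hi * \<eta> \<le> \<epsilon>"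
    using hi e by (auto simp: \<eta>_def field_simps)
  have J_small: "\<bar>flux x t\<bar> < \<epsilon>" if "k \<in> {1..N}" "x \<in> closed_phase q k" "0 < t" "\<bar>v' k x t\<bar> < \<eta>" for k x t
  proof -
    have c: "1 / 2 * (\<sigma> k)\<^sup>2 \<le> hi" "0 < 1 / 2 * (\<sigma> k)\<^sup>2"       proof -
      show "1 / 2 * (\<sigma> k)\<^sup>2 \<le> hi" unfolding hi_def by (intro Max_ge finite_imageI imageI that) simp
      show "0 < 1 / 2 * (\<sigma> k)\<^sup>2" using \<sigma>_pos[OF that(1)] by simp
    qed
    have "\<bar>flux x t\<bar> = 1 / 2 * (\<sigma> k)\<^sup>2 * \<bar>v' k x t\<bar>"
      unfolding flux_phase[OF that(1-3)] abs_mult by simp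
    also have "\<dots> < 1 / 2 * (\<sigma> k)\<^sup>2 * \<eta>" using that(4) c(2) by (rule mult_strict_left_mono)
    also have "\<dots> \<le> hi * \<eta>" using c eta by (intro mult_right_mono) auto
    finally show ?thesis using eta by simp
  qed
  have N1: "1 \<in> {1..N}" "N \<in> {1..N}" using N by auto
  have ev: "\<forall>\<^sub>F x in at_top. \<forall>t\<in>{0<..T}. dist (v 1 x t) 0 < \<eta> \<and> dist (v' 1 x t) 0 < \<eta>"
    using uniform_limitD[OF component_decay(1)[OF T] eta(1)] uniform_limitD[OF component_decay(2)[OF T] eta(1)]
    by eventually_elim auto
  then obtain X1 where "\<forall>x\<ge>X1. \<forall>t\<in>{0<..T}. dist (v 1 x t) 0 < \<eta> \<and> dist (v' 1 x t) 0 < \<eta>"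
    unfolding eventually_at_top_linorder by blast
  then have X1: "\<bar>v 1 x t\<bar> < \<eta> \<and> \<bar>v' 1 x t\<bar> < \<eta>" if "X1 \<le> x" "t \<in> {0<..T}" for x t
    using that by (simp add: dist_real_def)
  have ev: "\<forall>\<^sub>F x in at_bot. \<forall>t\<in>{0<..T}. dist (v N x t) 0 < \<eta> \<and> dist (v' N x t) 0 < \<eta>"
    using uniform_limitD[OF component_decay(3)[OF T] eta(1)] uniform_limitD[OF component_decay(4)[OF T] eta(1)]
    by eventually_elim auto
  then obtain X2 where "\<forall>x\<le>X2. \<forall>t\<in>{0<..T}. dist (v N x t) 0 < \<eta> \<and> dist (v' N x t) 0 < \<eta>"
    unfolding eventually_at_bot_linorder by blast
  then have X2: "\<bar>v N x t\<bar> < \<eta> \<and> \<bar>v' N x t\<bar> < \<eta>" if "x \<le> X2" "t \<in> {0<..T}" for x t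
    using that by (simp add: dist_real_def)
  have "q 1 < \<infinity>" using q_less[of 0 1] q_0 N by auto
  then obtain c1 where c1: "q 1 \<le> ereal c1" by (cases "q 1") auto
  have "-\<infinity> < q (N - 1)" using q_less[of "N - 1" N] q_N N by auto
  then obtain c2 where c2: "ereal c2 \<le> q (N - 1)" by (cases "q (N - 1)") auto
  define R where "R = max (max \<bar>X1\<bar> \<bar>X2\<bar>) (max \<bar>c1\<bar> \<bar>c2\<bar>)"
  have R: "\<bar>X1\<bar> \<le> R" "\<bar>X2\<bar> \<le> R" "\<bar>c1\<bar> \<le> R" "\<bar>c2\<bar> \<le> R" by (simp_all add: R_def le_max_iff_disj)
  have "\<bar>u x t\<bar> < \<epsilon> \<and> \<bar>flux x t\<bar> < \<epsilon>" if x: "R \<le> \<bar>x\<bar>" and t: "0 < t" "t \<le> T" for x t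
  proof (cases "0 \<le> x")
    case True
    then have b: "X1 \<le> x" "c1 \<le> x" using x R by linarith+
    have "q 1 \<le> ereal x" using c1 b(2) by (meson ereal_less_eq(3) order_trans)
    then have xc: "x \<in> closed_phase q 1" using q_0 by (simp add: closed_phase_def)
    have "\<bar>v 1 x t\<bar> < \<eta> \<and> \<bar>v' 1 x t\<bar> < \<eta>" using b t by (intro X1) auto
    then show ?thesis using u[OF N1(1) xc t(1)] J_small[OF N1(1) xc t(1)] eta by simp
  next
    case False
    then have b: "x \<le> X2" "x \<le> c2" using x R by linarith+
    have "ereal x \<le> q (N - 1)" using c2 b(2) by (meson ereal_less_eq(3) order_trans)
    then have xc: "x \<in> closed_phase q N" using q_N by (simp add: closed_phase_def)
    have "\<bar>v N x t\<bar> < \<eta> \<and> \<bar>v' N x t\<bar> < \<eta>" using b t by (intro X2) auto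
    then show ?thesis using u[OF N1(2) xc t(1)] J_small[OF N1(2) xc t(1)] eta by simp
  qed
  then show ?thesis by blast
qed

text \<open>Also the end points of the source phase lie in a closed phase that starts from \<open>0\<close>. This is
  clear for the upper end point \<open>q (l - 1)\<close>, which \<open>phase_index\<close> assigns to phase \<open>l - 1\<close>; the lower one,
  \<open>q l\<close>, belongs to closed phase \<open>Suc l\<close>.\<close>

lemma off_source_phase:
  assumes z: "z \<notin> phase q l"
  shows "\<exists>k\<in>{1..N}. k \<noteq> l \<and> z \<in> closed_phase q k"
proof (cases "phase_index q z = l")
  case False
  then show ?thesis using phase_index(1) in_closed_phase_index by blast
next
  case True
  then have "q l \<le> ereal z" "ereal z < q (l - 1)" using phase_index[of z] by auto
  then have eq: "ereal z = q l" using z by (auto simp: phase_def)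
  then have "l \<noteq> N" using q_N by auto
  then have "l < N" using l(1) by simp
  then have "z \<in> closed_phase q (Suc l)" using q_decreasing[of l] eq by (simp add: closed_phase_def less_imp_le)
  then show ?thesis using \<open>l < N\<close> by (intro bexI[of _ "Suc l"]) auto
qed

lemma small_near_initial_point:
  assumes e: "\<epsilon> > 0"
  shows "\<exists>d>0. \<forall>z t. z \<notin> phase q l \<and> 0 < t \<and> dist (z, t) (x, 0) < d \<longrightarrow> \<bar>u z t\<bar> < \<epsilon>"
proof -
  have "\<exists>d>0. \<forall>z t. z \<in> closed_phase q k \<and> 0 < t \<and> dist (z, t) (x, 0) < d \<longrightarrow> \<bar>v k z t\<bar> < \<epsilon>"
    if k: "k \<in> {1..N} - {l}" for k
  proof (cases "x \<in> closed_phase q k")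
    case True
    have "\<forall>\<^sub>F p in at (x, 0) within closed_phase q k \<times> {0<..}. dist ((\<lambda>(z, t). v k z t) p) 0 < \<epsilon>"
      using zero_initially[OF _ _ True] k e by (intro tendstoD) auto
    then obtain d where "d > 0" "\<And>p. p \<in> closed_phase q k \<times> {0<..} \<Longrightarrow> p \<noteq> (x, 0) \<Longrightarrow> dist p (x, 0) < d \<Longrightarrow>
        dist ((\<lambda>(z, t). v k z t) p) 0 < \<epsilon>"
      unfolding eventually_at by blast
    then show ?thesis by (intro exI[of _ d]) force
  next
    case False
    have "open (- closed_phase q k)" using closed_closed_phase by (simp add: open_Compl)
    then obtain d where d: "d > 0" "ball x d \<subseteq> - closed_phase q k"
      using False by (meson Compl_iff openE)
    have "z \<notin> closed_phase q k" if "dist (z, t) (x, 0) < d" for z t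
    proof -
      have "dist z x \<le> dist (z, t) (x, 0)" using dist_fst_le[of "(z, t)" "(x, 0)"] by simp
      then have "z \<in> ball x d" using that by (simp add: dist_commute)
      then show ?thesis using d(2) by blast
    qed
    then show ?thesis using d(1) by blast
  qed
  then obtain dk where dk: "\<And>k. k \<in> {1..N} - {l} \<Longrightarrow> dk k > 0"
    "\<And>k z t. k \<in> {1..N} - {l} \<Longrightarrow> z \<in> closed_phase q k \<Longrightarrow> 0 < t \<Longrightarrow> dist (z, t) (x, 0) < dk k \<Longrightarrow> \<bar>v k z t\<bar> < \<epsilon>"
    by metis
  define d where "d = Min (insert 1 (dk ` ({1..N} - {l})))"
  have d: "d > 0" "\<And>k. k \<in> {1..N} - {l} \<Longrightarrow> d \<le> dk k"
    unfolding d_def using dk(1) by (auto intro: Min_le)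
  have "\<bar>u z t\<bar> < \<epsilon>" if z: "z \<notin> phase q l" and t: "0 < t" and dist: "dist (z, t) (x, 0) < d" for z t
  proof -
    obtain k where k: "k \<in> {1..N}" "k \<noteq> l" "z \<in> closed_phase q k" using off_source_phase[OF z] by blast
    then show ?thesis using dk(2)[of k z t] d(2)[of k] dist u[OF k(1,3) t] t by auto
  qed
  then show ?thesis using d(1) by blast
qed

text \<open>Compactness makes the pointwise statement uniform on bounded sets, and the decay at infinity covers
  the rest of the line.\<close>

lemma uniformly_zero_initially:
  assumes e: "\<epsilon> > 0"
  shows "\<exists>\<delta>>0. \<forall>x t. x \<notin> phase q l \<and> 0 < t \<and> t < \<delta> \<longrightarrow> \<bar>u x t\<bar> < \<epsilon>"
proof -
  obtain R where R: "\<And>x t. \<bar>x\<bar> \<ge> R \<Longrightarrow> 0 < t \<Longrightarrow> t \<le> 1 \<Longrightarrow> \<bar>u x t\<bar> < \<epsilon>"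
    using uniform_decay[OF zero_less_one e] by blast
  define K where "K = {-R..R} - phase q l"
  have K: "compact K" unfolding K_def by (intro compact_diff compact_Icc open_phase)
  have "\<forall>x. \<exists>d>0. \<forall>z t. z \<notin> phase q l \<and> 0 < t \<and> dist (z, t) (x, 0) < d \<longrightarrow> \<bar>u z t\<bar> < \<epsilon>"
    using small_near_initial_point[OF e] by blast
  then obtain d where d: "\<And>x. d x > 0"
    "\<And>x z t. z \<notin> phase q l \<Longrightarrow> 0 < t \<Longrightarrow> dist (z, t) (x, 0) < d x \<Longrightarrow> \<bar>u z t\<bar> < \<epsilon>"
    by metis
  have "K \<subseteq> (\<Union>x\<in>K. ball x (d x / 2))" using d(1) by force
  then obtain X where X: "X \<subseteq> K" "finite X" "K \<subseteq> (\<Union>x\<in>X. ball x (d x / 2))"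
    using compactE_image[OF K, of K "\<lambda>x. ball x (d x / 2)"] by auto
  define \<delta> where "\<delta> = Min (insert 1 ((\<lambda>x. d x / 2) ` X))"
  have \<delta>: "\<delta> > 0" "\<delta> \<le> 1" "\<delta> \<le> d x / 2" if "x \<in> X" for x
    unfolding \<delta>_def using X(2) d(1) that by (auto intro!: Min_le simp del: divide_le_eq_numeral1 le_divide_eq_numeral1)
  have \<delta>01: "\<delta> > 0" "\<delta> \<le> 1" unfolding \<delta>_def using X(2) d(1) by auto
  have "\<bar>u z t\<bar> < \<epsilon>" if z: "z \<notin> phase q l" and t: "0 < t" "t < \<delta>" for z t
  proof (cases "R \<le> \<bar>z\<bar>")
    case True
    then show ?thesis using t \<delta>01 by (intro R) auto
  next
    case False
    then have "z \<in> K" using z by (auto simp: K_def)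
    then obtain x where x: "x \<in> X" "dist x z < d x / 2" using X(3) by auto
    have "dist (z, t) (x, 0) \<le> dist z x + dist t 0"
      unfolding dist_Pair_Pair by (rule sqrt_sum_squares_le_sum) auto
    also have "\<dots> < d x"
      using x(2) t \<delta>(3)[OF x(1)] unfolding dist_real_def by linarith
    finally show ?thesis by (intro d(2)[OF z t(1)])
  qed
  then show ?thesis using \<delta>01(1) by blast
qed

lemma solution: "medium.solution u flux"
  unfolding medium.solution_def using solution_equations uniform_decay by blast

lemma starts_from: "medium.starts_from (phase q l) 0 u"
proof -
  have "medium.homogeneous_patch (phase q l)"
    unfolding medium.homogeneous_patch_def
    using open_phase interval_phase phase_off_interface[OF l(1)] diffusivity_phase[OF l(1)] by blast
  then show ?thesis
    unfolding medium.starts_from_def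
    using l(2) uniformly_zero_initially dirac unfolding tends_to_dirac_def pairing_def by blast
qed

end

lemma (in multiphase) multiphase_solution_kernel:
  assumes l: "l \<in> {1..N}" "0 \<in> phase q l" and sys: "multiphase_solution N \<sigma> q l u"
  shows "\<exists>J. medium.solution u J \<and> medium.starts_from (phase q l) 0 u"
proof -
  have "\<exists>v v'. multiphase_components N \<sigma> q l v v' u"
    using sys unfolding multiphase_solution_def
  proof (elim exE, goal_cases)
    case (1 v v')
    have "multiphase_components N \<sigma> q l v v' u" by unfold_locales (use 1 l in blast)+
    then show ?case by blast
  qed
  then obtain v v' where "multiphase_components N \<sigma> q l v v' u" by blast
  then interpret multiphase_components N \<sigma> q l v v' u .
  show ?thesis using solution starts_from by blast
qed

lemma shifted_le_iff: "shifted q y k \<le> ereal x \<longleftrightarrow> q k \<le> ereal (x + y)"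
  unfolding shifted_def by (cases "q k") auto

lemma shifted_eq_iff: "ereal x = shifted q y k \<longleftrightarrow> ereal (x + y) = q k"
  unfolding shifted_def by (cases "q k") auto

lemma shifted_less_iff: "ereal x < shifted q y k \<longleftrightarrow> ereal (x + y) < q k"
  unfolding shifted_def by (cases "q k") auto

lemma less_shifted_iff: "shifted q y k < ereal x \<longleftrightarrow> q k < ereal (x + y)"
  unfolding shifted_def by (cases "q k") auto

lemma phase_shifted: "x \<in> phase (shifted q y) k \<longleftrightarrow> x + y \<in> phase q k"
  by (simp add: phase_def shifted_less_iff less_shifted_iff)

lemma diffusivity_shifted: "diffusivity \<sigma> (shifted q y) = (\<lambda>x. diffusivity \<sigma> q (x + y))"
  by (simp add: diffusivity_def phase_index_def shifted_le_iff fun_eq_iff)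

lemma interfaces_shifted: "interfaces N (shifted q y) = (\<lambda>x. x - y) ` interfaces N q"
proof -
  have "x \<in> interfaces N (shifted q y) \<longleftrightarrow> x + y \<in> interfaces N q" for x
    by (simp add: interfaces_def shifted_eq_iff)
  then show ?thesis by force
qed

lemma (in multiphase) multiphase_shifted: "multiphase N \<sigma> (shifted q y)"
proof
  show "shifted q y (Suc k) < shifted q y k" if "k < N" for k
    using q_decreasing[OF that] unfolding shifted_def by (cases "q k"; cases "q (Suc k)") auto
qed (use N \<sigma>_pos q_0 q_N in \<open>auto simp: shifted_def\<close>)

lemma (in multiphase) shifted_solution_kernel:
  assumes m: "m \<in> {1..N}" "0 \<in> phase (shifted q y) m"
    and sys: "multiphase_solution N \<sigma> (shifted q y) m w"
  shows "medium.kernel_from y (\<lambda>x t. w (x - y) t)"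
proof -
  interpret shift: multiphase N \<sigma> "shifted q y" by (rule multiphase_shifted)
  have "shift.medium.kernel_from 0 w"
    using shift.multiphase_solution_kernel[OF m sys] unfolding shift.medium.kernel_from_def by blast
  then have "medium.kernel_from (0 + y) (\<lambda>x t. w (x - y) t)"
    unfolding diffusivity_shifted interfaces_shifted by (rule medium.kernel_translate)
  then show ?thesis by simp
qed

theorem proposition1:
  fixes N l :: nat and \<sigma> :: "nat \<Rightarrow> real" and q :: "nat \<Rightarrow> ereal"
  assumes "N \<ge> 1"
    and "\<forall>k\<in>{1..N}. \<sigma> k > 0"
    and "q 0 = \<infinity>" and "q N = -\<infinity>"
    and "\<forall>k<N. q (Suc k) < q k"
    and "l \<in> {1..N}" and "0 \<in> phase q l"
  shows
    "(\<forall>u w. multiphase_solution N \<sigma> q l u \<and> multiphase_solution N \<sigma> q l w \<longrightarrow>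
        (\<forall>x. \<forall>t>0. u x t = w x t)) \<and>
     (\<forall>u. multiphase_solution N \<sigma> q l u \<longrightarrow>
        (\<forall>t>0. (\<forall>x. u x t \<ge> 0) \<and> has_bochner_integral lborel (\<lambda>x. u x t) 1)) \<and>
     (\<forall>u :: (nat \<Rightarrow> ereal) \<Rightarrow> real \<Rightarrow> real \<Rightarrow> real.
        multiphase_solution N \<sigma> q l (u q) \<and>
        (\<forall>y. \<forall>m\<in>{1..N}. 0 \<in> phase (shifted q y) m \<longrightarrow>
           multiphase_solution N \<sigma> (shifted q y) m (u (shifted q y))) \<longrightarrow>
        (\<forall>s t x. 0 < s \<and> s < t \<longrightarrow>
           has_bochner_integral lborel
             (\<lambda>y. u q y s * u (shifted q y) (x - y) (t - s)) (u q x t)))"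
proof -
  interpret multiphase N \<sigma> q
    using assms by unfold_locales auto
  note l = assms(6,7)
  show ?thesis
  proof (intro conjI allI impI)
    fix u w x and t :: real
    assume uw: "multiphase_solution N \<sigma> q l u \<and> multiphase_solution N \<sigma> q l w" and "0 < t"
    then show "u x t = w x t"
      using multiphase_solution_kernel[OF l, of u] multiphase_solution_kernel[OF l, of w] medium.solution_unique by blast
  next
    fix u x and t :: real
    assume "multiphase_solution N \<sigma> q l u" "0 < t"
    then show "0 \<le> u x t"
      using multiphase_solution_kernel[OF l, of u] medium.solution_nonneg by blast
  next
    fix u and t :: real
    assume "multiphase_solution N \<sigma> q l u" "0 < t"
    then show "has_bochner_integral lborel (\<lambda>x. u x t) 1"
      using multiphase_solution_kernel[OF l, of u] medium.solution_mass by blast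
  next
    fix u :: "(nat \<Rightarrow> ereal) \<Rightarrow> real \<Rightarrow> real \<Rightarrow> real" and s t x :: real
    assume sys: "multiphase_solution N \<sigma> q l (u q) \<and>
        (\<forall>y. \<forall>m\<in>{1..N}. 0 \<in> phase (shifted q y) m \<longrightarrow>
           multiphase_solution N \<sigma> (shifted q y) m (u (shifted q y)))" and st: "0 < s \<and> s < t"
    have q0: "shifted q 0 = q" by (simp add: shifted_def fun_eq_iff zero_ereal_def[symmetric])
    define G where "G = (\<lambda>y x t. u (shifted q y) (x - y) t)"
    have "medium.kernel_from y (G y)" if "y \<notin> interfaces N q" for y
    proof -
      have "0 \<in> phase (shifted q y) (phase_index q y)"
        using off_interface_phase[OF that] by (simp add: phase_shifted)
      then show ?thesis
        unfolding G_def using sys phase_index(1)[of y] by (intro shifted_solution_kernel) auto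
    qed
    moreover have "0 \<notin> interfaces N q" by (rule phase_off_interface[OF l])
    ultimately have "has_bochner_integral lborel (\<lambda>y. G 0 y s * G y x (t - s)) (G 0 x t)"
      using st by (intro medium.semigroup) auto
    then show "has_bochner_integral lborel (\<lambda>y. u q y s * u (shifted q y) (x - y) (t - s)) (u q x t)"
      by (simp add: G_def q0)
  qed
qed

end
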